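(* Let $(R,\mathfrak m)$ be a $d$-dimensional Noetherian local ring, $d\ge 1$, and let $\mathcal I=\{I_n\}_{n\ge 0}$ be a graded family of proper ideals of $R$. For each $\mathfrak p\in\operatorname{Assh}(R)=\{\mathfrak p\in\operatorname{Spec}R:\dim R/\mathfrak p=d\}$, set $\Gamma_{\mathfrak p}(\mathcal I)=\{n\ge 1: I_n\nsubseteq\mathfrak p\}$. Then the limit $c_0(\mathcal I;R)=\lim_{n\to\infty}c_0(I_n;R)$ exists if and only if $\gcd\Gamma_{\mathfrak p}(\mathcal I)=1$ for every $\mathfrak p\in\operatorname{Assh}(R)$ such that $\Gamma_{\mathfrak p}(\mathcal I)\ne\varnothing$.
   Context: Multiplicity sequence: for a proper ideal $I$ of a Noetherian local ring $(R,\mathfrak m)$ of dimension $d\ge1$, the function $H_I(r,s)=\sum_{v=0}^{s}\lambda_R\bigl(I^v/(\mathfrak m^{r+1}I^v+I^{v+1})\bigr)$ ($\lambda_R$ = length) agrees for $r,s\gg0$ with a polynomial whose homogeneous part of total degree $d$ is $\sum_{i=0}^{d}\frac{c_i(I;R)}{(d-i)!\,i!}r^{d-i}s^i$; this defines the nonnegative integers $c_0(I;R),\dots,c_d(I;R)$. Graded family: a sequence $\mathcal I=\{I_n\}_{n\ge0}$ of ideals of $R$ with $I_0=R$, $I_mI_n\subseteq I_{m+n}$ for all $m,n\ge 0$, and $I_n\subsetneq R$ for $n\ge1$ ("graded family of proper ideals" refers to the terms with $n\ge1$). *)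

theory Defs
  imports
    "HOL-Computational_Algebra.Polynomial"
    "HOL-Library.Extended_Real"
    "HOL-Algebra.Ring_Divisibility"
    "HOL-Algebra.Ideal_Product"
    "HOL-Algebra.QuotRing"
    "HOL-Algebra.Module"
begin

text \<open>The supremum of the lengths \<open>n\<close> of strict chains \<open>C 0 \<subset> C 1 \<subset> \<dots> \<subset> C n\<close> of members of \<open>F\<close>.\<close>

definition chain_length :: "'a set set \<Rightarrow> enat" where
  "chain_length F =
     (SUP n \<in> {n. \<exists>C. (\<forall>i\<le>n. C i \<in> F) \<and> (\<forall>i<n. C i \<subset> C (Suc i))}. enat n)"

definition krull_dim :: "('a, 'b) ring_scheme \<Rightarrow> enat" where
  "krull_dim R = chain_length {p. primeideal p R}"

locale noetherian_local_ring = cring R + noetherian_ring R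
  for R (structure) +
  fixes \<mm> :: "'a set"
  assumes maximal: "maximalideal \<mm> R"
    and maximal_unique: "maximalideal J R \<Longrightarrow> J = \<mm>"

definition module_length :: "('a, 'b) ring_scheme \<Rightarrow> ('a, 'c, 'd) module_scheme \<Rightarrow> enat" where
  "module_length R M = chain_length {N. submodule N R M}"

text \<open>An ideal \<open>I\<close> of \<open>R\<close>, regarded as an \<open>R\<close>-module.\<close>

definition ideal_module :: "('a, 'b) ring_scheme \<Rightarrow> 'a set \<Rightarrow> ('a, 'a) module" where
  "ideal_module R I =
     \<lparr>carrier = I, mult = mult R, one = \<one>\<^bsub>R\<^esub>, zero = \<zero>\<^bsub>R\<^esub>, add = add R, smult = mult R\<rparr>"

text \<open>The quotient \<open>M/N\<close> of a module by a submodule. The union in the scalar multiplication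
  makes it independent of the representative: \<open>a (N + x) = N + a x\<close>. The module record extends
  the ring record, but the multiplicative fields play no role for modules and are left
  unspecified.\<close>

definition quotient_module ::
    "('a, 'b, 'c) module_scheme \<Rightarrow> 'b set \<Rightarrow> ('a, 'b set) module" where
  "quotient_module M N =
     \<lparr>carrier = a_rcosets\<^bsub>M\<^esub> N, mult = undefined, one = undefined, zero = N, add = set_add M,
      smult = (\<lambda>a X. \<Union>x\<in>X. N +>\<^bsub>M\<^esub> (a \<odot>\<^bsub>M\<^esub> x))\<rparr>"

text \<open>\<open>H\<^sub>I(r,s)\<close>. Powers of ideals are taken in the monoid of ideals of \<open>R\<close>, whose unit is \<open>R\<close>.\<close>

definition bigraded_hilbert_fun ::
    "('a, 'b) ring_scheme \<Rightarrow> 'a set \<Rightarrow> 'a set \<Rightarrow> nat \<Rightarrow> nat \<Rightarrow> enat" where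
  "bigraded_hilbert_fun R \<mm> I r s =
     (\<Sum>v = 0..s. module_length R
        (quotient_module (ideal_module R (I [^]\<^bsub>ideals_set R\<^esub> v))
           ((\<mm> [^]\<^bsub>ideals_set R\<^esub> (r + 1)) \<cdot>\<^bsub>R\<^esub> (I [^]\<^bsub>ideals_set R\<^esub> v)
              <+>\<^bsub>R\<^esub> (I [^]\<^bsub>ideals_set R\<^esub> (v + 1)))))"

text \<open>The polynomial in two variables agreeing with \<open>H\<^sub>I(r,s)\<close> for \<open>r, s \<ggreater> 0\<close>; such a polynomial is
  unique. As an element of \<open>\<real>[r][s]\<close>, its inner variable is \<open>r\<close> and its outer variable is \<open>s\<close>, so
  the coefficient of \<open>r\<^sup>a s\<^sup>b\<close> is \<open>coeff (coeff P b) a\<close>.\<close>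

definition bigraded_hilbert_poly ::
    "('a, 'b) ring_scheme \<Rightarrow> 'a set \<Rightarrow> 'a set \<Rightarrow> real poly poly" where
  "bigraded_hilbert_poly R \<mm> I =
     (THE P. \<exists>N. \<forall>r\<ge>N. \<forall>s\<ge>N.
        ereal_of_enat (bigraded_hilbert_fun R \<mm> I r s)
          = ereal (poly (poly P [:real s:]) (real r)))"

text \<open>The multiplicity sequence \<open>c\<^sub>i(I;R)\<close>, \<open>0 \<le> i \<le> d = dim R\<close>: the coefficient of
  \<open>r\<^bsup>d-i\<^esup> s\<^sup>i\<close> in the Hilbert polynomial is \<open>c\<^sub>i(I;R) / ((d - i)! i!)\<close>.\<close>

definition multiplicity_seq ::
    "('a, 'b) ring_scheme \<Rightarrow> 'a set \<Rightarrow> nat \<Rightarrow> 'a set \<Rightarrow> real" where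
  "multiplicity_seq R \<mm> i I =
     (let d = the_enat (krull_dim R) in
      fact (d - i) * fact i
        * Polynomial.coeff (Polynomial.coeff (bigraded_hilbert_poly R \<mm> I) i) (d - i))"

definition graded_family_of_proper_ideals ::
    "('a, 'b) ring_scheme \<Rightarrow> (nat \<Rightarrow> 'a set) \<Rightarrow> bool" where
  "graded_family_of_proper_ideals R \<I> \<longleftrightarrow>
     (\<forall>n. ideal (\<I> n) R) \<and>
     \<I> 0 = carrier R \<and>
     (\<forall>m n. \<I> m \<cdot>\<^bsub>R\<^esub> \<I> n \<subseteq> \<I> (m + n)) \<and>
     (\<forall>n\<ge>1. \<I> n \<subset> carrier R)"

definition Assh :: "('a, 'b) ring_scheme \<Rightarrow> 'a set set" where
  "Assh R = {p. primeideal p R \<and> krull_dim (R Quot p) = krull_dim R}"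

definition Gamma_set :: "'a set \<Rightarrow> (nat \<Rightarrow> 'a set) \<Rightarrow> nat set" where
  "Gamma_set p \<I> = {n. n \<ge> 1 \<and> \<not> \<I> n \<subseteq> p}"

end

theory Submission
  imports Defs "HOL-Library.List_Lexorder" "HOL-Real_Asymp.Real_Asymp"
begin

text \<open>The modules in the definition of \<open>H\<^sub>I(r,s)\<close> are subquotients of \<open>R\<close>, so all lengths are lengths of
  intervals in the lattice of ideals. Let \<open>\<ell>(A,r)\<close> be the length of \<open>R/(A + \<mm>\<^sup>r)\<close>.

  Counting standard monomials in generators of \<open>\<mm>\<close> and \<open>I\<close>, as in Groebner basis theory, shows that
  \<open>H\<^sub>I(r,s)\<close> is the number of exponents of bounded bidegree outside a monomial ideal, hence agrees with
  a polynomial for large \<open>r\<close> and \<open>s\<close>. By Artin-Rees, for fixed \<open>s\<close> it lies between two shifts of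
  \<open>\<ell>(I\<^bsup>s+1\<^esup>,r)\<close>, so \<open>c\<^sub>0(I;R)/d!\<close> is the limit of \<open>\<ell>(I\<^sup>s,r)/r\<^sup>d\<close> as \<open>r \<rightarrow> \<infinity>\<close>, for every large \<open>s\<close>.

  In a prime filtration of a subquotient, a factor \<open>R/q\<close> with \<open>dim R/q < d\<close> contributes only
  \<open>O(r\<^bsup>d-1\<^esup>)\<close> to the length, while one with \<open>q \<in> Assh(R)\<close> contributes at least a multiple of \<open>r\<^sup>d\<close>.
  Therefore \<open>c\<^sub>0(I;R)\<close> depends only on the set of those \<open>p \<in> Assh(R)\<close> that contain \<open>I\<close>, and increases
  strictly with it. For \<open>I = I\<^sub>n\<close> this is the set of \<open>p\<close> with \<open>n \<notin> \<Gamma>\<^sub>p\<close>. As \<open>p\<close> is prime, \<open>\<Gamma>\<^sub>p\<close> is closed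
  under addition, so it contains all large \<open>n\<close> if its gcd is 1. If some nonempty \<open>\<Gamma>\<^sub>p\<close> has another
  gcd, take \<open>M\<close> in all the nonempty \<open>\<Gamma>\<^sub>q\<close>: then \<open>c\<^sub>0(I\<^sub>n;R)\<close> is constant along \<open>n = k M\<close> and larger by a
  fixed amount along \<open>n = k M + 1\<close>.\<close>

no_notation Sum_Type.Plus (infixr "<+>" 65)

section \<open>Lengths of chains\<close>

text \<open>Lengths are suprema of chains, so they are treated by order theory: additivity comes
  from a strictly monotone rank, and isomorphism theorems become pairs of inverse monotone maps
  between families of ideals. Localization at a prime p is replaced by multipliers outside p. At
  fixed s, the limit in r yields the coefficient of r^d in the Hilbert polynomial, which is a priori
  a polynomial in s. For large s and t >= s, each p in Assh(R) admits an element outside p carrying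
  I^s into I^t, so the two lengths differ by O(r^(d-1)) and the limits agree. Hence this polynomial
  in s is constant, and the limit is the coefficient of r^d s^0, that is, c_0/d!. Artin-Rees costs a
  shift of r, so lower bounds are stated at arguments K r + c. This suffices because the limits are
  known to exist and may be taken along a subsequence. In the converse direction the fixed gap is
  the one between I_M and I_M p_0, where p_0 is the prime with bad gcd: each member of Assh(R)
  containing I_M p_0 contains every I_(kM+1).\<close>

definition has_chain :: "'a set set \<Rightarrow> nat \<Rightarrow> bool" where
  "has_chain F n \<longleftrightarrow> (\<exists>C. (\<forall>i\<le>n. C i \<in> F) \<and> (\<forall>i<n. C i \<subset> C (Suc i)))"

lemma has_chain_mono: "has_chain F n \<Longrightarrow> m \<le> n \<Longrightarrow> has_chain F m"
  unfolding has_chain_def by (meson le_trans less_le_trans)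

lemma has_chain_subset: "has_chain F n \<Longrightarrow> F \<subseteq> G \<Longrightarrow> has_chain G n"
  unfolding has_chain_def by blast

lemma chain_length_eq_Sup: "chain_length F = (SUP n \<in> {n. has_chain F n}. enat n)"
  unfolding chain_length_def has_chain_def ..

lemma has_chain_0: "has_chain F 0 \<longleftrightarrow> F \<noteq> {}"
  unfolding has_chain_def by auto

lemma has_chain_imp_le: "has_chain F n \<Longrightarrow> enat n \<le> chain_length F"
  unfolding chain_length_eq_Sup by (rule SUP_upper) simp

text \<open>A supremum of naturals above k is exceeded by one of them, and a longer chain can be
  truncated. Nonemptiness covers n = 0, since the supremum over no chains is also 0.\<close>

lemma le_chain_length_imp:
  assumes "F \<noteq> {}" "enat n \<le> chain_length F"
  shows "has_chain F n"
proof (cases n)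
  case 0
  then show ?thesis using assms has_chain_0 by blast
next
  case (Suc k)
  then have "enat k < (SUP n \<in> {n. has_chain F n}. enat n)"
    using assms(2) unfolding chain_length_eq_Sup
    by (metis Suc_ile_eq)
  then obtain m where "has_chain F m" "k < m"
    unfolding less_SUP_iff by auto
  then show ?thesis using Suc has_chain_mono by (metis Suc_leI)
qed

lemma chain_length_leI:
  assumes "\<And>n. has_chain F n \<Longrightarrow> enat n \<le> b"
  shows "chain_length F \<le> b"
  unfolding chain_length_eq_Sup by (rule SUP_least) (use assms in auto)

text \<open>The rank grows by at least one along each link. This takes the place of the
  Jordan-Hoelder theorem when a length is bounded from above.\<close>

lemma chain_length_le_rank:
  fixes f :: "'a set \<Rightarrow> nat"
  assumes "\<And>X. X \<in> F \<Longrightarrow> f X \<le> k"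
    and "\<And>X Y. X \<in> F \<Longrightarrow> Y \<in> F \<Longrightarrow> X \<subset> Y \<Longrightarrow> f X < f Y"
  shows "chain_length F \<le> enat k"
proof (rule chain_length_leI)
  fix n assume "has_chain F n"
  then obtain C where C: "\<forall>i\<le>n. C i \<in> F" "\<forall>i<n. C i \<subset> C (Suc i)"
    unfolding has_chain_def by blast
  have "i \<le> f (C i)" if "i \<le> n" for i
    using that
  proof (induction i)
    case (Suc i)
    then have "f (C i) < f (C (Suc i))" using C assms(2) by simp
    then show ?case using Suc by linarith
  qed simp
  then show "enat n \<le> enat k" using assms(1) C by (meson enat_ord_simps(1) le_refl le_trans)
qed

lemma chain_length_mono_map:
  assumes "\<And>X. X \<in> F \<Longrightarrow> f X \<in> G"
    and "\<And>X Y. X \<in> F \<Longrightarrow> Y \<in> F \<Longrightarrow> X \<subset> Y \<Longrightarrow> f X \<subset> f Y"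
  shows "chain_length F \<le> chain_length G"
proof (rule chain_length_leI)
  fix n assume "has_chain F n"
  then obtain C where C: "\<forall>i\<le>n. C i \<in> F" "\<forall>i<n. C i \<subset> C (Suc i)"
    unfolding has_chain_def by blast
  have "has_chain G n" unfolding has_chain_def
    by (rule exI[of _ "\<lambda>i. f (C i)"]) (use C assms in auto)
  then show "enat n \<le> chain_length G" by (rule has_chain_imp_le)
qed

lemma chain_length_subset: "F \<subseteq> G \<Longrightarrow> chain_length F \<le> chain_length G"
  by (rule chain_length_mono_map[of _ "\<lambda>x. x"]) auto

text \<open>Isomorphism theorems enter in this order-theoretic form: for (A + B)/A, for (A + (x))/A,
  for submodules of a quotient and for primes of a quotient ring.\<close>

lemma chain_length_eq_inverse:
  assumes "\<And>X. X \<in> F \<Longrightarrow> f X \<in> G" "\<And>Y. Y \<in> G \<Longrightarrow> g Y \<in> F"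
    and "\<And>X. X \<in> F \<Longrightarrow> g (f X) = X" "\<And>Y. Y \<in> G \<Longrightarrow> f (g Y) = Y"
    and "\<And>X Y. X \<in> F \<Longrightarrow> Y \<in> F \<Longrightarrow> X \<subseteq> Y \<Longrightarrow> f X \<subseteq> f Y"
    and "\<And>X Y. X \<in> G \<Longrightarrow> Y \<in> G \<Longrightarrow> X \<subseteq> Y \<Longrightarrow> g X \<subseteq> g Y"
  shows "chain_length F = chain_length G"
proof (rule antisym)
  show "chain_length F \<le> chain_length G"
    by (rule chain_length_mono_map[where f=f]) (use assms in \<open>auto simp: psubset_eq\<close>, metis)
  show "chain_length G \<le> chain_length F"
    by (rule chain_length_mono_map[where f=g]) (use assms in \<open>auto simp: psubset_eq\<close>, metis)
qed

lemma has_chain_snoc: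
  assumes "has_chain {K \<in> F. K \<subseteq> X} n" "Y \<in> F" "X \<subset> Y"
  shows "has_chain {K \<in> F. K \<subseteq> Y} (Suc n)"
proof -
  from assms obtain C where C: "\<forall>i\<le>n. C i \<in> F \<and> C i \<subseteq> X" "\<forall>i<n. C i \<subset> C (Suc i)"
    unfolding has_chain_def by blast
  have "C n \<subset> Y" "\<forall>i\<le>n. C i \<subseteq> Y" using C assms(3) by blast+
  then show ?thesis unfolding has_chain_def
    by (intro exI[of _ "\<lambda>i. if i \<le> n then C i else Y"])
      (use C assms(2) in \<open>auto simp: less_Suc_eq\<close>)
qed

lemma has_chain_append:
  assumes "has_chain {K \<in> F. K \<subseteq> B} a" "has_chain {K \<in> F. B \<subseteq> K} b"
  shows "has_chain F (a + b)"
proof -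
  from assms(1) obtain C where C: "\<forall>i\<le>a. C i \<in> F \<and> C i \<subseteq> B" "\<forall>i<a. C i \<subset> C (Suc i)"
    unfolding has_chain_def by blast
  from assms(2) obtain D where D: "\<forall>i\<le>b. D i \<in> F \<and> B \<subseteq> D i" "\<forall>i<b. D i \<subset> D (Suc i)"
    unfolding has_chain_def by blast
  \<comment> \<open>The second chain resumes at \<open>D 1\<close>: both \<open>C a\<close> and
    \<open>D 0\<close> may equal \<open>B\<close>, so the junction gives no extra link.\<close>
  define E where "E i = (if i \<le> a then C i else D (i - a))" for i
  have "E i \<in> F" if "i \<le> a + b" for i
    using that C D by (auto simp: E_def)
  moreover have "E i \<subset> E (Suc i)" if i: "i < a + b" for i
  proof -
    consider "i < a" | "i = a" | "i > a" by linarith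
    then show ?thesis
    proof cases
      case 2
      then have "b > 0" using i by simp
      then have "D 0 \<subset> D (Suc 0)" "B \<subseteq> D 0" using D by auto
      moreover have "C a \<subseteq> B" using C by auto
      ultimately have "C a \<subset> D (Suc 0)" by blast
      then show ?thesis using 2 by (simp add: E_def)
    next
      case 3
      then have "D (i - a) \<subset> D (Suc (i - a))" using D i by auto
      then show ?thesis using 3 by (simp add: E_def Suc_diff_le)
    qed (use C in \<open>auto simp: E_def\<close>)
  qed
  ultimately show ?thesis unfolding has_chain_def by blast
qed

section \<open>Ideals\<close>

text \<open>For an ideal C containing A this is the annihilator of C/A, and for C = {x} the
  annihilator of the class of x. Arbitrary sets C allow both uses.\<close>

definition ideal_colon :: "('a, 'b) ring_scheme \<Rightarrow> 'a set \<Rightarrow> 'a set \<Rightarrow> 'a set" where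
  "ideal_colon R A C = {y \<in> carrier R. \<forall>c\<in>C. y \<otimes>\<^bsub>R\<^esub> c \<in> A}"

definition ideal_interval :: "('a, 'b) ring_scheme \<Rightarrow> 'a set \<Rightarrow> 'a set \<Rightarrow> 'a set set" where
  "ideal_interval R A B = {K. ideal K R \<and> A \<subseteq> K \<and> K \<subseteq> B}"

definition interval_length :: "('a, 'b) ring_scheme \<Rightarrow> 'a set \<Rightarrow> 'a set \<Rightarrow> enat" where
  "interval_length R A B = chain_length (ideal_interval R A B)"

context cring
begin

abbreviation colon where "colon \<equiv> ideal_colon R"
abbreviation ilen where "ilen \<equiv> interval_length R"

lemma ideal_addD: "ideal I R \<Longrightarrow> a \<in> I \<Longrightarrow> b \<in> I \<Longrightarrow> a \<oplus> b \<in> I"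
  by (simp add: additive_subgroup.a_closed ideal.axioms(1))

lemma ideal_zeroD: "ideal I R \<Longrightarrow> \<zero> \<in> I"
  by (simp add: additive_subgroup.zero_closed ideal.axioms(1))

lemma ideal_subset: "ideal I R \<Longrightarrow> I \<subseteq> carrier R"
  by (simp add: additive_subgroup.a_subset ideal.axioms(1))

lemma ideal_uminusD: "ideal I R \<Longrightarrow> a \<in> I \<Longrightarrow> \<ominus> a \<in> I"
  by (simp add: additive_subgroup.a_inv_closed ideal.axioms(1))

lemma ideal_minusD: "ideal I R \<Longrightarrow> a \<in> I \<Longrightarrow> b \<in> I \<Longrightarrow> a \<ominus> b \<in> I"
  by (simp add: ideal_addD ideal_uminusD a_minus_def)

lemma ideal_multD: "ideal I R \<Longrightarrow> a \<in> I \<Longrightarrow> r \<in> carrier R \<Longrightarrow> r \<otimes> a \<in> I"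
  by (simp add: ideal.I_l_closed)

lemma add_minus_cancel_left:
  assumes "a \<in> carrier R" "b \<in> carrier R"
  shows "(a \<oplus> b) \<ominus> a = b"
proof -
  have "(a \<oplus> b) \<ominus> a = (b \<oplus> a) \<oplus> \<ominus> a" using assms by (simp add: a_minus_def a_comm)
  also have "\<dots> = b \<oplus> (a \<oplus> \<ominus> a)" using assms by (simp only: a_assoc a_inv_closed)
  also have "\<dots> = b" using assms by (simp add: r_neg)
  finally show ?thesis .
qed

lemma idealI_elem:
  assumes "I \<subseteq> carrier R" "\<zero> \<in> I" "\<And>a b. a \<in> I \<Longrightarrow> b \<in> I \<Longrightarrow> a \<oplus> b \<in> I"
    and "\<And>a r. a \<in> I \<Longrightarrow> r \<in> carrier R \<Longrightarrow> r \<otimes> a \<in> I"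
  shows "ideal I R"
proof (rule idealI)
  show "subgroup I (add_monoid R)"
  proof (rule add.subgroupI)
    fix a assume a: "a \<in> I"
    then have "(\<ominus> \<one>) \<otimes> a \<in> I" using assms(4) by simp
    moreover have "(\<ominus> \<one>) \<otimes> a = \<ominus> a" using a assms(1) l_minus by auto
    ultimately show "\<ominus> a \<in> I" by simp
  qed (use assms in auto)
next
  fix a x assume "a \<in> I" "x \<in> carrier R"
  then show "a \<otimes> x \<in> I" using assms(1,4) m_comm by (metis subsetD)
qed (use assms ring_axioms in auto)

lemma set_add_elemI: "a \<in> A \<Longrightarrow> b \<in> B \<Longrightarrow> a \<oplus> b \<in> A <+> B"
  unfolding set_add_def' by blast

lemma set_add_elemE:
  assumes "x \<in> A <+> B"
  obtains a b where "a \<in> A" "b \<in> B" "x = a \<oplus> b"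
  using assms unfolding set_add_def' by blast

lemma add_ideals_upper1: "ideal A R \<Longrightarrow> ideal B R \<Longrightarrow> A \<subseteq> A <+> B"
proof
  fix x assume "ideal A R" "ideal B R" "x \<in> A"
  then have "x \<oplus> \<zero> \<in> A <+> B" by (simp add: set_add_elemI ideal_zeroD)
  moreover have "x \<in> carrier R" using \<open>x \<in> A\<close> \<open>ideal A R\<close> by (rule ideal.Icarr[rotated])
  ultimately show "x \<in> A <+> B" by simp
qed

lemma add_ideals_upper2: "ideal A R \<Longrightarrow> ideal B R \<Longrightarrow> B \<subseteq> A <+> B"
  by (metis add_ideals_upper1 ideal_subset set_add_comm)

lemma add_ideals_least: "ideal K R \<Longrightarrow> A \<subseteq> K \<Longrightarrow> B \<subseteq> K \<Longrightarrow> A <+> B \<subseteq> K"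
  by (auto elim!: set_add_elemE intro: ideal_addD)

lemma set_add_mono: "A \<subseteq> A' \<Longrightarrow> B \<subseteq> B' \<Longrightarrow> A <+> B \<subseteq> A' <+> B'"
  unfolding set_add_def' by blast

lemma add_ideals_absorb1: "ideal A R \<Longrightarrow> ideal B R \<Longrightarrow> B \<subseteq> A \<Longrightarrow> A <+> B = A"
  by (meson add_ideals_least add_ideals_upper1 equalityI subset_refl)

lemma add_ideals_assoc:
  "ideal A R \<Longrightarrow> ideal B R \<Longrightarrow> ideal C R \<Longrightarrow> (A <+> B) <+> C = A <+> (B <+> C)"
  by (simp add: add.set_mult_assoc ideal_subset set_add_defs(1))

lemma add_ideals_modular:
  assumes "ideal A R" "ideal B R" "ideal C R" "A \<subseteq> C"
  shows "(A <+> B) \<inter> C = A <+> (B \<inter> C)"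
proof
  show "(A <+> B) \<inter> C \<subseteq> A <+> (B \<inter> C)"
  proof
    fix x assume x: "x \<in> (A <+> B) \<inter> C"
    then obtain a b where ab: "a \<in> A" "b \<in> B" "x = a \<oplus> b" by (auto elim: set_add_elemE)
    then have c: "a \<in> carrier R" "b \<in> carrier R" using assms ideal_subset by auto
    have "x \<ominus> a \<in> C" using x ab assms by (auto intro: ideal_minusD)
    also have "x \<ominus> a = b" unfolding ab using c by (rule add_minus_cancel_left)
    finally show "x \<in> A <+> (B \<inter> C)" using ab by (auto intro: set_add_elemI)
  qed
  have "A <+> (B \<inter> C) \<subseteq> C"
    by (rule add_ideals_least) (use assms in auto)
  then show "A <+> (B \<inter> C) \<subseteq> (A <+> B) \<inter> C"
    using set_add_mono[of A A "B \<inter> C" B] by auto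
qed

lemma ideal_PIdl: "x \<in> carrier R \<Longrightarrow> ideal (PIdl x) R"
  by (rule cgenideal_ideal)

lemma PIdl_subset_iff: "x \<in> carrier R \<Longrightarrow> ideal K R \<Longrightarrow> PIdl x \<subseteq> K \<longleftrightarrow> x \<in> K"
  using cgenideal_minimal cgenideal_self by blast

lemma in_PIdlE:
  assumes "y \<in> PIdl x" obtains r where "r \<in> carrier R" "y = r \<otimes> x"
  using assms unfolding cgenideal_def by blast

lemma Idl_insert:
  assumes "x \<in> carrier R" "S \<subseteq> carrier R"
  shows "Idl (insert x S) = PIdl x <+> Idl S"
proof
  have ids: "ideal (PIdl x) R" "ideal (Idl S) R" using assms genideal_ideal ideal_PIdl by auto
  have "x \<in> PIdl x" "S \<subseteq> Idl S" using assms by (auto simp: cgenideal_self genideal_self)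
  then show "Idl (insert x S) \<subseteq> PIdl x <+> Idl S"
    by (intro genideal_minimal add_ideals ids) (use add_ideals_upper1[OF ids] add_ideals_upper2[OF ids] in auto)
  have xS: "insert x S \<subseteq> carrier R" using assms by auto
  have ii: "ideal (Idl (insert x S)) R" "insert x S \<subseteq> Idl (insert x S)"
    using genideal_ideal[OF xS] genideal_self[OF xS] by auto
  then show "PIdl x <+> Idl S \<subseteq> Idl (insert x S)"
    by (intro add_ideals_least genideal_minimal ii(1)) (auto simp: PIdl_subset_iff assms)
qed

lemma Idl_empty: "Idl {} = {\<zero>}"
  by (metis bot.extremum genideal_ideal genideal_minimal ideal_zeroD empty_subsetI insert_subset
      subset_antisym zeroideal)

lemma ideal_colon_ideal:
  assumes "ideal A R" "C \<subseteq> carrier R"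
  shows "ideal (colon A C) R"
proof (rule idealI_elem)
  fix a b assume a: "a \<in> colon A C" "b \<in> colon A C"
  show "a \<oplus> b \<in> colon A C"
    unfolding ideal_colon_def
  proof (intro CollectI conjI ballI)
    fix c assume "c \<in> C"
    then have "a \<otimes> c \<oplus> b \<otimes> c \<in> A" using a assms(1) by (auto simp: ideal_colon_def intro: ideal_addD)
    then show "(a \<oplus> b) \<otimes> c \<in> A" using a \<open>c \<in> C\<close> assms by (auto simp: ideal_colon_def l_distr subsetD)
  qed (use a in \<open>auto simp: ideal_colon_def\<close>)
next
  fix a r assume a: "a \<in> colon A C" "r \<in> carrier R"
  show "r \<otimes> a \<in> colon A C"
    unfolding ideal_colon_def
  proof (intro CollectI conjI ballI)
    fix c assume "c \<in> C"
    then have "r \<otimes> (a \<otimes> c) \<in> A" using a assms(1) by (auto simp: ideal_colon_def intro: ideal_multD)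
    then show "(r \<otimes> a) \<otimes> c \<in> A" using a \<open>c \<in> C\<close> assms by (auto simp: ideal_colon_def m_assoc subsetD)
  qed (use a in \<open>auto simp: ideal_colon_def\<close>)
qed (use assms ideal_zeroD in \<open>auto simp: ideal_colon_def subsetD\<close>)

lemma ideal_colon_elem_ideal: "ideal A R \<Longrightarrow> x \<in> carrier R \<Longrightarrow> ideal (colon A {x}) R"
  by (rule ideal_colon_ideal) auto

lemma subset_ideal_colon: "ideal A R \<Longrightarrow> C \<subseteq> carrier R \<Longrightarrow> A \<subseteq> colon A C"
  unfolding ideal_colon_def using ideal.Icarr[of A R] ideal.I_r_closed[of A R] by blast

text \<open>Transports annihilation one step down a prime filtration: a multiplier s outside a prime
  p makes the factor generated by x disappear, as localizing at p would.\<close>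

lemma ideal_colon_mult_add_PIdl:
  assumes "ideal A R" "x \<in> carrier R" "s \<in> colon A {x}" "z \<in> A <+> PIdl x"
  shows "s \<otimes> z \<in> A"
proof -
  obtain a k where ak: "a \<in> A" "k \<in> carrier R" "z = a \<oplus> k \<otimes> x"
    using assms(4) by (auto elim!: set_add_elemE in_PIdlE)
  have s: "s \<in> carrier R" "s \<otimes> x \<in> A" using assms(3) by (auto simp: ideal_colon_def)
  have "s \<otimes> z = s \<otimes> a \<oplus> k \<otimes> (s \<otimes> x)"
    using ak s assms(2) ideal.Icarr[OF assms(1) ak(1)] by (simp add: r_distr m_lcomm)
  then show ?thesis
    using ideal_addD[OF assms(1) ideal_multD[OF assms(1) ak(1) s(1)] ideal_multD[OF assms(1) s(2) ak(2)]] by simp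
qed

lemma ideal_proper_iff: "ideal A R \<Longrightarrow> A = carrier R \<longleftrightarrow> \<one> \<in> A"
  using ideal.one_imp_carrier by auto

lemma ideal_prod_mono: "A \<subseteq> A' \<Longrightarrow> B \<subseteq> B' \<Longrightarrow> A \<cdot> B \<subseteq> A' \<cdot> B'"
proof
  fix x assume AB: "A \<subseteq> A'" "B \<subseteq> B'" and "x \<in> A \<cdot> B"
  from this(3) show "x \<in> A' \<cdot> B'"
    by induction (use AB in \<open>auto intro: ideal_prod.intros\<close>)
qed

lemma ideal_prod_least:
  assumes "ideal K R" "\<And>a b. a \<in> A \<Longrightarrow> b \<in> B \<Longrightarrow> a \<otimes> b \<in> K"
  shows "A \<cdot> B \<subseteq> K"
proof
  fix x assume "x \<in> A \<cdot> B"
  then show "x \<in> K" by induction (use assms in \<open>auto intro: ideal_addD\<close>)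
qed

text \<open>Bilinearity is used one factor at a time: the elements multiplying T into K form an
  ideal containing S, hence \<open>Idl S\<close>, and then the same argument is applied to
  T.\<close>

lemma ideal_prod_Idl_least:
  assumes "ideal K R" "S \<subseteq> carrier R" "T \<subseteq> carrier R" "\<And>a b. a \<in> S \<Longrightarrow> b \<in> T \<Longrightarrow> a \<otimes> b \<in> K"
  shows "(Idl S) \<cdot> (Idl T) \<subseteq> K"
proof (rule ideal_prod_least[OF assms(1)])
  fix a b assume a: "a \<in> Idl S" and b: "b \<in> Idl T"
  have "S \<subseteq> colon K T" using assms by (auto simp: ideal_colon_def)
  then have *: "Idl S \<subseteq> colon K T"
    by (intro genideal_minimal ideal_colon_ideal) (use assms in auto)
  have "T \<subseteq> colon K (Idl S)"
  proof (intro subsetI)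
    fix t assume t: "t \<in> T"
    have "t \<otimes> c \<in> K" if "c \<in> Idl S" for c
    proof -
      have "c \<otimes> t \<in> K" "c \<in> carrier R" using *[THEN subsetD, OF that] t by (auto simp: ideal_colon_def)
      then show ?thesis using t assms(3) m_comm[of t c] by auto
    qed
    then show "t \<in> colon K (Idl S)" using t assms(3) by (auto simp: ideal_colon_def)
  qed
  then have "Idl T \<subseteq> colon K (Idl S)"
    by (intro genideal_minimal ideal_colon_ideal) (use assms genideal_ideal[OF assms(2)] ideal_subset oneideal in auto)
  then have "b \<otimes> a \<in> K" using a b by (auto simp: ideal_colon_def)
  then show "a \<otimes> b \<in> K" using a b assms(2,3) genideal_ideal m_comm by (metis ideal.Icarr)
qed

subsection \<open>Length of an interval of ideals\<close>

lemma ideal_interval_ne: "ideal A R \<Longrightarrow> A \<subseteq> B \<Longrightarrow> ideal_interval R A B \<noteq> {}"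
  unfolding ideal_interval_def by auto

lemma interval_length_refl [simp]: "ilen A A = 0"
proof -
  have "chain_length (ideal_interval R A A) \<le> enat 0"
    by (rule chain_length_le_rank[where f="\<lambda>_. 0"]) (auto simp: ideal_interval_def)
  then show ?thesis by (simp add: interval_length_def zero_enat_def[symmetric])
qed

lemma interval_length_mono:
  "A' \<subseteq> A \<Longrightarrow> B \<subseteq> B' \<Longrightarrow> ilen A B \<le> ilen A' B'"
  unfolding interval_length_def by (rule chain_length_subset) (auto simp: ideal_interval_def)

text \<open>A longest chain below X is prolonged by Y; finiteness of the length ensures that a
  longest chain exists.\<close>

lemma interval_length_less:
  assumes "ideal A R" "ideal X R" "ideal Y R" "A \<subseteq> X" "X \<subset> Y" "ilen A X \<noteq> \<infinity>"
  shows "ilen A X < ilen A Y"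
proof -
  obtain n where n: "ilen A X = enat n" using assms(6) by auto
  have "has_chain (ideal_interval R A X) n"
    using n assms by (intro le_chain_length_imp ideal_interval_ne) (auto simp: interval_length_def)
  moreover have "ideal_interval R A X = {K \<in> {K. ideal K R \<and> A \<subseteq> K}. K \<subseteq> X}" for X
    by (auto simp: ideal_interval_def)
  ultimately have "has_chain (ideal_interval R A Y) (Suc n)"
    using has_chain_snoc[of "{K. ideal K R \<and> A \<subseteq> K}" X n Y] assms by auto
  then have "enat (Suc n) \<le> ilen A Y"
    unfolding interval_length_def by (rule has_chain_imp_le)
  then show ?thesis using n by (metis Suc_ile_eq)
qed

lemma interval_length_add_ge:
  assumes "ideal A R" "ideal B R" "ideal C R" "A \<subseteq> B" "B \<subseteq> C"
  shows "ilen A B + ilen B C \<le> ilen A C"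
proof -
  have *: "enat n \<le> ilen A C"
    if ab: "enat a \<le> ilen A B" "enat b \<le> ilen B C" "n = a + b" for n a b
  proof -
    have "has_chain (ideal_interval R A B) a" "has_chain (ideal_interval R B C) b"
      using ab le_chain_length_imp[OF ideal_interval_ne[OF assms(1,4)]]
        le_chain_length_imp[OF ideal_interval_ne[OF assms(2,5)]] by (auto simp: interval_length_def)
    moreover have "ideal_interval R A B \<subseteq> {K \<in> ideal_interval R A C. K \<subseteq> B}"
      "ideal_interval R B C \<subseteq> {K \<in> ideal_interval R A C. B \<subseteq> K}"
      using assms(4,5) by (auto simp: ideal_interval_def)
    ultimately have "has_chain {K \<in> ideal_interval R A C. K \<subseteq> B} a" "has_chain {K \<in> ideal_interval R A C. B \<subseteq> K} b"
      by (blast intro: has_chain_subset)+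
    from has_chain_append[OF this] show ?thesis
      using ab(3) by (simp add: interval_length_def has_chain_imp_le)
  qed
  \<comment> \<open>If one part has infinite length, it has chains of every length, and so has the
    whole interval.\<close>
  have inf: "z = \<infinity>" if "\<And>n. enat n \<le> z" for z
    using that[of "Suc (the_enat z)"] by (cases z) auto
  show ?thesis
  proof (cases "ilen A B"; cases "ilen B C")
    fix a b assume "ilen A B = enat a" "ilen B C = enat b"
    then show ?thesis using * by auto
  qed (use *[of _ 0] *[of 0] inf[of "ilen A C"] in \<open>auto simp: zero_enat_def[symmetric]\<close>)
qed

text \<open>This is the absence of a pentagon in the modular lattice of ideals. It makes the rank in
  \<open>interval_length_add\<close> strictly monotone.\<close>

lemma ideal_eq_by_modular:
  assumes "ideal K R" "ideal L R" "ideal B R" "K \<subseteq> L" "K \<inter> B = L \<inter> B" "K <+> B = L <+> B"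
  shows "K = L"
proof -
  have "L = (K <+> B) \<inter> L" using add_ideals_upper1[of L B] assms by auto
  also have "\<dots> = K <+> (B \<inter> L)" using assms by (intro add_ideals_modular) auto
  also have "\<dots> = K" using assms by (intro add_ideals_absorb1 i_intersect) auto
  finally show ?thesis by simp
qed

theorem interval_length_add:
  assumes "ideal A R" "ideal B R" "ideal C R" "A \<subseteq> B" "B \<subseteq> C"
  shows "ilen A C = ilen A B + ilen B C"
proof (rule antisym[OF _ interval_length_add_ge[OF assms]])
  show "ilen A C \<le> ilen A B + ilen B C"
  proof (cases "ilen A B = \<infinity> \<or> ilen B C = \<infinity>")
    case False
    \<comment> \<open>The rank of K adds the length of its part below B to that of its join with B,
      mirroring the exact sequence 0 -> B/A -> C/A -> C/B -> 0.\<close>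
    define u where "u K = ilen A (K \<inter> B)" for K
    define v where "v K = ilen B (K <+> B)" for K
    have fin: "u K \<le> ilen A B" "v K \<le> ilen B C"
      if "K \<in> ideal_interval R A C" for K
    proof -
      have K: "ideal K R" "A \<subseteq> K" "K \<subseteq> C" using that by (auto simp: ideal_interval_def)
      have "K <+> B \<subseteq> C" using K assms by (intro add_ideals_least)
      then show "u K \<le> ilen A B" "v K \<le> ilen B C"
        by (auto simp: u_def v_def intro!: interval_length_mono)
    qed
    have fin': "u K \<noteq> \<infinity>" "v K \<noteq> \<infinity>" if "K \<in> ideal_interval R A C" for K
      using fin[OF that] False by (metis enat_ord_simps(5))+
    have "chain_length (ideal_interval R A C) \<le>
       enat (the_enat (ilen A B) + the_enat (ilen B C))"
    proof (rule chain_length_le_rank[where f="\<lambda>K. the_enat (u K) + the_enat (v K)"])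
      fix K assume K: "K \<in> ideal_interval R A C"
      have "the_enat (u K) \<le> the_enat (ilen A B)"
        "the_enat (v K) \<le> the_enat (ilen B C)"
        using fin[OF K] fin'[OF K] False by auto
      then show "the_enat (u K) + the_enat (v K) \<le> the_enat (ilen A B) + the_enat (ilen B C)"
        by simp
    next
      fix K L assume K: "K \<in> ideal_interval R A C" and L: "L \<in> ideal_interval R A C" and KL: "K \<subset> L"
      have i: "ideal K R" "ideal L R" "A \<subseteq> K" "A \<subseteq> L" using K L by (auto simp: ideal_interval_def)
      have le: "u K \<le> u L" "v K \<le> v L"
        unfolding u_def v_def using KL set_add_mono[of K L B B] by (auto intro!: interval_length_mono)
      have "u K < u L \<or> v K < v L"
      proof (cases "K \<inter> B = L \<inter> B")
        case True
        then have "K <+> B \<noteq> L <+> B" using ideal_eq_by_modular[of K L B] i KL assms by blast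
        then have "K <+> B \<subset> L <+> B" using KL set_add_mono[of K L B B] by auto
        then have "v K < v L" unfolding v_def
          using fin'[OF K] assms i by (intro interval_length_less add_ideals add_ideals_upper2) (auto simp: v_def)
        then show ?thesis ..
      next
        case False
        then have "K \<inter> B \<subset> L \<inter> B" using KL by auto
        then have "u K < u L" unfolding u_def
          using fin'[OF K] assms i by (intro interval_length_less i_intersect) (auto simp: u_def)
        then show ?thesis ..
      qed
      then show "the_enat (u K) + the_enat (v K) < the_enat (u L) + the_enat (v L)"
        using le fin'[OF K] fin'[OF L] by auto
    qed
    then show ?thesis using False by (auto simp: interval_length_def)
  qed auto
qed

text \<open>The second isomorphism theorem: adding A and intersecting with B are mutually inverse by
  the modular law.\<close>

lemma interval_length_diamond:
  assumes "ideal A R" "ideal B R"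
  shows "ilen (A \<inter> B) B = ilen A (A <+> B)"
proof (unfold interval_length_def, rule chain_length_eq_inverse[where f="\<lambda>K. A <+> K" and g="\<lambda>L. L \<inter> B"])
  fix K assume "K \<in> ideal_interval R (A \<inter> B) B"
  then have K: "ideal K R" "A \<inter> B \<subseteq> K" "K \<subseteq> B" by (auto simp: ideal_interval_def)
  show "A <+> K \<in> ideal_interval R A (A <+> B)"
    using K assms by (auto simp: ideal_interval_def add_ideals intro: set_add_mono[THEN subsetD] add_ideals_upper1[THEN subsetD])
  have "(A <+> K) \<inter> B = (K <+> A) \<inter> B" using set_add_comm assms K ideal_subset by metis
  also have "\<dots> = K <+> (A \<inter> B)" using K assms by (intro add_ideals_modular)
  also have "\<dots> = K" using K assms by (intro add_ideals_absorb1 i_intersect)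
  finally show "(A <+> K) \<inter> B = K" .
next
  fix L assume "L \<in> ideal_interval R A (A <+> B)"
  then have L: "ideal L R" "A \<subseteq> L" "L \<subseteq> A <+> B" by (auto simp: ideal_interval_def)
  show "L \<inter> B \<in> ideal_interval R (A \<inter> B) B" using L assms by (auto simp: ideal_interval_def i_intersect)
  have "A <+> (L \<inter> B) = (A <+> B) \<inter> L" using L assms by (subst add_ideals_modular) (auto simp: Int_commute)
  then show "A <+> (L \<inter> B) = L" using L by auto
qed (auto intro: set_add_mono[THEN subsetD])

lemma ideal_image_mult:
  assumes "ideal K R" "x \<in> carrier R"
  shows "ideal ((\<lambda>k. k \<otimes> x) ` K) R"
proof -
  have Kc: "k \<in> carrier R" if "k \<in> K" for k using that assms(1) ideal_subset by auto
  show ?thesis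
  proof (rule idealI_elem)
    have "\<zero> \<otimes> x \<in> (\<lambda>k. k \<otimes> x) ` K" using assms(1) ideal_zeroD by blast
    then show "\<zero> \<in> (\<lambda>k. k \<otimes> x) ` K" using assms by simp
    fix a b assume "a \<in> (\<lambda>k. k \<otimes> x) ` K" "b \<in> (\<lambda>k. k \<otimes> x) ` K"
    then obtain k l where "k \<in> K" "l \<in> K" "a = k \<otimes> x" "b = l \<otimes> x" by auto
    then have "a \<oplus> b = (k \<oplus> l) \<otimes> x" "k \<oplus> l \<in> K" using assms Kc by (auto simp: l_distr ideal_addD)
    then show "a \<oplus> b \<in> (\<lambda>k. k \<otimes> x) ` K" by blast
  next
    fix a r assume "a \<in> (\<lambda>k. k \<otimes> x) ` K" "r \<in> carrier R"
    then obtain k where "k \<in> K" "a = k \<otimes> x" by auto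
    then have "r \<otimes> a = (r \<otimes> k) \<otimes> x" "r \<otimes> k \<in> K" using assms Kc \<open>r \<in> carrier R\<close> by (auto simp: m_assoc ideal_multD)
    then show "r \<otimes> a \<in> (\<lambda>k. k \<otimes> x) ` K" by blast
  qed (use Kc assms in auto)
qed

text \<open>Multiplication by x identifies R/(A : x) with (A + (x))/A. On ideals it is the map from
  K to A + K x, with inverse L to (L : x).\<close>

lemma interval_length_colon:
  assumes "ideal A R" "x \<in> carrier R"
  shows "ilen A (A <+> PIdl x) = ilen (colon A {x}) (carrier R)"
proof (unfold interval_length_def, rule sym,
    rule chain_length_eq_inverse[where f="\<lambda>K. A <+> (\<lambda>k. k \<otimes> x) ` K" and g="\<lambda>L. colon L {x}"])
  fix K assume "K \<in> ideal_interval R (colon A {x}) (carrier R)"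
  then have K: "ideal K R" "colon A {x} \<subseteq> K" by (auto simp: ideal_interval_def)
  have Kc: "k \<in> carrier R" if "k \<in> K" for k using that K ideal_subset by auto
  have Ki: "ideal ((\<lambda>k. k \<otimes> x) ` K) R" by (rule ideal_image_mult[OF K(1) assms(2)])
  have "(\<lambda>k. k \<otimes> x) ` K \<subseteq> PIdl x" using Kc unfolding cgenideal_def by blast
  then show "A <+> (\<lambda>k. k \<otimes> x) ` K \<in> ideal_interval R A (A <+> PIdl x)"
    unfolding ideal_interval_def using Ki assms add_ideals add_ideals_upper1 set_add_mono[of A A _ "PIdl x"]
    by (auto simp del: set_add_defs)
  show "colon (A <+> (\<lambda>k. k \<otimes> x) ` K) {x} = K"
  proof
    show "K \<subseteq> colon (A <+> (\<lambda>k. k \<otimes> x) ` K) {x}"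
      using Kc add_ideals_upper2[OF assms(1) Ki] by (auto simp: ideal_colon_def)
    show "colon (A <+> (\<lambda>k. k \<otimes> x) ` K) {x} \<subseteq> K"
    proof
      fix y assume "y \<in> colon (A <+> (\<lambda>k. k \<otimes> x) ` K) {x}"
      then have y: "y \<in> carrier R" "y \<otimes> x \<in> A <+> (\<lambda>k. k \<otimes> x) ` K" by (auto simp: ideal_colon_def)
      then obtain a k where ak: "a \<in> A" "k \<in> K" "y \<otimes> x = a \<oplus> k \<otimes> x" by (auto elim!: set_add_elemE)
      have ac: "a \<in> carrier R" using ak assms ideal_subset by auto
      have "(y \<ominus> k) \<otimes> x = y \<otimes> x \<ominus> k \<otimes> x"
        using y ak Kc assms by (simp add: a_minus_def l_distr l_minus)
      also have "\<dots> = a" unfolding ak(3) using Kc[OF ak(2)] ac assms by (simp add: a_minus_def a_assoc r_neg)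
      finally have "y \<ominus> k \<in> K" using K(2) ak y Kc assms by (auto simp: ideal_colon_def)
      then have "(y \<ominus> k) \<oplus> k \<in> K" using K ak by (intro ideal_addD)
      then show "y \<in> K" using y Kc[OF ak(2)] by (simp add: a_minus_def a_assoc l_neg)
    qed
  qed
next
  fix L assume "L \<in> ideal_interval R A (A <+> PIdl x)"
  then have L: "ideal L R" "A \<subseteq> L" "L \<subseteq> A <+> PIdl x" by (auto simp: ideal_interval_def)
  show "colon L {x} \<in> ideal_interval R (colon A {x}) (carrier R)"
    using L assms ideal_colon_elem_ideal[OF L(1)] by (auto simp: ideal_interval_def ideal_colon_def)
  show "A <+> (\<lambda>k. k \<otimes> x) ` colon L {x} = L"
  proof
    show "A <+> (\<lambda>k. k \<otimes> x) ` colon L {x} \<subseteq> L"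
      using L by (intro add_ideals_least) (auto simp: ideal_colon_def)
    show "L \<subseteq> A <+> (\<lambda>k. k \<otimes> x) ` colon L {x}"
    proof
      fix l assume l: "l \<in> L"
      then obtain a r where ar: "a \<in> A" "r \<in> carrier R" "l = a \<oplus> r \<otimes> x"
        using L by (auto elim!: set_add_elemE in_PIdlE dest!: subsetD)
      have c: "a \<in> carrier R" using ar assms ideal_subset by auto
      have "l \<ominus> a \<in> L" using l ar L by (auto intro: ideal_minusD)
      also have "l \<ominus> a = r \<otimes> x" unfolding ar(3) using c ar(2) assms by (intro add_minus_cancel_left) auto
      finally have "r \<in> colon L {x}" using ar by (auto simp: ideal_colon_def)
      then show "l \<in> A <+> (\<lambda>k. k \<otimes> x) ` colon L {x}" using ar by (auto intro: set_add_elemI)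
    qed
  qed
next
  show "\<And>X Y. X \<subseteq> Y \<Longrightarrow> A <+> (\<lambda>k. k \<otimes> x) ` X \<subseteq> A <+> (\<lambda>k. k \<otimes> x) ` Y"
    by (intro set_add_mono) auto
qed (auto simp: ideal_colon_def)

end

section \<open>Monomial exponents\<close>

lemma nat_incseq_subseq:
  fixes g :: "nat \<Rightarrow> nat"
  shows "\<exists>\<phi> :: nat \<Rightarrow> nat. strict_mono \<phi> \<and> (\<forall>i j. i \<le> j \<longrightarrow> g (\<phi> i) \<le> g (\<phi> j))"
proof -
  obtain \<phi> where \<phi>: "strict_mono (\<phi> :: nat \<Rightarrow> nat)" "monoseq (\<lambda>x. g (\<phi> x))"
    using seq_monosub[of g] by blast
  show ?thesis
  proof (cases "\<forall>m n. m \<le> n \<longrightarrow> g (\<phi> m) \<le> g (\<phi> n)")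
    case False
    then have dec: "g (\<phi> n) \<le> g (\<phi> m)" if "m \<le> n" for m n
      using \<phi>(2) that unfolding monoseq_def by blast
    \<comment> \<open>A weakly decreasing sequence of naturals is constant from the place where it
      takes its minimum, and a constant sequence is also increasing.\<close>
    define N where "N = (ARG_MIN (\<lambda>n. g (\<phi> n)) n. True)"
    have N: "g (\<phi> N) \<le> g (\<phi> n)" for n
      unfolding N_def by (rule arg_min_nat_le) simp
    have "strict_mono (\<lambda>i. \<phi> (N + i))" using \<phi>(1) by (simp add: strict_mono_def)
    moreover have "g (\<phi> (N + i)) \<le> g (\<phi> (N + j))" for i j
      by (rule order_trans[OF dec[of N] N]) simp
    ultimately show ?thesis by (intro exI[of _ "\<lambda>i. \<phi> (N + i)"]) blast
  qed (use \<phi> in blast)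
qed

text \<open>Dickson's lemma in its subsequence form: the heads are made increasing first, then the
  tails along that subsequence. It serves both for monomial ideals and for families of coefficient
  ideals.\<close>

lemma Dickson_subseq:
  fixes f :: "nat \<Rightarrow> nat list"
  assumes "\<And>i. length (f i) = n"
  shows "\<exists>\<phi> :: nat \<Rightarrow> nat. strict_mono \<phi> \<and> (\<forall>i j. i \<le> j \<longrightarrow> list_all2 (\<le>) (f (\<phi> i)) (f (\<phi> j)))"
  using assms
proof (induction n arbitrary: f)
  case 0
  then show ?case by (intro exI[of _ "\<lambda>i. i"]) (auto simp: strict_mono_def)
next
  case (Suc n)
  obtain \<phi> :: "nat \<Rightarrow> nat" where "strict_mono \<phi> \<and> (\<forall>i j. i \<le> j \<longrightarrow> hd (f (\<phi> i)) \<le> hd (f (\<phi> j)))"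
    using nat_incseq_subseq[of "\<lambda>i. hd (f i)"] ..
  then have \<phi>: "strict_mono \<phi>" "\<And>i j. i \<le> j \<Longrightarrow> hd (f (\<phi> i)) \<le> hd (f (\<phi> j))" by simp_all
  have "\<exists>\<psi> :: nat \<Rightarrow> nat. strict_mono \<psi> \<and> (\<forall>i j. i \<le> j \<longrightarrow> list_all2 (\<le>) (tl (f (\<phi> (\<psi> i)))) (tl (f (\<phi> (\<psi> j)))))"
    by (rule Suc.IH) (use Suc.prems in simp)
  then obtain \<psi> :: "nat \<Rightarrow> nat" where "strict_mono \<psi> \<and> (\<forall>i j. i \<le> j \<longrightarrow> list_all2 (\<le>) (tl (f (\<phi> (\<psi> i)))) (tl (f (\<phi> (\<psi> j)))))" ..
  then have \<psi>: "strict_mono \<psi>"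
    "\<And>i j. i \<le> j \<Longrightarrow> list_all2 (\<le>) (tl (f (\<phi> (\<psi> i)))) (tl (f (\<phi> (\<psi> j))))" by simp_all
  have f: "f i = hd (f i) # tl (f i)" for i
    using Suc.prems[of i] by (metis list.collapse list.size(3) nat.distinct(1))
  have "list_all2 (\<le>) (f (\<phi> (\<psi> i))) (f (\<phi> (\<psi> j)))" if "i \<le> j" for i j
    using \<phi>(2)[of "\<psi> i" "\<psi> j"] \<psi>(2)[OF that] that \<psi>(1)
    by (subst (1 2) f) (simp add: strict_mono_less_eq)
  moreover have "strict_mono (\<lambda>i. \<phi> (\<psi> i))" using \<phi>(1) \<psi>(1) by (simp add: strict_mono_def)
  ultimately show ?case by (intro exI[of _ "\<lambda>i. \<phi> (\<psi> i)"]) blast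
qed

text \<open>The lexicographic order is a monomial order: it is compatible with multiplication by a
  monomial, as leading-term arguments require.\<close>

lemma list_add_mono_lex:
  fixes e f g :: "nat list"
  assumes "length e = length f" "length f = length g" "e < f"
  shows "map2 (+) g e < map2 (+) g f"
  using assms
proof (induction e f g rule: list_induct3)
  case (Cons x xs y ys z zs)
  then show ?case by (auto simp: Cons_less_Cons)
qed simp

lemma list_all2_diff_add:
  fixes e e' :: "nat list"
  assumes "list_all2 (\<le>) e' e" shows "e = map2 (+) (map2 (-) e e') e'"
  using list_all2_lengthD[OF assms] assms
  by (intro nth_equalityI) (auto simp: list_all2_conv_all_nth)

text \<open>Each flag tells which of two ideals a generator belongs to, so the flags
  \<open>True\<close> and \<open>False\<close> give the two components of the bidegree of an
  exponent. The recursion by \<open>hd\<close> and \<open>tl\<close> is meaningful for lists of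
  matching length only.\<close>

primrec flag_degree :: "bool \<Rightarrow> bool list \<Rightarrow> nat list \<Rightarrow> nat" where
  "flag_degree b [] e = 0"
| "flag_degree b (f # fs) e = (if f = b then hd e else 0) + flag_degree b fs (tl e)"

lemma flag_degree_add:
  "length e = length fs \<Longrightarrow> length g = length fs \<Longrightarrow>
     flag_degree b fs (map2 (+) g e) = flag_degree b fs g + flag_degree b fs e"
proof (induction fs arbitrary: e g)
  case (Cons f fs)
  then show ?case by (cases e; cases g) auto
qed simp

lemma flag_degree_bound:
  "length e = length fs \<Longrightarrow> x \<in> set e \<Longrightarrow> x \<le> flag_degree b fs e + flag_degree (\<not> b) fs e"
proof (induction fs arbitrary: e)
  case (Cons f fs)
  then obtain y ys where e: "e = y # ys" by (cases e) auto
  show ?case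
  proof (cases "x \<in> set ys")
    case True
    then show ?thesis using Cons.IH[of ys] Cons.prems e by auto
  qed (use Cons.prems e in auto)
qed simp

lemma finite_flag_degree_le:
  "finite {e. length e = length fs \<and> flag_degree b fs e \<le> r \<and> flag_degree (\<not> b) fs e \<le> s}"
proof (rule finite_subset)
  show "{e. length e = length fs \<and> flag_degree b fs e \<le> r \<and> flag_degree (\<not> b) fs e \<le> s}
      \<subseteq> {e. set e \<subseteq> {..r + s} \<and> length e = length fs}"
  proof (intro subsetI CollectI conjI)
    fix e x assume e: "e \<in> {e. length e = length fs \<and> flag_degree b fs e \<le> r \<and> flag_degree (\<not> b) fs e \<le> s}" "x \<in> set e"
    then show "x \<in> {..r + s}" using flag_degree_bound[of e fs x b] by auto
  qed auto
qed (rule finite_lists_length_eq, simp)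

section \<open>Eventually polynomial functions\<close>

definition eventually_poly :: "(nat \<Rightarrow> real) \<Rightarrow> bool" where
  "eventually_poly f \<longleftrightarrow> (\<exists>p N. \<forall>n\<ge>N. f n = poly p (real n))"

lemma power_antidifference: "\<exists>q. \<forall>x::real. poly q (x + 1) - poly q x = x ^ k"
proof (induction k rule: less_induct)
  case (less k)
  then obtain q where q: "\<And>i x. i < k \<Longrightarrow> poly (q i) (x + 1) - poly (q i) x = (x::real) ^ i"
    by metis
  \<comment> \<open>In (x + 1)^(k+1) - x^(k+1) the top term is (k+1) x^k; the antidifferences
    \<open>q i\<close> of the lower powers cancel the rest.\<close>
  define Q where "Q = Polynomial.smult (1 / real (Suc k)) (Polynomial.monom 1 (Suc k) - (\<Sum>i<k. Polynomial.smult (real (Suc k choose i)) (q i)))"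
  have "poly Q (x + 1) - poly Q x = x ^ k" for x
  proof -
    have "(x + 1) ^ Suc k = (\<Sum>i\<le>Suc k. real (Suc k choose i) * x ^ i)"
      by (subst binomial_ring) simp
    also have "\<dots> = (\<Sum>i<k. real (Suc k choose i) * x ^ i) + real (Suc k) * x ^ k + x ^ Suc k"
      by (simp add: lessThan_Suc_atMost[symmetric] del: sum.atMost_Suc)
    finally have 1: "(x + 1) ^ Suc k - x ^ Suc k - (\<Sum>i<k. real (Suc k choose i) * x ^ i) = real (Suc k) * x ^ k"
      by simp
    have "poly Q (x + 1) - poly Q x = 1 / real (Suc k) * ((x + 1) ^ Suc k - x ^ Suc k
       - (\<Sum>i<k. real (Suc k choose i) * (poly (q i) (x + 1) - poly (q i) x)))"
      by (simp add: Q_def poly_monom poly_sum sum_subtractf right_diff_distrib del: power_Suc of_nat_Suc)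
    also have "\<dots> = 1 / real (Suc k) * (real (Suc k) * x ^ k)"
      by (subst 1[symmetric]) (simp add: q del: power_Suc of_nat_Suc)
    finally show ?thesis by (simp del: of_nat_Suc)
  qed
  then show ?case by blast
qed

lemma poly_sum_lessThan: "\<exists>q. \<forall>n. (\<Sum>j<n. poly p (real j)) = poly q (real n)"
proof -
  obtain Q where Q: "\<And>k x. poly (Q k) (x + 1) - poly (Q k) x = (x::real) ^ k"
    using power_antidifference by metis
  define q where "q = (\<Sum>k\<le>Polynomial.degree p. Polynomial.smult (Polynomial.coeff p k) (Q k))"
  have d: "poly q (x + 1) - poly q x = poly p x" for x
    by (simp add: q_def poly_sum poly_altdef[of p] sum_subtractf[symmetric] right_diff_distrib[symmetric] Q)
  have "(\<Sum>j<n. poly p (real j)) = poly (q - [:poly q 0:]) (real n)" for n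
  proof (induction n)
    case (Suc n)
    then show ?case using d[of "real n"] by (simp add: add.commute)
  qed simp
  then show ?thesis by blast
qed

lemma eventually_poly_const: "eventually_poly (\<lambda>_. c)"
  unfolding eventually_poly_def by (intro exI[of _ "[:c:]"]) simp

lemma eventually_poly_shift:
  assumes "eventually_poly f" shows "eventually_poly (\<lambda>n. if k \<le> n then f (n - k) else 0)"
proof -
  obtain p N where p: "\<And>n. n \<ge> N \<Longrightarrow> f n = poly p (real n)"
    using assms unfolding eventually_poly_def by blast
  have "(if k \<le> n then f (n - k) else 0) = poly (pcompose p [:- real k, 1:]) (real n)" if "n \<ge> N + k" for n
    using that p[of "n - k"] by (simp add: poly_pcompose of_nat_diff)
  then show ?thesis unfolding eventually_poly_def by blast
qed

lemma eventually_poly_cumsum: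
  assumes "eventually_poly f" shows "eventually_poly (\<lambda>n. \<Sum>j\<le>n. f j)"
proof -
  obtain p N where p: "\<And>n. n \<ge> N \<Longrightarrow> f n = poly p (real n)"
    using assms unfolding eventually_poly_def by blast
  obtain q where q: "\<And>n. (\<Sum>j<n. poly p (real j)) = poly q (real n)"
    using poly_sum_lessThan by metis
  \<comment> \<open>From N on the summands equal the polynomial values, so the accumulated error
    stays at this constant.\<close>
  define c where "c = (\<Sum>j<N. f j - poly p (real j))"
  have "(\<Sum>j\<le>n. f j) = poly (pcompose q [:1, 1:] + [:c:]) (real n)" if "n \<ge> N" for n
  proof -
    have "(\<Sum>j\<le>n. f j - poly p (real j)) = c"
      unfolding c_def by (rule sum.mono_neutral_right) (use that p in auto)
    moreover have "(\<Sum>j\<le>n. poly p (real j)) = poly q (real (Suc n))"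
      unfolding q[symmetric] by (simp add: lessThan_Suc_atMost)
    ultimately show ?thesis by (simp add: sum_subtractf poly_pcompose add.commute)
  qed
  then show ?thesis unfolding eventually_poly_def by blast
qed

text \<open>The tensor square of the eventually polynomial functions. Unlike the functions that agree with
  a polynomial when both arguments are large, it is closed under partial sums in one variable.\<close>

inductive sep_poly :: "(nat \<Rightarrow> nat \<Rightarrow> real) \<Rightarrow> bool" where
  zero: "sep_poly (\<lambda>r s. 0)"
| add: "eventually_poly f \<Longrightarrow> eventually_poly g \<Longrightarrow> sep_poly F \<Longrightarrow> sep_poly (\<lambda>r s. f r * g s + F r s)"

lemma sep_poly_const: "sep_poly (\<lambda>r s. c)"
  using sep_poly.add[OF eventually_poly_const[of c] eventually_poly_const[of 1] sep_poly.zero] by simp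

lemma sep_poly_add: "sep_poly F \<Longrightarrow> sep_poly G \<Longrightarrow> sep_poly (\<lambda>r s. F r s + G r s)"
  by (induction rule: sep_poly.induct) (auto simp: add.assoc intro: sep_poly.add)

lemma sep_poly_sum: "(\<And>i. i \<in> A \<Longrightarrow> sep_poly (F i)) \<Longrightarrow> sep_poly (\<lambda>r s. \<Sum>i\<in>A. F i r s)"
  by (induction A rule: infinite_finite_induct) (auto intro: sep_poly.zero sep_poly_add)

lemma sep_poly_swap: "sep_poly F \<Longrightarrow> sep_poly (\<lambda>r s. F s r)"
proof (induction rule: sep_poly.induct)
  case (add f g F)
  have "(\<lambda>r s. f s * g r + F s r) = (\<lambda>r s. g r * f s + F s r)" by (simp add: mult.commute)
  then show ?case using sep_poly.add[OF add(2,1) add.IH] by simp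
qed (rule sep_poly.zero)

lemma sep_poly_shift: "sep_poly F \<Longrightarrow> sep_poly (\<lambda>r s. if k \<le> r then F (r - k) s else 0)"
proof (induction rule: sep_poly.induct)
  case (add f g F)
  have "(\<lambda>r s. if k \<le> r then f (r - k) * g s + F (r - k) s else 0) =
     (\<lambda>r s. (if k \<le> r then f (r - k) else 0) * g s + (if k \<le> r then F (r - k) s else 0))"
    by auto
  then show ?case using sep_poly.add[OF eventually_poly_shift[OF add(1)] add(2) add.IH] by simp
qed (simp add: sep_poly.zero)

lemma sep_poly_cumsum: "sep_poly F \<Longrightarrow> sep_poly (\<lambda>r s. \<Sum>j\<le>r. F j s)"
proof (induction rule: sep_poly.induct)
  case (add f g F)
  then show ?case using sep_poly.add[OF eventually_poly_cumsum[OF add(1)] add(2) add.IH]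
    by (simp add: sum.distrib sum_distrib_right)
qed (simp add: sep_poly.zero)

lemma poly_lift_const: "poly (map_poly (\<lambda>c. [:c:]) q) [:s:] = [:poly q (s::real):]"
  by (induction q) (auto simp: map_poly_pCons)

lemma sep_poly_imp_poly:
  assumes "sep_poly F"
  shows "\<exists>P N. \<forall>r\<ge>N. \<forall>s\<ge>N. F r s = poly (poly P [:real s:]) (real r)"
  using assms
proof (induction rule: sep_poly.induct)
  case zero
  then show ?case by (intro exI[of _ 0]) simp
next
  case (add f g F)
  then obtain P N p M q L where P: "\<And>r s. r \<ge> N \<Longrightarrow> s \<ge> N \<Longrightarrow> F r s = poly (poly P [:real s:]) (real r)"
    and p: "\<And>n. n \<ge> M \<Longrightarrow> f n = poly p (real n)" and q: "\<And>n. n \<ge> L \<Longrightarrow> g n = poly q (real n)"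
    unfolding eventually_poly_def by blast
  \<comment> \<open>The outer variable is s, so q(s) enters with its coefficients lifted to
    constants of the inner ring, while p(r) acts as a scalar.\<close>
  have "f r * g s + F r s = poly (poly (Polynomial.smult p (map_poly (\<lambda>c. [:c:]) q) + P) [:real s:]) (real r)"
    if "r \<ge> max N (max M L)" "s \<ge> max N (max M L)" for r s
    using that P[of r s] p[of r] q[of s] by (simp add: poly_lift_const)
  then show ?case by blast
qed

lemma real_nat_tail_infinite: "infinite {real s |s. s \<ge> N}"
proof -
  have "{real s |s. s \<ge> N} = real ` {N..}" by auto
  moreover have "infinite (real ` {N..})" by (subst finite_image_iff) (auto simp: infinite_Ici inj_on_def)
  ultimately show ?thesis by simp
qed

lemma poly_eqI_nat:
  assumes "\<And>r. r \<ge> N \<Longrightarrow> poly p (real r) = poly q (real r)" shows "p = q"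
proof (rule ccontr)
  assume "p \<noteq> q"
  then have "finite {x. poly (p - q) x = 0}" by (intro poly_roots_finite) simp
  moreover have "{real s |s. s \<ge> N} \<subseteq> {x. poly (p - q) x = 0}" using assms by auto
  ultimately show False using real_nat_tail_infinite finite_subset by blast
qed

text \<open>For each large s the two sides agree as polynomials in r. The constants
  \<open>[:s:]\<close> are then infinitely many roots of P - Q over the integral domain of
  polynomials in r.\<close>

lemma bivariate_poly_eqI:
  assumes "\<And>r s. r \<ge> N \<Longrightarrow> s \<ge> N \<Longrightarrow> poly (poly P [:real s:]) (real r) = poly (poly Q [:real s:]) (real r)"
  shows "P = Q"
proof (rule ccontr)
  assume "P \<noteq> Q"
  then have "finite {x. poly (P - Q) x = 0}" by (intro poly_roots_finite) simp
  moreover have "poly P [:real s:] = poly Q [:real s:]" if "s \<ge> N" for s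
    using assms[OF _ that] by (rule poly_eqI_nat)
  then have "(\<lambda>x. [:x:]) ` {real s |s. s \<ge> N} \<subseteq> {x. poly (P - Q) x = 0}" by auto
  ultimately have "finite ((\<lambda>x. [:x:]) ` {real s |s. s \<ge> N})" by (rule rev_finite_subset)
  then show False using real_nat_tail_infinite by (subst (asm) finite_image_iff) (auto simp: inj_on_def)
qed

lemma poly_over_power_tendsto:
  assumes "Polynomial.degree p \<le> d"
  shows "(\<lambda>n. poly p (real n) / real n ^ d) \<longlonglongrightarrow> Polynomial.coeff p d"
proof -
  have "(\<lambda>n. \<Sum>i\<le>d. Polynomial.coeff p i * (real n ^ i / real n ^ d)) \<longlonglongrightarrow> (\<Sum>i\<le>d. Polynomial.coeff p i * (if i = d then 1 else 0))"
  proof (intro tendsto_sum tendsto_mult tendsto_const)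
    fix i assume i: "i \<in> {..d}"
    show "(\<lambda>n. real n ^ i / real n ^ d) \<longlonglongrightarrow> (if i = d then 1 else 0)"
    proof (cases "i = d")
      case True
      have "(\<lambda>n. real n ^ i / real n ^ d) \<longlonglongrightarrow> 1"
        by (rule tendsto_eventually) (use True in \<open>auto intro!: eventually_sequentiallyI[of 1]\<close>)
      then show ?thesis using True by simp
    next
      case False
      have "(\<lambda>n. inverse (real n) ^ (d - i)) \<longlonglongrightarrow> 0"
        using i False tendsto_power[OF lim_inverse_n[where 'a=real], of "d - i"]
        by (simp add: power_0_left)
      moreover have "\<forall>\<^sub>F n in sequentially. inverse (real n) ^ (d - i) = real n ^ i / real n ^ d"
        by (rule eventually_sequentiallyI[of 1])
          (use i False in \<open>auto simp: power_diff divide_simps power_add[symmetric]\<close>)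
      ultimately have "(\<lambda>n. real n ^ i / real n ^ d) \<longlonglongrightarrow> 0" by (rule Lim_transform_eventually)
      then show ?thesis using False by simp
    qed
  qed
  moreover have "(\<Sum>i\<le>d. Polynomial.coeff p i * (real n ^ i / real n ^ d)) = poly p (real n) / real n ^ d" for n
  proof -
    have "poly p (real n) = (\<Sum>i\<le>d. Polynomial.coeff p i * real n ^ i)"
      unfolding poly_altdef by (rule sum.mono_neutral_left) (use assms in \<open>auto intro: coeff_eq_0\<close>)
    then show ?thesis by (simp add: sum_divide_distrib)
  qed
  ultimately show ?thesis by (simp add: sum.delta if_distrib cong: if_cong)
qed

text \<open>If the degree exceeded d, dividing by that power of n would send the values both to the
  leading coefficient and to 0.\<close>

lemma poly_degree_le_of_bound:
  assumes "\<And>n. n \<ge> N \<Longrightarrow> \<bar>poly p (real n)\<bar> \<le> K * (real n + 1) ^ d"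
  shows "Polynomial.degree p \<le> d"
proof (rule ccontr)
  assume "\<not> Polynomial.degree p \<le> d"
  then have D: "d < Polynomial.degree p" by simp
  have "(\<lambda>n. poly p (real n) / real n ^ Polynomial.degree p) \<longlonglongrightarrow> 0"
  proof (rule tendsto_0_le)
    show "(\<lambda>n. \<bar>K\<bar> * 2 ^ d * inverse (real n)) \<longlonglongrightarrow> 0"
      by (rule tendsto_mult_right_zero[OF lim_inverse_n])
    show "\<forall>\<^sub>F n in sequentially. norm (poly p (real n) / real n ^ Polynomial.degree p) \<le> norm (\<bar>K\<bar> * 2 ^ d * inverse (real n)) * 1"
    proof (rule eventually_sequentiallyI[of "max 1 N"])
      fix n assume n: "max 1 N \<le> n"
      have "\<bar>poly p (real n)\<bar> \<le> K * (real n + 1) ^ d" using assms n by simp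
      also have "\<dots> \<le> \<bar>K\<bar> * (2 * real n) ^ d" using n by (intro mult_mono power_mono) auto
      also have "\<dots> \<le> \<bar>K\<bar> * 2 ^ d * real n ^ (Polynomial.degree p - 1)"
        using n D by (auto simp: power_mult_distrib mult.assoc intro!: mult_left_mono power_increasing)
      finally have "\<bar>poly p (real n)\<bar> / real n ^ Polynomial.degree p
          \<le> \<bar>K\<bar> * 2 ^ d * real n ^ (Polynomial.degree p - 1) / real n ^ Polynomial.degree p"
        by (rule divide_right_mono) simp
      moreover have "real n ^ Polynomial.degree p = real n * real n ^ (Polynomial.degree p - 1)"
        using D by (simp add: power_eq_if)
      then have "\<bar>K\<bar> * 2 ^ d * real n ^ (Polynomial.degree p - 1) / real n ^ Polynomial.degree p
          = \<bar>K\<bar> * 2 ^ d * inverse (real n)"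
        using n by (simp add: divide_simps)
      ultimately show "norm (poly p (real n) / real n ^ Polynomial.degree p) \<le> norm (\<bar>K\<bar> * 2 ^ d * inverse (real n)) * 1"
        by (simp add: abs_mult)
    qed
  qed
  moreover have "(\<lambda>n. poly p (real n) / real n ^ Polynomial.degree p) \<longlonglongrightarrow> lead_coeff p"
    by (rule poly_over_power_tendsto) simp
  ultimately have "lead_coeff p = 0" using LIMSEQ_unique by blast
  then show False using D by simp
qed

section \<open>Counting exponents outside a monomial ideal\<close>

text \<open>The complements form an increasing sequence of monomial ideals, and Dickson's lemma
  makes it stationary.\<close>

lemma decseq_downset_stabilizes:
  assumes len: "\<And>k e. e \<in> D k \<Longrightarrow> length e = n"
    and down: "\<And>k e e'. e \<in> D k \<Longrightarrow> list_all2 (\<le>) e' e \<Longrightarrow> e' \<in> D k"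
    and dec: "\<And>k. D (Suc k) \<subseteq> D (k :: nat)"
  shows "\<exists>K. \<forall>k\<ge>K. D k = (D K :: nat list set)"
proof (rule ccontr)
  have dec': "D j \<subseteq> D i" if "i \<le> j" for i j using lift_Suc_antimono_le[of D] dec that by blast
  assume "\<not> (\<exists>K. \<forall>k\<ge>K. D k = D K)"
  then have "\<exists>k e. k \<ge> K \<and> e \<in> D K \<and> e \<notin> D k" for K using dec'[of K] by blast
  then obtain k e where ke: "\<And>K. k K \<ge> K" "\<And>K. e K \<in> D K" "\<And>K. e K \<notin> D (k K)" by metis
  \<comment> \<open>Iterating k yields stages such that the witness chosen at one stage has left the
    set by the next. A later witness above an earlier one would pull the earlier one back
    in.\<close>
  define c where "c i = (k ^^ i) 0" for i
  have cS: "c (Suc i) = k (c i)" for i by (simp add: c_def)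
  have cmono: "c i \<le> c j" if "i \<le> j" for i j
    using lift_Suc_mono_le[of c] ke(1) cS that by metis
  have "length (e (c i)) = n" for i using ke(2) by (rule len)
  then obtain \<phi> :: "nat \<Rightarrow> nat" where "strict_mono \<phi> \<and> (\<forall>i j. i \<le> j \<longrightarrow> list_all2 (\<le>) (e (c (\<phi> i))) (e (c (\<phi> j))))"
    using Dickson_subseq[of "\<lambda>i. e (c i)" n] by auto
  then have \<phi>: "strict_mono \<phi>" "\<And>i j. i \<le> j \<Longrightarrow> list_all2 (\<le>) (e (c (\<phi> i))) (e (c (\<phi> j)))" by simp_all
  have "Suc (\<phi> 0) \<le> \<phi> 1" using \<phi>(1) by (simp add: strict_mono_def Suc_leI)
  then have "e (c (\<phi> 1)) \<in> D (k (c (\<phi> 0)))"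
    using ke(2)[of "c (\<phi> 1)"] dec'[OF cmono, of "Suc (\<phi> 0)" "\<phi> 1"] unfolding cS by blast
  then have "e (c (\<phi> 0)) \<in> D (k (c (\<phi> 0)))" using down \<phi>(2)[of 0 1] by simp
  then show False using ke(3) by blast
qed

text \<open>Cutting the convolution at K leaves finitely many shifts of fixed functions and one
  shifted partial sum, the operations under which \<open>sep_poly\<close> is closed.\<close>

lemma sum_shift_stable:
  fixes F :: "nat \<Rightarrow> nat \<Rightarrow> real"
  assumes "\<And>k. k \<ge> K \<Longrightarrow> F k = F K"
  shows "(\<Sum>k\<le>r. F k (r - k)) =
    (\<Sum>k<K. if k \<le> r then F k (r - k) else 0) + (if K \<le> r then (\<Sum>j\<le>r - K. F K j) else 0)"
proof -
  have "(\<Sum>k\<le>r. F k (r - k)) = (\<Sum>k\<in>{..<K} \<inter> {..r}. F k (r - k)) + (\<Sum>k\<in>{K..r}. F k (r - k))"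
  proof (subst sum.union_disjoint[symmetric])
    have "{..r} = {..<K} \<inter> {..r} \<union> {K..r}" by auto
    then show "(\<Sum>k\<le>r. F k (r - k)) = (\<Sum>k\<in>{..<K} \<inter> {..r} \<union> {K..r}. F k (r - k))" by simp
  qed auto
  also have "(\<Sum>k\<in>{..<K} \<inter> {..r}. F k (r - k)) = (\<Sum>k<K. if k \<le> r then F k (r - k) else 0)"
    by (subst sum.inter_restrict) auto
  also have "(\<Sum>k\<in>{K..r}. F k (r - k)) = (\<Sum>k\<in>{K..r}. F K (r - k))"
  proof (rule sum.cong[OF refl])
    fix k assume "k \<in> {K..r}"
    then have "F k = F K" by (intro assms) simp
    then show "F k (r - k) = F K (r - k)" by simp
  qed
  also have "\<dots> = (if K \<le> r then (\<Sum>j\<le>r - K. F K j) else 0)"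
  proof (cases "K \<le> r")
    case True
    have "(\<Sum>k\<in>{K..r}. F K (r - k)) = (\<Sum>j\<le>r - K. F K j)"
      by (rule sum.reindex_bij_witness[of _ "\<lambda>j. r - j" "\<lambda>k. r - k"]) (use True in auto)
    then show ?thesis using True by simp
  qed simp
  finally show ?thesis .
qed

text \<open>This is the Hilbert function of a monomial ideal, computed by slicing along the first
  exponent. The slices decrease and finally stop changing, so \<open>sum_shift_stable\<close>
  applies. The flag b varies in the induction, as the next variable may count toward either
  degree.\<close>

theorem sep_poly_card_downset:
  assumes "\<And>e. e \<in> D \<Longrightarrow> length e = length fs"
    and "\<And>e e'. e \<in> D \<Longrightarrow> list_all2 (\<le>) e' e \<Longrightarrow> e' \<in> D"
  shows "sep_poly (\<lambda>r s. real (card {e \<in> D. flag_degree b fs e \<le> r \<and> flag_degree (\<not> b) fs e \<le> s}))"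
  using assms
proof (induction fs arbitrary: D b)
  case Nil
  then show ?case by (simp add: sep_poly_const)
next
  case (Cons f fs)
  define E where "E k = {e. k # e \<in> D}" for k
  define F where "F k r s = real (card {e \<in> E k. flag_degree f fs e \<le> r \<and> flag_degree (\<not> f) fs e \<le> s})" for k r s
  have Elen: "length e = length fs" if "e \<in> E k" for e k using Cons.prems(1) that by (fastforce simp: E_def)
  have Edown: "e' \<in> E k" if "e \<in> E k" "list_all2 (\<le>) e' e" for e e' k
    using Cons.prems(2)[of "k # e" "k # e'"] that by (simp add: E_def)
  have Edec: "E (Suc k) \<subseteq> E k" for k
    using Cons.prems(2)[of "Suc k # e" "k # e" for e] by (auto simp: E_def list.rel_refl)
  obtain K where K: "\<And>k. k \<ge> K \<Longrightarrow> E k = E K"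
    using decseq_downset_stabilizes[of E "length fs"] Elen Edown Edec by metis
  have FK: "F k = F K" if "k \<ge> K" for k using K[OF that] by (auto simp: F_def fun_eq_iff)
  have Fsep: "sep_poly (F k)" for k
    unfolding F_def by (rule Cons.IH) (use Elen Edown in auto)
  \<comment> \<open>A first exponent k uses up k of the allowance r for its own flag and leaves s
    untouched.\<close>
  have eq: "real (card {e \<in> D. flag_degree f (f # fs) e \<le> r \<and> flag_degree (\<not> f) (f # fs) e \<le> s})
      = (\<Sum>k\<le>r. F k (r - k) s)" for r s
  proof -
    let ?S = "\<lambda>k. {e \<in> E k. flag_degree f fs e \<le> r - k \<and> flag_degree (\<not> f) fs e \<le> s}"
    have "{e \<in> D. flag_degree f (f # fs) e \<le> r \<and> flag_degree (\<not> f) (f # fs) e \<le> s} = (\<Union>k\<le>r. (#) k ` ?S k)"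
    proof (intro equalityI subsetI)
      fix e assume e: "e \<in> {e \<in> D. flag_degree f (f # fs) e \<le> r \<and> flag_degree (\<not> f) (f # fs) e \<le> s}"
      then obtain k e' where "e = k # e'" using Cons.prems(1)[of e] by (cases e) auto
      moreover from this have "k \<le> r" "e' \<in> ?S k" using e by (auto simp: E_def)
      ultimately show "e \<in> (\<Union>k\<le>r. (#) k ` ?S k)" by blast
    qed (auto simp: E_def)
    moreover have "finite (?S k)" for k
      by (rule finite_subset[OF _ finite_flag_degree_le[of fs f "r - k" s]]) (auto dest: Elen)
    moreover have "card ((#) k ` ?S k) = card (?S k)" for k by (rule card_image) simp
    ultimately show ?thesis
      by (simp add: F_def) (subst card_UN_disjoint; auto)
  qed
  have main: "sep_poly (\<lambda>r s. real (card {e \<in> D. flag_degree f (f # fs) e \<le> r \<and> flag_degree (\<not> f) (f # fs) e \<le> s}))"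
  proof -
    have "(\<Sum>k\<le>r. F k (r - k) s) = (\<Sum>k<K. if k \<le> r then F k (r - k) s else 0)
        + (if K \<le> r then (\<Sum>j\<le>r - K. F K j s) else 0)" for r s
      by (rule sum_shift_stable[where F="\<lambda>k r. F k r s"]) (subst FK, auto)
    moreover have "sep_poly (\<lambda>r s. (\<Sum>k<K. if k \<le> r then F k (r - k) s else 0)
        + (if K \<le> r then (\<Sum>j\<le>r - K. F K j s) else 0))"
      by (intro sep_poly_add sep_poly_sum sep_poly_shift Fsep sep_poly_shift[OF sep_poly_cumsum])
    ultimately show ?thesis unfolding eq by simp
  qed
  \<comment> \<open>If b is the other flag, exchanging r and s reduces to the case just
    treated.\<close>
  show ?case
  proof (cases "b = f")
    case False
    then have "b = (\<not> f)" by auto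
    then show ?thesis using sep_poly_swap[OF main] by (simp add: conj_commute cong: conj_cong)
  qed (use main in simp)
qed

section \<open>Noetherian rings and powers of ideals\<close>

locale noetherian_cring = cring R + noetherian_ring R for R (structure)

sublocale noetherian_local_ring \<subseteq> noetherian_cring ..

context noetherian_cring
begin

lemma wf_ideal_supset: "wf {(B, A). ideal A R \<and> ideal B R \<and> A \<subset> B}"
proof (subst wf_iff_no_infinite_down_chain, rule notI)
  assume "\<exists>f. \<forall>i. (f (Suc i), f i) \<in> {(B, A). ideal A R \<and> ideal B R \<and> A \<subset> B}"
  then obtain f where f: "\<And>i. ideal (f i) R" "\<And>i. f i \<subset> f (Suc i)" by blast
  have mono: "f i \<subseteq> f j" if "i \<le> j" for i j
    using lift_Suc_mono_le[of f, OF _ that] f(2) by blast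
  have "subset.chain {I. ideal I R} (range f)"
    unfolding subset_chain_def
  proof (intro conjI ballI)
    fix X Y assume "X \<in> range f" "Y \<in> range f"
    then obtain i j where "X = f i" "Y = f j" by blast
    then show "X \<subseteq> Y \<or> Y \<subseteq> X" using mono[of i j] mono[of j i] by (cases "i \<le> j") auto
  qed (use f(1) in auto)
  then have "\<Union> (range f) \<in> range f" by (intro ideal_chain_is_trivial) auto
  then obtain k where "\<Union> (range f) = f k" by blast
  then have "f (Suc k) \<subseteq> f k" by blast
  then show False using f(2)[of k] by blast
qed

lemma noetherian_induct [consumes 1, case_names step]:
  assumes "ideal A R"
    and "\<And>A. ideal A R \<Longrightarrow> (\<And>B. ideal B R \<Longrightarrow> A \<subset> B \<Longrightarrow> P B) \<Longrightarrow> P A"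
  shows "P A"
  using assms(1)
proof (induction A rule: wf_induct_rule[OF wf_ideal_supset])
  case (1 A)
  then show ?case using assms(2)[of A] by blast
qed

lemma exists_maximal_ideal_in:
  assumes "ideal A R" "Q A"
  shows "\<exists>B. ideal B R \<and> Q B \<and> A \<subseteq> B \<and> (\<forall>C. ideal C R \<longrightarrow> Q C \<longrightarrow> B \<subseteq> C \<longrightarrow> C = B)"
  using assms
proof (induction rule: noetherian_induct)
  case (step A)
  show ?case
  proof (cases "\<forall>C. ideal C R \<longrightarrow> Q C \<longrightarrow> A \<subseteq> C \<longrightarrow> C = A")
    case False
    then obtain C where "ideal C R" "Q C" "A \<subset> C" by blast
    then show ?thesis using step.IH[of C] by (meson psubset_imp_subset subset_trans)
  qed (use step in blast)
qed

lemma ideal_finite_gens: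
  assumes "ideal I R"
  obtains xs where "set xs \<subseteq> carrier R" "I = Idl (set xs)"
  using finetely_gen[OF assms] finite_list by metis

end

section \<open>Powers of ideals and monomials in a list of elements\<close>

context cring
begin

abbreviation ideal_pow :: "'a set \<Rightarrow> nat \<Rightarrow> 'a set" where
  "ideal_pow I n \<equiv> I [^]\<^bsub>ideals_set R\<^esub> n"

lemma ideals_set_simps [simp]:
  "A \<otimes>\<^bsub>ideals_set R\<^esub> B = A \<cdot> B" "\<one>\<^bsub>ideals_set R\<^esub> = carrier R"
  by (simp_all add: ideals_set_def)

lemma ideal_pow_0: "ideal_pow I 0 = carrier R"
  by (simp add: nat_pow_def ideals_set_def)

lemma ideal_pow_Suc: "ideal_pow I (Suc n) = ideal_pow I n \<cdot> I"
  by (simp add: nat_pow_def ideals_set_def)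

lemma ideal_pow_ideal: "ideal I R \<Longrightarrow> ideal (ideal_pow I n) R"
  by (induction n) (simp_all add: ideal_pow_0 ideal_pow_Suc oneideal ideal_prod_is_ideal)

lemma ideal_pow_add: "ideal I R \<Longrightarrow> ideal_pow I (m + n) = ideal_pow I m \<cdot> ideal_pow I n"
  by (induction n) (simp_all add: ideal_pow_0 ideal_pow_Suc ideal_prod_one ideal_pow_ideal ideal_prod_assoc)

lemma ideal_pow_1: "ideal I R \<Longrightarrow> ideal_pow I (Suc 0) = I"
  by (simp add: ideal_pow_Suc ideal_pow_0 ideal_prod_commute[OF oneideal] ideal_prod_one)

lemma ideal_prod_subset1: "ideal A R \<Longrightarrow> ideal B R \<Longrightarrow> A \<cdot> B \<subseteq> A"
  using ideal_prod_inter by blast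

lemma ideal_prod_subset2: "ideal A R \<Longrightarrow> ideal B R \<Longrightarrow> A \<cdot> B \<subseteq> B"
  using ideal_prod_inter by blast

lemma ideal_pow_antimono: "ideal I R \<Longrightarrow> m \<le> n \<Longrightarrow> ideal_pow I n \<subseteq> ideal_pow I m"
  by (metis ideal_pow_add ideal_pow_ideal ideal_prod_subset1 le_add_diff_inverse)

lemma ideal_pow_mono: "I \<subseteq> J \<Longrightarrow> ideal_pow I n \<subseteq> ideal_pow J n"
  by (induction n) (simp_all add: ideal_pow_0 ideal_pow_Suc ideal_prod_mono)

lemma elem_pow_in_ideal_pow: "ideal I R \<Longrightarrow> z \<in> I \<Longrightarrow> z [^] k \<in> ideal_pow I k"
  by (induction k) (auto simp: ideal_pow_0 ideal_pow_Suc intro: ideal_prod.prod)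

primrec monomial :: "'a list \<Rightarrow> nat list \<Rightarrow> 'a" where
  "monomial [] e = \<one>"
| "monomial (z # zs) e = z [^] hd e \<otimes> monomial zs (tl e)"

lemma monomial_closed: "set zs \<subseteq> carrier R \<Longrightarrow> monomial zs e \<in> carrier R"
  by (induction zs arbitrary: e) auto

lemma monomial_add:
  "set zs \<subseteq> carrier R \<Longrightarrow> length g = length zs \<Longrightarrow> length e = length zs \<Longrightarrow>
     monomial zs (map2 (+) g e) = monomial zs g \<otimes> monomial zs e"
proof (induction zs arbitrary: g e)
  case (Cons z zs)
  then obtain a g' b e' where "g = a # g'" "e = b # e'" by (cases g; cases e) auto
  then show ?case using Cons monomial_closed[of zs]
    by (simp add: nat_pow_mult[symmetric] m_ac)
qed simp

lemma monomial_zero: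
  "set zs \<subseteq> carrier R \<Longrightarrow> monomial zs (replicate (length zs) 0) = \<one>"
  by (induction zs) auto

lemma flag_degree_zero: "flag_degree b fs (replicate (length fs) 0) = 0"
  by (induction fs) auto

lemma monomial_unit:
  assumes "set zs \<subseteq> carrier R" "length fs = length zs" "i < length zs"
  shows "\<exists>g. length g = length zs \<and> monomial zs g = zs ! i \<and>
    (\<forall>b. flag_degree b fs g = (if fs ! i = b then 1 else 0))"
  using assms
proof (induction zs arbitrary: fs i)
  case (Cons z zs)
  then obtain f fs' where fs: "fs = f # fs'" by (cases fs) auto
  have z0: "flag_degree b fs' (replicate (length zs) 0) = 0" for b
    using flag_degree_zero[of b fs'] Cons.prems fs by simp
  show ?case
  proof (cases i)
    case 0
    have "monomial (z # zs) (1 # replicate (length zs) 0) = z"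
      using Cons.prems monomial_zero[of zs] by (simp add: nat_pow_eone)
    then show ?thesis using 0 fs z0 by (intro exI[of _ "1 # replicate (length zs) 0"]) auto
  next
    case (Suc j)
    then obtain g where "length g = length zs" "monomial zs g = zs ! j"
      "\<forall>b. flag_degree b fs' g = (if fs' ! j = b then 1 else 0)"
      using Cons.IH[of fs' j] Cons.prems fs by auto
    moreover have "zs ! j \<in> carrier R" using Cons.prems Suc by auto
    ultimately show ?thesis using Suc fs Cons.prems by (intro exI[of _ "0 # g"]) auto
  qed
qed simp

end

section \<open>Monomials in the generators of two ideals\<close>

text \<open>Generators of both ideals sit in one list, so that a single exponent vector describes a
  generator of M^u I^v and a single lexicographic order serves both. Taking I = {0} recovers the
  powers of one ideal.\<close>

locale two_ideals = cring R for R (structure) +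
  fixes M I :: "'a set" and zs :: "'a list" and fs :: "bool list"
  assumes zs_carrier: "set zs \<subseteq> carrier R"
    and length_fs: "length fs = length zs"
    and M_gen: "M = Idl {zs ! i |i. i < length zs \<and> fs ! i}"
    and I_gen: "I = Idl {zs ! i |i. i < length zs \<and> \<not> fs ! i}"
begin

abbreviation degM where "degM \<equiv> flag_degree True fs"
abbreviation degI where "degI \<equiv> flag_degree False fs"

lemma gens_carrier: "{zs ! i |i. i < length zs \<and> P i} \<subseteq> carrier R"
  using zs_carrier by auto

lemma M_ideal: "ideal M R" unfolding M_gen by (rule genideal_ideal[OF gens_carrier])
lemma I_ideal: "ideal I R" unfolding I_gen by (rule genideal_ideal[OF gens_carrier])

definition bipow :: "nat \<Rightarrow> nat \<Rightarrow> 'a set" where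
  "bipow u v = ideal_pow M u \<cdot> ideal_pow I v"

definition exponents :: "nat \<Rightarrow> nat \<Rightarrow> nat list set" where
  "exponents u v = {e. length e = length zs \<and> degM e = u \<and> degI e = v}"

abbreviation mon :: "nat list \<Rightarrow> 'a" where "mon \<equiv> monomial zs"

lemma mon_closed: "mon e \<in> carrier R" by (rule monomial_closed[OF zs_carrier])

lemma bipow_ideal: "ideal (bipow u v) R"
  unfolding bipow_def by (intro ideal_prod_is_ideal ideal_pow_ideal M_ideal I_ideal)

lemma bipow_0: "bipow u 0 = ideal_pow M u" "bipow 0 v = ideal_pow I v"
  unfolding bipow_def ideal_pow_0
  by (simp_all add: ideal_prod_one ideal_pow_ideal M_ideal I_ideal ideal_prod_commute[OF oneideal])

lemma bipow_prod: "bipow u v \<cdot> bipow u' v' = bipow (u + u') (v + v')"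
proof -
  note [intro] = ideal_prod_is_ideal ideal_pow_ideal[OF M_ideal] ideal_pow_ideal[OF I_ideal]
  have "bipow u v \<cdot> bipow u' v' = ideal_pow M u \<cdot> (ideal_pow I v \<cdot> (ideal_pow M u' \<cdot> ideal_pow I v'))"
    unfolding bipow_def by (rule ideal_prod_assoc) auto
  also have "ideal_pow I v \<cdot> (ideal_pow M u' \<cdot> ideal_pow I v') = ideal_pow M u' \<cdot> (ideal_pow I v \<cdot> ideal_pow I v')"
    by (metis ideal_prod_assoc ideal_prod_commute ideal_pow_ideal M_ideal I_ideal)
  also have "ideal_pow M u \<cdot> \<dots> = (ideal_pow M u \<cdot> ideal_pow M u') \<cdot> (ideal_pow I v \<cdot> ideal_pow I v')"
    by (rule ideal_prod_assoc[symmetric]) auto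
  finally show ?thesis by (simp add: bipow_def ideal_pow_add M_ideal I_ideal)
qed

lemma bipow_mult: "a \<in> bipow u v \<Longrightarrow> b \<in> bipow u' v' \<Longrightarrow> a \<otimes> b \<in> bipow (u + u') (v + v')"
  unfolding bipow_prod[symmetric] by (rule ideal_prod.prod)

lemma bipow_antimono: "u' \<le> u \<Longrightarrow> v' \<le> v \<Longrightarrow> bipow u v \<subseteq> bipow u' v'"
  unfolding bipow_def by (intro ideal_prod_mono ideal_pow_antimono M_ideal I_ideal)

lemma gens_in: "i < length zs \<Longrightarrow> zs ! i \<in> (if fs ! i then M else I)"
  unfolding M_gen I_gen using genideal_self[OF gens_carrier[of "\<lambda>i. fs ! i"]]
    genideal_self[OF gens_carrier[of "\<lambda>i. \<not> fs ! i"]] by (cases "fs ! i") auto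

lemma mon_in_bipow:
  assumes "length e = length zs"
  shows "mon e \<in> bipow (degM e) (degI e)"
proof -
  have "\<forall>i<length zs. zs ! i \<in> (if fs ! i then M else I)" using gens_in by blast
  from length_fs assms this show ?thesis
  proof (induction zs arbitrary: fs e)
    case Nil
    then show ?case by (simp add: bipow_0 ideal_pow_0)
  next
    case (Cons z zs)
    then obtain f fs' k e' where fe: "fs = f # fs'" "e = k # e'" by (cases fs; cases e) auto
    have "monomial zs e' \<in> bipow (flag_degree True fs' e') (flag_degree False fs' e')"
    proof (rule Cons.IH)
      show "\<forall>i<length zs. zs ! i \<in> (if fs' ! i then M else I)"
      proof (intro allI impI)
        fix i assume "i < length zs"
        then show "zs ! i \<in> (if fs' ! i then M else I)" using Cons.prems(3)[rule_format, of "Suc i"] fe by simp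
      qed
    qed (use Cons.prems fe in auto)
    moreover have "z [^] k \<in> bipow (if f then k else 0) (if f then 0 else k)"
      using Cons.prems(3)[rule_format, of 0] fe elem_pow_in_ideal_pow M_ideal I_ideal by (auto simp: bipow_0)
    ultimately show ?case using bipow_mult fe by fastforce
  qed
qed

lemma mon_in_bipow': "e \<in> exponents u v \<Longrightarrow> mon e \<in> bipow u v"
  unfolding exponents_def using mon_in_bipow by auto

lemma exponents_add:
  "g \<in> exponents u v \<Longrightarrow> e \<in> exponents u' v' \<Longrightarrow> map2 (+) g e \<in> exponents (u + u') (v + v')"
  by (auto simp: exponents_def flag_degree_add length_fs)

lemma mon_add: "length g = length zs \<Longrightarrow> length e = length zs \<Longrightarrow> mon (map2 (+) g e) = mon g \<otimes> mon e"
  by (rule monomial_add[OF zs_carrier])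

lemma finite_exponents: "finite (exponents u v)"
  by (rule finite_subset[OF _ finite_flag_degree_le[of fs True u v]]) (auto simp: exponents_def length_fs)

lemma gen_exponent:
  assumes "i < length zs"
  shows "\<exists>g \<in> exponents (if fs ! i then 1 else 0) (if fs ! i then 0 else 1). mon g = zs ! i"
  using monomial_unit[OF zs_carrier length_fs assms] by (auto simp: exponents_def)

lemma mon_image_carrier: "mon ` X \<subseteq> carrier R"
  using mon_closed by auto

lemma zero_exponent: "replicate (length zs) 0 \<in> exponents 0 0"
  using flag_degree_zero[of _ fs] by (simp add: exponents_def length_fs)

text \<open>P selects the generators of M or those of I, making (a, b) equal to (1, 0) or (0, 1);
  the two inductions in \<open>bipow_eq_Idl\<close> use one case each.\<close>

lemma gens_mult_mons:
  assumes "\<And>i. i < length zs \<Longrightarrow> P (fs ! i) \<Longrightarrow> (if fs ! i then 1 else 0) = a \<and> (if fs ! i then 0 else 1) = b"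
  shows "(Idl {zs ! i |i. i < length zs \<and> P (fs ! i)}) \<cdot> (Idl (mon ` exponents u v)) \<subseteq> Idl (mon ` exponents (a + u) (b + v))"
proof (rule ideal_prod_Idl_least[OF genideal_ideal[OF mon_image_carrier] gens_carrier mon_image_carrier])
  fix x y assume "x \<in> {zs ! i |i. i < length zs \<and> P (fs ! i)}" "y \<in> mon ` exponents u v"
  then obtain i e where i: "i < length zs" "P (fs ! i)" "x = zs ! i" and e: "e \<in> exponents u v" "y = mon e" by auto
  obtain g where g: "g \<in> exponents a b" "mon g = x" using gen_exponent[OF i(1)] assms[OF i(1,2)] i(3) by auto
  have "map2 (+) g e \<in> exponents (a + u) (b + v)" using exponents_add g e by blast
  moreover have "mon (map2 (+) g e) = x \<otimes> y" using g e by (auto simp: exponents_def mon_add)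
  ultimately show "x \<otimes> y \<in> Idl (mon ` exponents (a + u) (b + v))"
    using genideal_self[OF mon_image_carrier, of "exponents (a + u) (b + v)"] by (metis imageI subsetD)
qed

lemma bipow_eq_Idl: "bipow u v = Idl (mon ` exponents u v)"
proof
  show "Idl (mon ` exponents u v) \<subseteq> bipow u v"
    by (rule genideal_minimal[OF bipow_ideal]) (use mon_in_bipow' in auto)
  have base: "bipow 0 v \<subseteq> Idl (mon ` exponents 0 v)"
  proof (induction v)
    case 0
    have "\<one> \<in> mon ` exponents 0 0"
      using imageI[OF zero_exponent, of mon] monomial_zero[OF zs_carrier] by simp
    then have "\<one> \<in> Idl (mon ` exponents 0 0)" using genideal_self[OF mon_image_carrier] by blast
    then have "Idl (mon ` exponents 0 0) = carrier R"
      using ideal_proper_iff[OF genideal_ideal[OF mon_image_carrier]] by blast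
    then show ?case using ideal_subset[OF bipow_ideal] by simp
  next
    case (Suc v)
    have "bipow 0 (Suc v) = I \<cdot> bipow 0 v"
      by (simp add: bipow_0 ideal_pow_Suc ideal_prod_commute ideal_pow_ideal I_ideal)
    also have "\<dots> \<subseteq> I \<cdot> (Idl (mon ` exponents 0 v))" by (rule ideal_prod_mono) (use Suc in auto)
    also have "\<dots> \<subseteq> Idl (mon ` exponents (0 + 0) (1 + v))"
      unfolding I_gen by (rule gens_mult_mons[where P="\<lambda>f. \<not> f"]) auto
    finally show ?case by simp
  qed
  show "bipow u v \<subseteq> Idl (mon ` exponents u v)"
  proof (induction u)
    case (Suc u)
    have "bipow (Suc u) v = M \<cdot> bipow u v"
      using bipow_prod[of "Suc 0" 0 u v] unfolding bipow_0 ideal_pow_1[OF M_ideal] by simp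
    also have "\<dots> \<subseteq> M \<cdot> (Idl (mon ` exponents u v))" by (rule ideal_prod_mono) (use Suc in auto)
    also have "\<dots> \<subseteq> Idl (mon ` exponents (1 + u) (0 + v))"
      unfolding M_gen by (rule gens_mult_mons[where P="\<lambda>f. f"]) auto
    finally show ?case by simp
  qed (rule base)
qed

definition smaller_ideal :: "nat list \<Rightarrow> 'a set" where
  "smaller_ideal e = Idl (mon ` {f \<in> exponents (degM e) (degI e). f < e})"

lemma smaller_ideal_ideal: "ideal (smaller_ideal e) R"
  unfolding smaller_ideal_def by (intro genideal_ideal mon_image_carrier)

text \<open>Passing to a colon ideal reduces this to generators, where adding g preserves equality
  of bidegrees as well as the lexicographic order.\<close>

lemma mon_mult_smaller_ideal:
  assumes "length e = length zs" "length g = length zs" "q \<in> smaller_ideal e"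
  shows "mon g \<otimes> q \<in> smaller_ideal (map2 (+) g e)"
proof -
  let ?C = "colon (smaller_ideal (map2 (+) g e)) {mon g}"
  have "smaller_ideal e \<subseteq> ?C"
    unfolding smaller_ideal_def[of e]
  proof (rule genideal_minimal)
    show "ideal ?C R" by (rule ideal_colon_elem_ideal[OF smaller_ideal_ideal mon_closed])
    show "mon ` {f \<in> exponents (degM e) (degI e). f < e} \<subseteq> ?C"
    proof (rule image_subsetI)
      fix f assume f: "f \<in> {f \<in> exponents (degM e) (degI e). f < e}"
      then have lf: "length f = length zs" by (simp add: exponents_def)
      have "map2 (+) g f < map2 (+) g e" by (rule list_add_mono_lex) (use assms lf f in auto)
      moreover have "map2 (+) g f \<in> exponents (degM (map2 (+) g e)) (degI (map2 (+) g e))"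
        using assms lf f by (simp add: exponents_def flag_degree_add length_fs)
      ultimately have "mon (map2 (+) g f) \<in> smaller_ideal (map2 (+) g e)"
        unfolding smaller_ideal_def
        by (intro subsetD[OF genideal_self[OF mon_image_carrier]] imageI CollectI conjI)
      moreover have "mon (map2 (+) g f) = mon f \<otimes> mon g"
        unfolding mon_add[OF assms(2) lf] by (intro m_comm mon_closed)
      ultimately show "mon f \<in> ?C" using mon_closed by (simp add: ideal_colon_def)
    qed
  qed
  then have "q \<in> ?C" using assms(3) by blast
  then have "q \<in> carrier R" "q \<otimes> mon g \<in> smaller_ideal (map2 (+) g e)" by (simp_all add: ideal_colon_def)
  then show ?thesis using m_comm[OF mon_closed, of q g] by simp
qed

text \<open>A Groebner-style argument: an exponent is standard if its monomial does not reduce to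
  lexicographically smaller monomials of the same bidegree, modulo terms of higher order.\<close>

definition lower_ideal :: "nat list \<Rightarrow> 'a set" where
  "lower_ideal e = (let u = degM e; v = degI e in
     (bipow (Suc u) v <+> ideal_pow I (Suc v)) <+> smaller_ideal e)"

definition standard :: "nat list set" where
  "standard = {e. length e = length zs \<and> mon e \<notin> lower_ideal e}"

lemma lower_ideal_ideal: "ideal (lower_ideal e) R"
  unfolding lower_ideal_def Let_def
  by (intro add_ideals bipow_ideal ideal_pow_ideal I_ideal smaller_ideal_ideal)

text \<open>If \<open>mon e'\<close> reduced, multiplying its reduction by \<open>mon g\<close> with
  e = g + e' would reduce \<open>mon e\<close>: each of the three summands of
  \<open>lower_ideal e'\<close> is carried into the corresponding one for e. Hence the nonstandard
  exponents form a monomial ideal.\<close>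

lemma standard_downward:
  assumes e: "e \<in> standard" and le: "list_all2 (\<le>) e' e"
  shows "e' \<in> standard"
proof (rule ccontr)
  assume ns: "e' \<notin> standard"
  define g where "g = map2 (-) e e'"
  define u v where "u = degM e'" and "v = degI e'"
  define a b where "a = degM g" and "b = degI g"
  have len: "length e = length zs" "length e' = length zs" "length g = length zs"
    using e list_all2_lengthD[OF le] by (auto simp: standard_def g_def)
  have eg: "e = map2 (+) g e'" unfolding g_def by (rule list_all2_diff_add[OF le])
  have deg: "degM e = u + a" "degI e = v + b"
    using len unfolding eg u_def v_def a_def b_def by (simp_all add: flag_degree_add length_fs)
  have g: "mon g \<in> bipow a b" unfolding a_def b_def by (rule mon_in_bipow[OF len(3)])
  note ids = bipow_ideal ideal_pow_ideal[OF I_ideal] smaller_ideal_ideal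
  let ?H = "bipow (Suc (u + a)) (v + b) <+> ideal_pow I (Suc (v + b))"
  have low: "lower_ideal e = ?H <+> smaller_ideal e" by (simp add: lower_ideal_def deg Let_def)
  have H: "ideal ?H R" by (intro add_ideals ids)
  have sub: "bipow (Suc (u + a)) (v + b) \<subseteq> lower_ideal e" "ideal_pow I (Suc (v + b)) \<subseteq> lower_ideal e"
    "smaller_ideal e \<subseteq> lower_ideal e"
    unfolding low using add_ideals_upper1[OF ids(1,2)] add_ideals_upper2[OF ids(1,2)]
      add_ideals_upper1[OF H ids(3)] add_ideals_upper2[OF H ids(3)] by blast+
  let ?C = "colon (lower_ideal e) {mon g}"
  have Cc: "x \<in> ?C" if "x \<in> J" "ideal J R" "mon g \<otimes> x \<in> lower_ideal e" for x J
    using that m_comm[OF mon_closed ideal.Icarr[OF that(2,1)], of g] ideal.Icarr[OF that(2,1)]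
    by (simp add: ideal_colon_def)
  have "(bipow (Suc u) v <+> ideal_pow I (Suc v)) <+> smaller_ideal e' \<subseteq> ?C"
  proof (intro add_ideals_least ideal_colon_elem_ideal[OF lower_ideal_ideal mon_closed] subsetI)
    fix x assume x: "x \<in> bipow (Suc u) v"
    have "mon g \<otimes> x \<in> bipow (a + Suc u) (b + v)" by (rule bipow_mult[OF g x])
    then show "x \<in> ?C" using sub(1) Cc[OF x ids(1)] by (auto simp: add.commute)
  next
    fix x assume x: "x \<in> ideal_pow I (Suc v)"
    have "mon g \<in> ideal_pow I b"
      using g ideal_prod_subset2[OF ideal_pow_ideal[OF M_ideal] ids(2)] unfolding bipow_def by blast
    then have "mon g \<otimes> x \<in> ideal_pow I (b + Suc v)"
      unfolding ideal_pow_add[OF I_ideal] using x by (rule ideal_prod.prod)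
    then have "mon g \<otimes> x \<in> ideal_pow I (Suc (v + b))" by (simp only: add_Suc_right add.commute)
    then show "x \<in> ?C" using sub(2) Cc[OF x ids(2)] by blast
  next
    fix x assume x: "x \<in> smaller_ideal e'"
    show "x \<in> ?C" using mon_mult_smaller_ideal[OF len(2,3) x] sub(3) eg by (intro Cc[OF x ids(3)]) auto
  qed
  moreover have "mon e' \<in> (bipow (Suc u) v <+> ideal_pow I (Suc v)) <+> smaller_ideal e'"
    using ns len by (simp add: standard_def lower_ideal_def Let_def u_def v_def)
  ultimately have "mon e' \<in> ?C" by blast
  then have "mon e' \<otimes> mon g \<in> lower_ideal e" by (simp add: ideal_colon_def)
  then have "mon e \<in> lower_ideal e" using mon_add[OF len(3,2)] m_comm mon_closed eg by simp
  then show False using e by (simp add: standard_def)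
qed

end

section \<open>The bigraded Hilbert function\<close>

context noetherian_local_ring
begin

lemma m_ideal: "ideal \<mm> R"
  using maximal by (rule maximalideal.axioms(1))

lemma m_proper: "\<mm> \<noteq> carrier R"
  using maximal maximalideal.I_notcarr by metis

lemma ideal_above_m: "ideal J R \<Longrightarrow> \<mm> \<subseteq> J \<Longrightarrow> J = \<mm> \<or> J = carrier R"
  using maximalideal.I_maximal[OF maximal] ideal_subset by blast

lemma interval_length_m: "ilen \<mm> (carrier R) = 1"
proof (rule antisym)
  have "ilen \<mm> (carrier R) \<le> enat 1"
    unfolding interval_length_def
  proof (rule chain_length_le_rank[where f="\<lambda>K. if K = carrier R then 1 else 0"])
    fix X Y assume XY: "X \<in> ideal_interval R \<mm> (carrier R)" "Y \<in> ideal_interval R \<mm> (carrier R)" "X \<subset> Y"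
    then have "X = \<mm> \<or> X = carrier R" "Y = \<mm> \<or> Y = carrier R"
      using ideal_above_m by (auto simp: ideal_interval_def)
    then have "X = \<mm>" "Y = carrier R" using XY by (auto simp: ideal_interval_def)
    then show "(if X = carrier R then 1 else 0) < (if Y = carrier R then 1 else (0::nat))" using m_proper by simp
  qed auto
  then show "ilen \<mm> (carrier R) \<le> 1" by (simp add: one_enat_def)
  have "ilen \<mm> \<mm> < ilen \<mm> (carrier R)"
    using m_ideal oneideal m_proper ideal_subset[OF m_ideal] by (intro interval_length_less) auto
  then show "1 \<le> ilen \<mm> (carrier R)" by (simp add: ileI1 one_eSuc)
qed

text \<open>The colon ideal (A : x) contains the maximal ideal, so the cyclic module (A + (x))/A is
  zero or simple.\<close>

lemma interval_length_simple_step: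
  assumes "ideal A R" "x \<in> carrier R" "\<And>y. y \<in> \<mm> \<Longrightarrow> y \<otimes> x \<in> A"
  shows "ilen A (A <+> PIdl x) = (if x \<in> A then 0 else 1)"
proof (cases "x \<in> A")
  case True
  then have "A <+> PIdl x = A"
    using assms by (intro add_ideals_absorb1 ideal_PIdl) (auto simp: PIdl_subset_iff)
  then show ?thesis using True by simp
next
  case False
  have "\<mm> \<subseteq> colon A {x}"
    using assms(3) ideal.Icarr[OF m_ideal] by (auto simp: ideal_colon_def)
  moreover have "\<one> \<notin> colon A {x}"
    using False assms(2) by (simp add: ideal_colon_def)
  then have "colon A {x} \<noteq> carrier R" by auto
  ultimately have "colon A {x} = \<mm>"
    using ideal_above_m ideal_colon_elem_ideal[OF assms(1,2)] by blast
  then show ?thesis using False interval_length_m interval_length_colon[OF assms(1,2)] by simp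
qed

text \<open>When the \<open>f e\<close> are adjoined in increasing order, each step is zero or
  simple, and it is simple exactly when \<open>f e\<close> is new modulo its predecessors.\<close>

lemma interval_length_monomials:
  fixes f :: "'i :: linorder \<Rightarrow> 'a"
  assumes "finite X" "ideal A R" "range f \<subseteq> carrier R" "\<And>e y. e \<in> X \<Longrightarrow> y \<in> \<mm> \<Longrightarrow> y \<otimes> f e \<in> A"
  shows "ilen A (A <+> Idl (f ` X)) =
    enat (card {e \<in> X. f e \<notin> A <+> Idl (f ` {i \<in> X. i < e})})"
  using assms(1,4)
proof (induction X rule: finite_linorder_max_induct)
  case empty
  then show ?case
    using assms(2) by (simp add: Idl_empty add_ideals_absorb1 zeroideal ideal_zeroD zero_enat_def)
next
  case (insert b X)
  have fc: "f e \<in> carrier R" "f ` Y \<subseteq> carrier R" for e Y using assms(3) by auto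
  define B where "B = A <+> Idl (f ` X)"
  have Bi: "ideal B R" unfolding B_def by (intro add_ideals assms genideal_ideal fc)
  have AB: "A \<subseteq> B" unfolding B_def by (intro add_ideals_upper1 assms genideal_ideal fc)
  note Px = ideal_PIdl[OF fc(1)[of b]]
  have eq: "A <+> Idl (f ` insert b X) = B <+> PIdl (f b)"
  proof -
    have "A <+> Idl (f ` insert b X) = A <+> (PIdl (f b) <+> Idl (f ` X))"
      using fc by (simp add: Idl_insert)
    also have "PIdl (f b) <+> Idl (f ` X) = Idl (f ` X) <+> PIdl (f b)"
      by (intro set_add_comm ideal_subset Px genideal_ideal fc)
    also have "A <+> (Idl (f ` X) <+> PIdl (f b)) = B <+> PIdl (f b)"
      unfolding B_def by (intro add_ideals_assoc[symmetric] assms Px genideal_ideal fc)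
    finally show ?thesis .
  qed
  have "ilen A (B <+> PIdl (f b)) = ilen A B + ilen B (B <+> PIdl (f b))"
    by (intro interval_length_add assms Bi add_ideals Px AB add_ideals_upper1)
  also have "ilen B (B <+> PIdl (f b)) = (if f b \<in> B then 0 else 1)"
    using insert.prems AB by (intro interval_length_simple_step Bi fc) auto
  also have "ilen A B = enat (card {e \<in> X. f e \<notin> A <+> Idl (f ` {i \<in> X. i < e})})"
    unfolding B_def using insert.prems by (intro insert.IH) auto
  also have "{e \<in> X. f e \<notin> A <+> Idl (f ` {i \<in> X. i < e})} = {e \<in> X. f e \<notin> A <+> Idl (f ` {i \<in> insert b X. i < e})}"
  proof -
    \<comment> \<open>The new index is the largest, so the predecessors of the old ones do not
      change.\<close>
    have "{i \<in> insert b X. i < e} = {i \<in> X. i < e}" if "e \<in> X" for e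
      using insert.hyps that by force
    then show ?thesis by auto
  qed
  also have "enat (card {e \<in> X. f e \<notin> A <+> Idl (f ` {i \<in> insert b X. i < e})}) + (if f b \<in> B then 0 else 1) =
      enat (card {e \<in> insert b X. f e \<notin> A <+> Idl (f ` {i \<in> insert b X. i < e})})"
  proof -
    define q where "q e \<longleftrightarrow> f e \<notin> A <+> Idl (f ` {i \<in> insert b X. i < e})" for e
    have "{i \<in> insert b X. i < b} = X" using insert.hyps by auto
    then have "q b \<longleftrightarrow> f b \<notin> B" unfolding q_def B_def by simp
    then have "{e \<in> insert b X. q e} = (if f b \<in> B then {} else {b}) \<union> {e \<in> X. q e}"
      by auto
    then have "{e \<in> insert b X. f e \<notin> A <+> Idl (f ` {i \<in> insert b X. i < e})} =
       (if f b \<in> B then {} else {b}) \<union> {e \<in> X. f e \<notin> A <+> Idl (f ` {i \<in> insert b X. i < e})}"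
      unfolding q_def .
    moreover have "b \<notin> X" using insert.hyps by auto
    ultimately show ?thesis using insert.hyps(1) by (simp add: one_enat_def zero_enat_def)
  qed
  finally show ?case unfolding eq .
qed

end

locale local_two_ideals = noetherian_local_ring R \<mm> + two_ideals R \<mm> I zs fs
  for R (structure) and \<mm> and I and zs and fs
begin

text \<open>Here M is the maximal ideal, which multiplies M^u I^v into M^(u+1) I^v. The monomials of
  bidegree (u, v) therefore give simple or zero steps, and the simple ones are the standard
  exponents.\<close>

lemma interval_length_bidegree:
  "ilen (bipow (Suc u) v <+> ideal_pow I (Suc v)) (bipow u v <+> ideal_pow I (Suc v))
     = enat (card (standard \<inter> exponents u v))"
proof -
  let ?A = "bipow (Suc u) v <+> ideal_pow I (Suc v)"
  note ids = bipow_ideal ideal_pow_ideal[OF I_ideal]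
  have A: "ideal ?A R" by (intro add_ideals ids)
  have "?A <+> Idl (mon ` exponents u v) = bipow u v <+> ideal_pow I (Suc v)"
  proof -
    have "?A <+> Idl (mon ` exponents u v) = bipow u v <+> ?A"
      unfolding bipow_eq_Idl[symmetric, of u v] by (intro set_add_comm ideal_subset ids A)
    also have "\<dots> = (bipow u v <+> bipow (Suc u) v) <+> ideal_pow I (Suc v)"
      by (intro add_ideals_assoc[symmetric] ids)
    also have "bipow u v <+> bipow (Suc u) v = bipow u v"
      by (intro add_ideals_absorb1 ids bipow_antimono) auto
    finally show ?thesis .
  qed
  moreover have "ilen ?A (?A <+> Idl (mon ` exponents u v)) =
     enat (card {e \<in> exponents u v. mon e \<notin> ?A <+> Idl (mon ` {i \<in> exponents u v. i < e})})"
  proof (rule interval_length_monomials[OF finite_exponents A])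
    fix e y assume "e \<in> exponents u v" "y \<in> \<mm>"
    then have "y \<otimes> mon e \<in> bipow (Suc 0 + u) (0 + v)"
      using mon_in_bipow' by (intro bipow_mult) (simp_all only: bipow_0 ideal_pow_1[OF m_ideal])
    then have "y \<otimes> mon e \<in> bipow (Suc u) v" by simp
    then show "y \<otimes> mon e \<in> ?A" using add_ideals_upper1[OF ids] by blast
  qed (use mon_closed in auto)
  moreover have "{e \<in> exponents u v. mon e \<notin> ?A <+> Idl (mon ` {i \<in> exponents u v. i < e})} = standard \<inter> exponents u v"
    by (auto simp: standard_def lower_ideal_def smaller_ideal_def Let_def exponents_def)
  ultimately show ?thesis by simp
qed

text \<open>Telescopes the filtration of I^v/I^(v+1) induced by powers of the maximal ideal, through
  the bidegrees (0, v) to (u - 1, v).\<close>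

lemma interval_length_adic:
  "ilen (bipow u v <+> ideal_pow I (Suc v)) (ideal_pow I v) =
     enat (card {e \<in> standard. degM e < u \<and> degI e = v})"
proof (induction u)
  case 0
  have "bipow 0 v <+> ideal_pow I (Suc v) = ideal_pow I v"
    unfolding bipow_0 by (intro add_ideals_absorb1 ideal_pow_ideal I_ideal ideal_pow_antimono) auto
  then show ?case by (simp add: zero_enat_def)
next
  case (Suc u)
  note ids = bipow_ideal ideal_pow_ideal[OF I_ideal]
  have fin: "finite {e \<in> standard. degM e < u \<and> degI e = v}"
    by (rule finite_subset[OF _ finite_flag_degree_le[of fs True u v]]) (auto simp: standard_def length_fs)
  have "ilen (bipow (Suc u) v <+> ideal_pow I (Suc v)) (ideal_pow I v) =
     ilen (bipow (Suc u) v <+> ideal_pow I (Suc v)) (bipow u v <+> ideal_pow I (Suc v)) +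
     ilen (bipow u v <+> ideal_pow I (Suc v)) (ideal_pow I v)"
  proof (intro interval_length_add add_ideals ids)
    show "bipow (Suc u) v <+> ideal_pow I (Suc v) \<subseteq> bipow u v <+> ideal_pow I (Suc v)"
      by (intro set_add_mono bipow_antimono) auto
    show "bipow u v <+> ideal_pow I (Suc v) \<subseteq> ideal_pow I v"
      using bipow_antimono[of 0 u v v]
      by (intro add_ideals_least ids ideal_pow_antimono I_ideal) (auto simp: bipow_0)
  qed
  also have "\<dots> = enat (card (standard \<inter> exponents u v) +
      card {e \<in> standard. degM e < u \<and> degI e = v})"
    unfolding interval_length_bidegree Suc.IH by simp
  also have "card (standard \<inter> exponents u v) +
      card {e \<in> standard. degM e < u \<and> degI e = v}
     = card ((standard \<inter> exponents u v) \<union> {e \<in> standard. degM e < u \<and> degI e = v})"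
    using fin finite_exponents by (intro card_Un_disjoint[symmetric]) (auto simp: exponents_def)
  also have "(standard \<inter> exponents u v) \<union> {e \<in> standard. degM e < u \<and> degI e = v}
     = {e \<in> standard. degM e < Suc u \<and> degI e = v}"
    by (auto simp: exponents_def standard_def)
  finally show ?case .
qed

lemma sum_interval_length_adic:
  "(\<Sum>v=0..s. ilen (bipow (Suc r) v <+> ideal_pow I (Suc v)) (ideal_pow I v)) =
     enat (card {e \<in> standard. degM e \<le> r \<and> degI e \<le> s})"
proof -
  let ?S = "\<lambda>v. {e \<in> standard. degM e < Suc r \<and> degI e = v}"
  have "{e \<in> standard. degM e \<le> r \<and> degI e \<le> s} = (\<Union>v\<in>{0..s}. ?S v)"
    by auto
  moreover have "card (\<Union>v\<in>{0..s}. ?S v) = (\<Sum>v=0..s. card (?S v))"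
  proof (rule card_UN_disjoint)
    show "\<forall>v\<in>{0..s}. finite (?S v)"
      by (intro ballI finite_subset[OF _ finite_flag_degree_le[of fs True r s]]) (auto simp: standard_def length_fs)
  qed auto
  moreover have "(\<Sum>v=0..s. enat (card (?S v))) = enat (\<Sum>v=0..s. card (?S v))" for s
    by (induction s) auto
  ultimately show ?thesis unfolding interval_length_adic by simp
qed

end

section \<open>Submodules of a quotient of ideals\<close>

context cring
begin

text \<open>Submodules of B/A correspond to ideals between A and B: an ideal goes to its set of
  cosets, a submodule to its union.\<close>

lemma module_length_quotient_ideal:
  assumes A: "ideal A R" and B: "ideal B R" and AB: "A \<subseteq> B"
  shows "module_length R (quotient_module (ideal_module R B) A) = ilen A B"
proof -
  define Q where "Q = quotient_module (ideal_module R B) A"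
  have coset: "A +>\<^bsub>ideal_module R B\<^esub> x = A +> x" for x
    by (simp add: a_r_coset_def r_coset_def ideal_module_def)
  have Qc: "carrier Q = {A +> x |x. x \<in> B}"
    by (auto simp: Q_def quotient_module_def A_RCOSETS_def RCOSETS_def r_coset_def a_r_coset_def ideal_module_def)
  have Qadd: "X \<oplus>\<^bsub>Q\<^esub> Y = X <+> Y" for X Y
    by (simp add: Q_def quotient_module_def set_add_def set_mult_def ideal_module_def)
  have Qzero: "\<zero>\<^bsub>Q\<^esub> = A" by (simp add: Q_def quotient_module_def)
  have Qsmult: "a \<odot>\<^bsub>Q\<^esub> X = (\<Union>x\<in>X. A +> (a \<otimes> x))" for a X
    by (simp add: Q_def quotient_module_def coset) (simp add: ideal_module_def)
  have Bc: "x \<in> carrier R" if "x \<in> B" for x using that B ideal_subset by auto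
  have cos_eq: "A +> x = A +> y \<longleftrightarrow> x \<ominus> y \<in> A" if "x \<in> carrier R" "y \<in> carrier R" for x y
    using quotient_eq_iff_same_a_r_cos[OF A that] by simp
  have cos_self: "x \<in> A +> x" if "x \<in> carrier R" for x
    using abelian_subgroup.a_rcos_self[OF abelian_subgroupI3[OF ideal.axioms(1)[OF A] is_abelian_group] that] .
  have cos_mem: "A +> y = A +> x" if "x \<in> carrier R" "y \<in> A +> x" for x y
    using a_repr_independence[OF that(2,1)] additive_subgroup.a_subgroup[OF ideal.axioms(1)[OF A]] by simp
  have cos_sub: "A +> x \<subseteq> carrier R" if "x \<in> carrier R" for x
    using that A a_r_coset_subset_G ideal_subset by auto
  have cos_in: "A +> x \<subseteq> K" if "ideal K R" "A \<subseteq> K" "x \<in> K" for K x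
    using that by (auto simp: a_r_coset_def' intro!: ideal_addD)
  have cos_add: "(A +> x) <+> (A +> y) = A +> (x \<oplus> y)" if "x \<in> carrier R" "y \<in> carrier R" for x y
    using that ideal.a_rcos_sum[OF A] by simp
  have cos_smult: "a \<odot>\<^bsub>Q\<^esub> (A +> x) = A +> (a \<otimes> x)" if a: "a \<in> carrier R" and x: "x \<in> carrier R" for a x
  proof -
    \<comment> \<open>The union in the scalar multiplication collapses, since every representative
      gives the same coset.\<close>
    have "A +> (a \<otimes> y) = A +> (a \<otimes> x)" if y: "y \<in> A +> x" for y
    proof -
      have yc: "y \<in> carrier R" using y cos_sub[OF x] by auto
      have "y \<ominus> x \<in> A" using cos_mem[OF x y] cos_eq yc x by simp
      then have "a \<otimes> (y \<ominus> x) \<in> A" using A a by (intro ideal_multD)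
      moreover have "a \<otimes> (y \<ominus> x) = a \<otimes> y \<ominus> a \<otimes> x"
        using a x yc by (simp add: a_minus_def r_distr r_minus)
      ultimately show ?thesis using cos_eq a x yc by simp
    qed
    then have "(\<Union>y\<in>A +> x. A +> (a \<otimes> y)) = (\<Union>y\<in>A +> x. A +> (a \<otimes> x))"
      by (intro SUP_cong refl)
    also have "\<dots> = A +> (a \<otimes> x)" using cos_self[OF x] by blast
    finally show ?thesis unfolding Qsmult .
  qed
  define f where "f K = {A +> k |k. k \<in> K}" for K
  have f_mem: "A +> x \<in> f K \<longleftrightarrow> x \<in> K" if K: "K \<in> ideal_interval R A B" and x: "x \<in> carrier R" for K x
  proof
    assume "A +> x \<in> f K"
    then obtain k where k: "k \<in> K" "A +> x = A +> k" by (auto simp: f_def)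
    have kc: "k \<in> carrier R" using k K ideal_subset by (auto simp: ideal_interval_def)
    then have "x \<in> A +> k" using cos_self[OF x] k by simp
    then show "x \<in> K" using cos_in[of K k] K k by (auto simp: ideal_interval_def)
  qed (auto simp: f_def)
  have main: "chain_length (ideal_interval R A B) = chain_length {N. submodule N R Q}"
  proof (rule chain_length_eq_inverse[where f=f and g="\<lambda>N. \<Union>N"])
    fix K assume K0: "K \<in> ideal_interval R A B"
    then have K: "ideal K R" "A \<subseteq> K" "K \<subseteq> B" by (auto simp: ideal_interval_def)
    have Kc: "k \<in> carrier R" if "k \<in> K" for k using K that Bc by auto
    show "\<Union> (f K) = K"
    proof
      show "\<Union> (f K) \<subseteq> K" using cos_in[OF K(1,2)] by (auto simp: f_def)
      show "K \<subseteq> \<Union> (f K)"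
      proof
        fix k assume "k \<in> K"
        then show "k \<in> \<Union> (f K)" using cos_self[OF Kc] by (intro UnionI[of "A +> k"]) (auto simp: f_def)
      qed
    qed
    \<comment> \<open>\<open>Q\<close> is handled as a bare record, so the inverse demanded of a
      subgroup is obtained from its definite description, by existence and uniqueness.\<close>
    have inv: "inv\<^bsub>add_monoid Q\<^esub> (A +> k) = A +> (\<ominus> k)" if k: "k \<in> K" for k
      unfolding m_inv_def
    proof (rule the_equality)
      have kk: "k \<in> carrier R" "k \<in> B" "\<ominus> k \<in> B" using k K Kc B ideal_uminusD by auto
      have z: "A +> \<zero> = A" by (simp add: a_coset_add_zero ideal_subset[OF A])
      show "A +> \<ominus> k \<in> carrier (add_monoid Q) \<and> (A +> k) \<otimes>\<^bsub>add_monoid Q\<^esub> (A +> \<ominus> k) = \<one>\<^bsub>add_monoid Q\<^esub>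
         \<and> (A +> \<ominus> k) \<otimes>\<^bsub>add_monoid Q\<^esub> (A +> k) = \<one>\<^bsub>add_monoid Q\<^esub>"
        using kk z by (auto simp: Qc Qadd Qzero cos_add r_neg l_neg)
      fix Y assume Y: "Y \<in> carrier (add_monoid Q) \<and> (A +> k) \<otimes>\<^bsub>add_monoid Q\<^esub> Y = \<one>\<^bsub>add_monoid Q\<^esub>
         \<and> Y \<otimes>\<^bsub>add_monoid Q\<^esub> (A +> k) = \<one>\<^bsub>add_monoid Q\<^esub>"
      then obtain y where y: "y \<in> B" "Y = A +> y" by (auto simp: Qc)
      then have "A +> (y \<oplus> k) = A +> \<zero>" using Y kk Bc z by (simp add: Qadd Qzero cos_add)
      then have "(y \<oplus> k) \<ominus> \<zero> \<in> A" using cos_eq kk Bc y by simp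
      then have "y \<ominus> (\<ominus> k) \<in> A" using kk Bc[OF y(1)] by (simp add: a_minus_def)
      then show "Y = A +> \<ominus> k" using y cos_eq kk Bc by simp
    qed
    show "f K \<in> {N. submodule N R Q}"
    proof (intro CollectI submodule.intro subgroup.intro submodule_axioms.intro)
      show "f K \<subseteq> carrier (add_monoid Q)" using K by (auto simp: f_def Qc)
      have "A = A +> \<zero>" by (simp add: a_coset_add_zero ideal_subset[OF A])
      then show "\<one>\<^bsub>add_monoid Q\<^esub> \<in> f K" using ideal_zeroD[OF K(1)] by (auto simp: f_def Qzero)
      fix X assume "X \<in> f K"
      then obtain k where k: "k \<in> K" "X = A +> k" by (auto simp: f_def)
      show "inv\<^bsub>add_monoid Q\<^esub> X \<in> f K" using inv k ideal_uminusD[OF K(1)] by (auto simp: f_def)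
      show "a \<odot>\<^bsub>Q\<^esub> X \<in> f K" if "a \<in> carrier R" for a
        using k cos_smult[OF that Kc] ideal_multD[OF K(1) _ that] by (auto simp: f_def)
      fix Y assume "Y \<in> f K"
      then obtain l where l: "l \<in> K" "Y = A +> l" by (auto simp: f_def)
      show "X \<otimes>\<^bsub>add_monoid Q\<^esub> Y \<in> f K"
        using k l cos_add Kc ideal_addD[OF K(1)] by (auto simp: f_def Qadd)
    qed
  next
    fix N assume "N \<in> {N. submodule N R Q}"
    then interpret N: submodule N R Q by simp
    have Nc: "N \<subseteq> {A +> x |x. x \<in> B}" using N.subset by (simp add: Qc)
    have mem: "x \<in> \<Union>N \<longleftrightarrow> x \<in> carrier R \<and> A +> x \<in> N" for x
    proof
      assume "x \<in> \<Union>N"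
      then obtain y where y: "y \<in> B" "A +> y \<in> N" "x \<in> A +> y" using Nc by blast
      then show "x \<in> carrier R \<and> A +> x \<in> N" using cos_mem[of y x] cos_sub[of y] Bc by auto
    qed (use cos_self in blast)
    have sub: "\<Union>N \<subseteq> B" using Nc cos_in[OF B AB] by auto
    show "\<Union>N \<in> ideal_interval R A B"
      unfolding ideal_interval_def
    proof (intro CollectI conjI sub)
      show "A \<subseteq> \<Union>N" using N.one_closed by (auto simp: Qzero)
      show "ideal (\<Union>N) R"
      proof (rule idealI_elem)
        show "\<zero> \<in> \<Union>N" using N.one_closed ideal_zeroD[OF A] by (auto simp: Qzero)
        fix a b assume "a \<in> \<Union>N" "b \<in> \<Union>N"
        then have ab: "a \<in> carrier R" "A +> a \<in> N" "b \<in> carrier R" "A +> b \<in> N" by (simp_all only: mem)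
        then have "(A +> a) <+> (A +> b) \<in> N" using N.m_closed[of "A +> a" "A +> b"] by (simp add: Qadd)
        then show "a \<oplus> b \<in> \<Union>N" unfolding mem using ab cos_add by simp
      next
        fix a r assume "a \<in> \<Union>N" and r: "r \<in> carrier R"
        then have a: "a \<in> carrier R" "A +> a \<in> N" by (simp_all only: mem)
        then have "r \<odot>\<^bsub>Q\<^esub> (A +> a) \<in> N" using r by blast
        then show "r \<otimes> a \<in> \<Union>N" unfolding mem using a r cos_smult by simp
      qed (use sub Bc in blast)
    qed
    show "f (\<Union>N) = N"
    proof
      show "f (\<Union>N) \<subseteq> N" unfolding f_def mem by blast
      show "N \<subseteq> f (\<Union>N)"
      proof
        fix X assume X: "X \<in> N"
        then obtain x where x: "x \<in> B" "X = A +> x" using Nc by blast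
        then have "x \<in> \<Union>N" unfolding mem using X Bc by simp
        then show "X \<in> f (\<Union>N)" using x by (auto simp: f_def)
      qed
    qed
  qed (auto simp: f_def)
  then show ?thesis by (simp add: module_length_def interval_length_def Q_def)
qed

end

section \<open>Existence of the bigraded Hilbert polynomial\<close>

context noetherian_local_ring
begin

lemma bigraded_hilbert_fun_eq:
  assumes "ideal I R"
  shows "bigraded_hilbert_fun R \<mm> I r s =
    (\<Sum>v=0..s. ilen ((ideal_pow \<mm> (Suc r) \<cdot> ideal_pow I v) <+> ideal_pow I (Suc v)) (ideal_pow I v))"
  unfolding bigraded_hilbert_fun_def Suc_eq_plus1[symmetric]
proof (intro sum.cong refl module_length_quotient_ideal)
  note ids = ideal_pow_ideal[OF assms] ideal_pow_ideal[OF m_ideal]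
  fix v
  show "ideal (ideal_pow \<mm> (Suc r) \<cdot> ideal_pow I v <+> ideal_pow I (Suc v)) R" "ideal (ideal_pow I v) R"
    by (intro add_ideals ids ideal_prod_is_ideal)+
  show "ideal_pow \<mm> (Suc r) \<cdot> ideal_pow I v <+> ideal_pow I (Suc v) \<subseteq> ideal_pow I v"
    by (intro add_ideals_least ids ideal_prod_subset2 ideal_pow_antimono assms) auto
qed

lemma obtain_local_two_ideals:
  assumes "ideal I R"
  obtains zs fs where "local_two_ideals R \<mm> I zs fs"
proof -
  obtain xs where xs: "set xs \<subseteq> carrier R" "\<mm> = Idl (set xs)" using ideal_finite_gens[OF m_ideal] .
  obtain ys where ys: "set ys \<subseteq> carrier R" "I = Idl (set ys)" using ideal_finite_gens[OF assms] .
  define zs fs where "zs = xs @ ys" and "fs = replicate (length xs) True @ replicate (length ys) False"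
  have "{zs ! i |i. i < length zs \<and> fs ! i} = set xs"
  proof (intro equalityI subsetI)
    fix x assume "x \<in> set xs"
    then obtain i where "i < length xs" "xs ! i = x" by (auto simp: in_set_conv_nth)
    then show "x \<in> {zs ! i |i. i < length zs \<and> fs ! i}"
      by (intro CollectI exI[of _ i]) (auto simp: zs_def fs_def nth_append)
  qed (auto simp: zs_def fs_def nth_append split: if_splits)
  moreover have "{zs ! i |i. i < length zs \<and> \<not> fs ! i} = set ys"
  proof (intro equalityI subsetI)
    fix x assume "x \<in> set ys"
    then obtain i where "i < length ys" "ys ! i = x" by (auto simp: in_set_conv_nth)
    then show "x \<in> {zs ! i |i. i < length zs \<and> \<not> fs ! i}"
      by (intro CollectI exI[of _ "length xs + i"]) (auto simp: zs_def fs_def nth_append)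
  qed (auto simp: zs_def fs_def nth_append split: if_splits)
  ultimately have "local_two_ideals R \<mm> I zs fs"
    using xs ys by unfold_locales (auto simp: zs_def fs_def)
  then show thesis by (rule that)
qed

lemma bigraded_hilbert_fun_finite:
  assumes "ideal I R" shows "bigraded_hilbert_fun R \<mm> I r s \<noteq> \<infinity>"
proof -
  obtain zs fs where "local_two_ideals R \<mm> I zs fs" using obtain_local_two_ideals[OF assms] .
  then interpret local_two_ideals R \<mm> I zs fs .
  show ?thesis
    unfolding bigraded_hilbert_fun_eq[OF assms] bipow_def[symmetric] sum_interval_length_adic by simp
qed

text \<open>Gives meaning to the definite description in \<open>bigraded_hilbert_poly\<close>:
  counting standard exponents provides a polynomial, and its values at all large pairs determine
  it.\<close>

theorem bigraded_hilbert_fun_poly: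
  assumes "ideal I R"
  shows "\<exists>N. \<forall>r\<ge>N. \<forall>s\<ge>N. ereal_of_enat (bigraded_hilbert_fun R \<mm> I r s)
    = ereal (poly (poly (bigraded_hilbert_poly R \<mm> I) [:real s:]) (real r))"
proof -
  obtain zs fs where "local_two_ideals R \<mm> I zs fs" using obtain_local_two_ideals[OF assms] .
  then interpret local_two_ideals R \<mm> I zs fs .
  define h where "h r s = card {e \<in> standard. degM e \<le> r \<and> degI e \<le> s}" for r s
  have H: "bigraded_hilbert_fun R \<mm> I r s = enat (h r s)" for r s
    unfolding bigraded_hilbert_fun_eq[OF assms] bipow_def[symmetric] sum_interval_length_adic h_def by simp
  have "sep_poly (\<lambda>r s. real (h r s))"
    unfolding h_def
    using sep_poly_card_downset[of standard fs True, OF _ standard_downward]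
    by (simp add: standard_def length_fs)
  then obtain P N where PN: "\<forall>r\<ge>N. \<forall>s\<ge>N. real (h r s) = poly (poly P [:real s:]) (real r)"
    using sep_poly_imp_poly by blast
  show ?thesis unfolding bigraded_hilbert_poly_def
  proof (rule theI)
    show "\<exists>N. \<forall>r\<ge>N. \<forall>s\<ge>N. ereal_of_enat (bigraded_hilbert_fun R \<mm> I r s) = ereal (poly (poly P [:real s:]) (real r))"
      using PN by (intro exI[of _ N]) (simp add: H)
    fix Q assume "\<exists>N. \<forall>r\<ge>N. \<forall>s\<ge>N. ereal_of_enat (bigraded_hilbert_fun R \<mm> I r s) = ereal (poly (poly Q [:real s:]) (real r))"
    then obtain L where L: "\<forall>r\<ge>L. \<forall>s\<ge>L. real (h r s) = poly (poly Q [:real s:]) (real r)"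
      by (auto simp: H)
    show "Q = P"
    proof (rule bivariate_poly_eqI[of "max L N"])
      fix r s assume "r \<ge> max L N" "s \<ge> max L N"
      then show "poly (poly Q [:real s:]) (real r) = poly (poly P [:real s:]) (real r)"
        using PN L by (metis max.bounded_iff)
    qed
  qed
qed

end

section \<open>The Artin-Rees lemma\<close>

context noetherian_cring
begin

text \<open>A form of Hilbert's basis theorem, combining Dickson's lemma for the exponents with the
  chain condition in R. Greedily chosen counterexamples have a componentwise increasing subsequence,
  along which the ideals would ascend strictly.\<close>

lemma monotone_ideal_family_finite:
  fixes a :: "nat list \<Rightarrow> 'a set"
  assumes ideals: "\<And>e. length e = n \<Longrightarrow> ideal (a e) R"
    and mono: "\<And>e e'. length e = n \<Longrightarrow> list_all2 (\<le>) e' e \<Longrightarrow> a e' \<subseteq> a e"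
  shows "\<exists>F. finite F \<and> (\<forall>f\<in>F. length f = n) \<and>
    (\<forall>e. length e = n \<longrightarrow> a e \<subseteq> Idl (\<Union>f\<in>{f \<in> F. list_all2 (\<le>) f e}. a f))"
proof (rule ccontr)
  let ?I = "\<lambda>F e. Idl (\<Union>f\<in>{f \<in> F. list_all2 (\<le>) f e}. a f)"
  assume "\<not> ?thesis"
  then have "\<exists>e. length e = n \<and> \<not> a e \<subseteq> ?I F e" if "finite F" "\<forall>f\<in>F. length f = n" for F
    using that by blast
  then obtain g where g: "\<And>F. finite F \<Longrightarrow> \<forall>f\<in>F. length f = n \<Longrightarrow> length (g F) = n \<and> \<not> a (g F) \<subseteq> ?I F (g F)"
    by metis
  define Fs where "Fs = rec_nat {} (\<lambda>_ F. insert (g F) F)"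
  have Fs: "Fs 0 = {}" "Fs (Suc i) = insert (g (Fs i)) (Fs i)" for i by (simp_all add: Fs_def)
  have fin: "finite (Fs i) \<and> (\<forall>f\<in>Fs i. length f = n)" for i
    by (induction i) (use g Fs in auto)
  define e where "e i = g (Fs i)" for i
  have e: "length (e i) = n" "\<not> a (e i) \<subseteq> ?I (Fs i) (e i)" for i
    using g fin unfolding e_def by blast+
  have eFs: "e i \<in> Fs j" if "i < j" for i j
    using that by (induction j) (auto simp: Fs e_def less_Suc_eq)
  obtain \<phi> :: "nat \<Rightarrow> nat" where \<phi>: "strict_mono \<phi> \<and> (\<forall>i j. i \<le> j \<longrightarrow> list_all2 (\<le>) (e (\<phi> i)) (e (\<phi> j)))"
    using Dickson_subseq[of e n] e(1) by auto
  have inc: "a (e (\<phi> i)) \<subseteq> a (e (\<phi> (Suc i)))" for i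
    using mono[OF e(1)] \<phi> by simp
  have "a (e (\<phi> i)) \<subset> a (e (\<phi> (Suc i)))" for i
  proof -
    let ?j = "\<phi> (Suc i)"
    have "e (\<phi> i) \<in> {f \<in> Fs ?j. list_all2 (\<le>) f (e ?j)}"
      using eFs \<phi> by (simp add: strict_mono_def)
    then have "a (e (\<phi> i)) \<subseteq> (\<Union>f\<in>{f \<in> Fs ?j. list_all2 (\<le>) f (e ?j)}. a f)" by blast
    also have "\<dots> \<subseteq> ?I (Fs ?j) (e ?j)"
      by (rule genideal_self) (use fin ideals ideal_subset in blast)
    finally show ?thesis using e(2)[of ?j] inc[of i] by blast
  qed
  then have "\<And>i. (a (e (\<phi> (Suc i))), a (e (\<phi> i))) \<in> {(B, A). ideal A R \<and> ideal B R \<and> A \<subset> B}"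
    using ideals e(1) by blast
  then have "\<exists>f. \<forall>i. (f (Suc i), f i) \<in> {(B, A). ideal A R \<and> ideal B R \<and> A \<subset> B}"
    by (intro exI[of _ "\<lambda>i. a (e (\<phi> i))"]) blast
  then show False using wf_ideal_supset unfolding wf_iff_no_infinite_down_chain by blast
qed

end

context two_ideals
begin

text \<open>Up to a combination of smaller monomials of the same bidegree,
  \<open>y \<otimes> mon e\<close> lies in B: these y are the coefficients with which
  \<open>mon e\<close> can lead an element of B.\<close>

definition lead_coeffs :: "'a set \<Rightarrow> nat list \<Rightarrow> 'a set" where
  "lead_coeffs B e = colon (B <+> smaller_ideal e) {mon e}"

lemma lead_coeffs_ideal: "ideal B R \<Longrightarrow> ideal (lead_coeffs B e) R"
  unfolding lead_coeffs_def by (intro ideal_colon_elem_ideal add_ideals smaller_ideal_ideal mon_closed)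

text \<open>The element of B realizing y at e is kept in the form \<open>mon g \<otimes> p\<close>,
  because in \<open>artin_rees\<close> the factor \<open>mon g\<close> is what places it in M^r
  B.\<close>

lemma lead_coeffs_shift:
  assumes "ideal B R" "length e = length zs" "list_all2 (\<le>) e' e" "y \<in> lead_coeffs B e'"
  defines "g \<equiv> map2 (-) e e'"
  shows "\<exists>p\<in>B. \<exists>q\<in>smaller_ideal e. y \<otimes> mon e = mon g \<otimes> p \<oplus> q"
proof -
  have len: "length e' = length zs" "length g = length zs"
    using list_all2_lengthD[OF assms(3)] assms(2) by (auto simp: g_def)
  have eg: "e = map2 (+) g e'" unfolding g_def by (rule list_all2_diff_add[OF assms(3)])
  have y: "y \<in> carrier R" "y \<otimes> mon e' \<in> B <+> smaller_ideal e'"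
    using assms(4) by (auto simp: lead_coeffs_def ideal_colon_def)
  then obtain p q where pq: "p \<in> B" "q \<in> smaller_ideal e'" "y \<otimes> mon e' = p \<oplus> q"
    by (auto elim: set_add_elemE)
  have c: "p \<in> carrier R" "q \<in> carrier R" "mon g \<in> carrier R" "mon e' \<in> carrier R"
    using ideal.Icarr[OF assms(1) pq(1)] ideal.Icarr[OF smaller_ideal_ideal pq(2)] mon_closed by auto
  have "mon e = mon g \<otimes> mon e'" using mon_add[OF len(2,1)] eg by simp
  then have "y \<otimes> mon e = mon g \<otimes> (y \<otimes> mon e')" using y c by (simp add: m_lcomm)
  also have "\<dots> = mon g \<otimes> p \<oplus> mon g \<otimes> q" using pq c by (simp add: r_distr)
  finally show ?thesis using pq mon_mult_smaller_ideal[OF len(1,2) pq(2)] eg by blast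
qed

lemma lead_coeffs_mono:
  assumes "ideal B R" "length e = length zs" "list_all2 (\<le>) e' e"
  shows "lead_coeffs B e' \<subseteq> lead_coeffs B e"
proof
  fix y assume y: "y \<in> lead_coeffs B e'"
  then have yc: "y \<in> carrier R" by (simp add: lead_coeffs_def ideal_colon_def)
  obtain p q where "p \<in> B" "q \<in> smaller_ideal e" "y \<otimes> mon e = mon (map2 (-) e e') \<otimes> p \<oplus> q"
    using lead_coeffs_shift[OF assms y] by blast
  then have "y \<otimes> mon e \<in> B <+> smaller_ideal e"
    using ideal_multD[OF assms(1) _ mon_closed] by (auto intro: set_add_elemI)
  then show "y \<in> lead_coeffs B e" using yc by (simp add: lead_coeffs_def ideal_colon_def)
qed

end

context noetherian_cring
begin

text \<open>Finitely many of the ideals of leading coefficients of \<open>B\<close> generate all the others; \<open>c\<close> bounds the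
  degrees at which they occur, so that an element of \<open>B \<inter> M\<^bsup>r + c\<^esup>\<close> reduces to zero by multiples of
  elements of \<open>B\<close> with factors in \<open>M\<^sup>r\<close>.\<close>

theorem artin_rees:
  assumes "ideal M R" "ideal B R"
  shows "\<exists>c. \<forall>r. ideal_pow M (r + c) \<inter> B \<subseteq> ideal_pow M r \<cdot> B"
proof -
  obtain zs where zs: "set zs \<subseteq> carrier R" "M = Idl (set zs)" using ideal_finite_gens[OF assms(1)] .
  define fs where "fs = replicate (length zs) True"
  have sz: "{zs ! i |i. i < length zs \<and> fs ! i} = set zs"
  proof (intro equalityI subsetI)
    fix x assume "x \<in> set zs"
    then obtain i where "i < length zs" "zs ! i = x" by (auto simp: in_set_conv_nth)
    then show "x \<in> {zs ! i |i. i < length zs \<and> fs ! i}" by (intro CollectI exI[of _ i]) (auto simp: fs_def)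
  qed auto
  have nz: "{zs ! i |i. i < length zs \<and> \<not> fs ! i} = {}" by (auto simp: fs_def)
  \<comment> \<open>With all flags true and I = {0}, bidegree (n, 0) is degree n in the generators
    of M.\<close>
  interpret two_ideals R M "{\<zero>}" zs fs
  proof
    show "length fs = length zs" by (simp add: fs_def)
    show "{\<zero>} = Idl {zs ! i |i. i < length zs \<and> \<not> fs ! i}" unfolding nz Idl_empty ..
  qed (use zs in \<open>simp_all only: sz\<close>)
  have degF: "degI e = 0" for e
  proof -
    have "flag_degree False (replicate n True) e = 0" for n by (induction n arbitrary: e) auto
    then show ?thesis by (simp add: fs_def)
  qed
  obtain F where "finite F \<and> (\<forall>f\<in>F. length f = length zs) \<and> (\<forall>e. length e = length zs \<longrightarrow>
      lead_coeffs B e \<subseteq> Idl (\<Union>f\<in>{f \<in> F. list_all2 (\<le>) f e}. lead_coeffs B f))"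
    using monotone_ideal_family_finite[of "length zs" "lead_coeffs B", OF lead_coeffs_ideal[OF assms(2)]
        lead_coeffs_mono[OF assms(2)]] by (rule exE)
  then have F: "finite F" "\<And>f. f \<in> F \<Longrightarrow> length f = length zs"
    "\<And>e. length e = length zs \<Longrightarrow> lead_coeffs B e \<subseteq> Idl (\<Union>f\<in>{f \<in> F. list_all2 (\<le>) f e}. lead_coeffs B f)"
    by simp_all
  \<comment> \<open>The sum is a common bound for the degrees of the finitely many f; with it,
    \<open>map2 (-) b f\<close> has degree at least r whenever b has degree r + c.\<close>
  define c where "c = (\<Sum>f\<in>F. degM f)"
  have cF: "degM f \<le> c" if "f \<in> F" for f
    unfolding c_def using F(1) that by (rule member_le_sum[rotated 2]) auto
  have "ideal_pow M (r + c) \<inter> B \<subseteq> ideal_pow M r \<cdot> B" for r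
  proof -
    let ?J = "ideal_pow M r \<cdot> B"
    have J: "ideal ?J R" "?J \<subseteq> B"
      using ideal_prod_is_ideal ideal_prod_subset2 ideal_pow_ideal assms by auto
    let ?E = "exponents (r + c) 0"
    \<comment> \<open>X runs over initial segments in the lexicographic order, so the leading term
      at the largest exponent is removed modulo M^r B and the remainder falls to the induction
      hypothesis.\<close>
    have main: "Idl (mon ` X) \<inter> B \<subseteq> ?J"
      if "X \<subseteq> ?E" "\<forall>e\<in>X. \<forall>f\<in>?E. f < e \<longrightarrow> f \<in> X" "finite X" for X
      using that(3,1,2)
    proof (induction X rule: finite_linorder_max_induct)
      case empty
      then show ?case using ideal_zeroD[OF J(1)] by (auto simp: Idl_empty)
    next
      case (insert b X)
      have b: "length b = length zs" "degM b = r + c" using insert.prems by (auto simp: exponents_def)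
      have Xb: "{f \<in> ?E. f < b} = X" using insert.prems insert.hyps by auto
      then have Lb: "smaller_ideal b = Idl (mon ` X)" unfolding smaller_ideal_def b degF by simp
      have IH: "Idl (mon ` X) \<inter> B \<subseteq> ?J"
      proof (rule insert.IH)
        show "\<forall>e\<in>X. \<forall>f\<in>?E. f < e \<longrightarrow> f \<in> X"
        proof (intro ballI impI)
          fix e f assume ef: "e \<in> X" "f \<in> ?E" "f < e"
          then have "f < b" using insert.hyps by (meson order.strict_trans)
          moreover have "f \<in> insert b X" using insert.prems ef by blast
          ultimately show "f \<in> X" by auto
        qed
      qed (use insert.prems in auto)
      note Li = smaller_ideal_ideal[of b]
      let ?C = "colon (?J <+> smaller_ideal b) {mon b}"
      have C: "ideal ?C R" by (intro ideal_colon_elem_ideal add_ideals J Li mon_closed)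
      have "lead_coeffs B f \<subseteq> ?C" if f: "f \<in> F" "list_all2 (\<le>) f b" for f
      proof
        fix y assume y: "y \<in> lead_coeffs B f"
        let ?g = "map2 (-) b f"
        obtain p q where pq: "p \<in> B" "q \<in> smaller_ideal b" "y \<otimes> mon b = mon ?g \<otimes> p \<oplus> q"
          using lead_coeffs_shift[OF assms(2) b(1) f(2) y] by blast
        have lg: "length ?g = length zs" using b(1) F(2)[OF f(1)] by simp
        have "degM b = degM ?g + degM f"
          using flag_degree_add[of f fs ?g True] list_all2_diff_add[OF f(2)] lg F(2)[OF f(1)] length_fs by simp
        then have "r \<le> degM ?g" using cF[OF f(1)] b(2) by linarith
        moreover have "mon ?g \<in> ideal_pow M (degM ?g)"
          using mon_in_bipow[OF lg] by (simp add: degF bipow_0)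
        ultimately have "mon ?g \<in> ideal_pow M r" using ideal_pow_antimono[OF assms(1)] by blast
        then have "mon ?g \<otimes> p \<in> ?J" using pq(1) by (rule ideal_prod.prod)
        then have "y \<otimes> mon b \<in> ?J <+> smaller_ideal b" unfolding pq(3) using pq(2) by (rule set_add_elemI)
        then show "y \<in> ?C" using y by (simp add: lead_coeffs_def ideal_colon_def)
      qed
      then have "Idl (\<Union>f\<in>{f \<in> F. list_all2 (\<le>) f b}. lead_coeffs B f) \<subseteq> ?C"
        by (intro genideal_minimal C) auto
      then have aC: "lead_coeffs B b \<subseteq> ?C" using F(3)[OF b(1)] by blast
      show ?case
      proof
        fix w assume w: "w \<in> Idl (mon ` insert b X) \<inter> B"
        have "Idl (mon ` insert b X) = PIdl (mon b) <+> smaller_ideal b"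
          unfolding Lb using mon_closed mon_image_carrier by (simp add: Idl_insert)
        then obtain k l where kl: "k \<in> carrier R" "l \<in> smaller_ideal b" "w = k \<otimes> mon b \<oplus> l"
          using w by (auto elim!: set_add_elemE in_PIdlE)
        have lc: "l \<in> carrier R" "k \<otimes> mon b \<in> carrier R" "w \<in> carrier R"
          using kl ideal.Icarr[OF Li] mon_closed w ideal.Icarr[OF assms(2)] by auto
        have "k \<otimes> mon b = w \<oplus> (\<ominus> l)" using kl(3) lc by (simp add: a_assoc r_neg)
        also have "\<dots> \<in> B <+> smaller_ideal b"
          using w ideal_uminusD[OF Li kl(2)] by (intro set_add_elemI) auto
        finally have "k \<in> lead_coeffs B b" using kl(1) by (simp add: lead_coeffs_def ideal_colon_def)
        then have "k \<otimes> mon b \<in> ?J <+> smaller_ideal b" using aC by (auto simp: ideal_colon_def)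
        then obtain j l' where jl: "j \<in> ?J" "l' \<in> smaller_ideal b" "k \<otimes> mon b = j \<oplus> l'"
          by (auto elim: set_add_elemE)
        have jc: "j \<in> carrier R" "l' \<in> carrier R" using jl ideal.Icarr[OF J(1)] ideal.Icarr[OF Li] by auto
        have ll: "l' \<oplus> l \<in> smaller_ideal b" using jl(2) kl(2) by (rule ideal_addD[OF Li])
        have wj: "w = j \<oplus> (l' \<oplus> l)" using kl(3) jl(3) jc lc by (simp add: a_assoc)
        then have "l' \<oplus> l = w \<ominus> j" using add_minus_cancel_left[of j "l' \<oplus> l"] jc lc by simp
        then have "l' \<oplus> l \<in> B" using w jl(1) J(2) ideal_minusD[OF assms(2)] by auto
        then have "l' \<oplus> l \<in> ?J" using IH ll Lb by auto
        then show "w \<in> ?J" unfolding wj by (rule ideal_addD[OF J(1) jl(1)])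
      qed
    qed
    have "ideal_pow M (r + c) = Idl (mon ` ?E)" using bipow_eq_Idl[of "r + c" 0] by (simp add: bipow_0)
    then show ?thesis using main[of ?E] finite_exponents by simp
  qed
  then show ?thesis by blast
qed

end

section \<open>Lengths modulo powers of the maximal ideal\<close>

context noetherian_local_ring
begin

abbreviation mpow :: "nat \<Rightarrow> 'a set" where
  "mpow r \<equiv> ideal_pow \<mm> r"

definition adic_length :: "'a set \<Rightarrow> nat \<Rightarrow> nat" where
  "adic_length A r = the_enat (ilen (A <+> mpow r) (carrier R))"

lemma mpow_ideal: "ideal (mpow r) R"
  by (rule ideal_pow_ideal[OF m_ideal])

lemma add_mpow_ideal: "ideal A R \<Longrightarrow> ideal (A <+> mpow r) R"
  by (intro add_ideals mpow_ideal)

text \<open>For I = {0} and s = 0 the Hilbert function is the length of R/m^(r+1), so finiteness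
  comes from the monomial count; monotonicity then covers r itself.\<close>

lemma interval_length_mpow_finite: "ilen (mpow r) (carrier R) \<noteq> \<infinity>"
proof -
  have "bigraded_hilbert_fun R \<mm> {\<zero>} r 0 =
      ilen (mpow (Suc r) \<cdot> ideal_pow {\<zero>} 0 <+> ideal_pow {\<zero>} (Suc 0)) (ideal_pow {\<zero>} 0)"
    unfolding bigraded_hilbert_fun_eq[OF zeroideal] by (simp del: nat_pow_Suc)
  also have "mpow (Suc r) \<cdot> ideal_pow {\<zero>} 0 <+> ideal_pow {\<zero>} (Suc 0) = mpow (Suc r)"
    unfolding ideal_pow_1[OF zeroideal] ideal_pow_0 ideal_prod_one[OF mpow_ideal]
    using ideal_zeroD[OF mpow_ideal] by (intro add_ideals_absorb1 mpow_ideal zeroideal) blast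
  finally have "ilen (mpow (Suc r)) (carrier R) = bigraded_hilbert_fun R \<mm> {\<zero>} r 0"
    unfolding ideal_pow_0 by simp
  then have fin: "ilen (mpow (Suc r)) (carrier R) \<noteq> \<infinity>"
    using bigraded_hilbert_fun_finite[OF zeroideal] by simp
  have "ilen (mpow r) (carrier R) \<le> ilen (mpow (Suc r)) (carrier R)"
    by (intro interval_length_mono ideal_pow_antimono m_ideal) auto
  then show ?thesis using fin by (metis enat_ord_simps(5) nat_le_linear)
qed

lemma adic_length_eq:
  assumes "ideal A R"
  shows "ilen (A <+> mpow r) (carrier R) = enat (adic_length A r)"
proof -
  have "ilen (A <+> mpow r) (carrier R) \<le> ilen (mpow r) (carrier R)"
    by (intro interval_length_mono add_ideals_upper2 assms mpow_ideal) auto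
  then have "ilen (A <+> mpow r) (carrier R) \<noteq> \<infinity>"
    using interval_length_mpow_finite[of r] by (metis enat_ord_simps(5))
  then show ?thesis unfolding adic_length_def by auto
qed

lemma adic_length_split:
  assumes "ideal A R" "ideal C R" "A \<subseteq> C"
  shows "enat (adic_length A r) = ilen (A <+> mpow r) (C <+> mpow r) + enat (adic_length C r)"
  using interval_length_add[OF add_mpow_ideal[OF assms(1)] add_mpow_ideal[OF assms(2)] oneideal
      set_add_mono[OF assms(3) subset_refl] ideal_subset[OF add_mpow_ideal[OF assms(2)]]]
  by (simp add: adic_length_eq assms)

lemma adic_length_antimono: "ideal A R \<Longrightarrow> ideal C R \<Longrightarrow> A \<subseteq> C \<Longrightarrow> adic_length C r \<le> adic_length A r"
  using adic_length_split[of A C r] by (metis enat_ord_simps(1) le_iff_add add.commute)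

lemma adic_length_mono: "ideal A R \<Longrightarrow> r \<le> r' \<Longrightarrow> adic_length A r \<le> adic_length A r'"
  using interval_length_mono[OF set_add_mono[OF subset_refl ideal_pow_antimono[OF m_ideal]] subset_refl, of r r' A "carrier R"]
  by (simp add: adic_length_eq)

lemma adic_length_carrier: "adic_length (carrier R) r = 0"
proof -
  have "carrier R <+> mpow r = carrier R"
    by (intro add_ideals_absorb1 oneideal mpow_ideal ideal_subset)
  then show ?thesis using adic_length_eq[OF oneideal, of r] by (simp add: zero_enat_def)
qed

text \<open>Adjoining x lowers the length by that of the cyclic module R/((A + m^r) : x). The
  estimates below compare this colon with some Q + m^r', from inside or from outside.\<close>

lemma adic_length_step:
  assumes "ideal A R" "x \<in> carrier R"
  shows "enat (adic_length A r) =
    ilen (colon (A <+> mpow r) {x}) (carrier R) + enat (adic_length (A <+> PIdl x) r)"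
proof -
  note Px = ideal_PIdl[OF assms(2)]
  have "(A <+> PIdl x) <+> mpow r = A <+> (PIdl x <+> mpow r)" by (intro add_ideals_assoc assms Px mpow_ideal)
  also have "PIdl x <+> mpow r = mpow r <+> PIdl x" by (intro set_add_comm ideal_subset Px mpow_ideal)
  also have "A <+> (mpow r <+> PIdl x) = (A <+> mpow r) <+> PIdl x"
    by (intro add_ideals_assoc[symmetric] assms Px mpow_ideal)
  finally have "ilen (A <+> mpow r) ((A <+> PIdl x) <+> mpow r) =
      ilen (colon (A <+> mpow r) {x}) (carrier R)"
    using interval_length_colon[OF add_mpow_ideal[OF assms(1)] assms(2)] by simp
  then show ?thesis
    using adic_length_split[OF assms(1) add_ideals[OF assms(1) Px] add_ideals_upper1[OF assms(1) Px], of r] by simp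
qed

lemma adic_length_step_le:
  assumes "ideal A R" "x \<in> carrier R" "ideal Q R" "Q <+> mpow r' \<subseteq> colon (A <+> mpow r) {x}"
  shows "adic_length A r \<le> adic_length (A <+> PIdl x) r + adic_length Q r'"
proof -
  have "ilen (colon (A <+> mpow r) {x}) (carrier R) \<le> enat (adic_length Q r')"
    using interval_length_mono[OF assms(4) subset_refl, of "carrier R"] by (simp add: adic_length_eq assms)
  then have "enat (adic_length A r) \<le> enat (adic_length Q r') + enat (adic_length (A <+> PIdl x) r)"
    unfolding adic_length_step[OF assms(1,2)] by (rule add_right_mono)
  then show ?thesis by simp
qed

lemma adic_length_step_ge:
  assumes "ideal A R" "x \<in> carrier R" "ideal Q R" "colon (A <+> mpow r) {x} \<subseteq> Q <+> mpow r'"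
  shows "adic_length (A <+> PIdl x) r + adic_length Q r' \<le> adic_length A r"
proof -
  have "enat (adic_length Q r') \<le> ilen (colon (A <+> mpow r) {x}) (carrier R)"
    using interval_length_mono[OF assms(4) subset_refl, of "carrier R"] by (simp add: adic_length_eq assms)
  then have "enat (adic_length Q r') + enat (adic_length (A <+> PIdl x) r) \<le> enat (adic_length A r)"
    unfolding adic_length_step[OF assms(1,2)] by (rule add_right_mono)
  then show ?thesis by simp
qed

lemma adic_length_step_upper:
  assumes "ideal A R" "x \<in> carrier R"
  shows "adic_length A r \<le> adic_length (A <+> PIdl x) r + adic_length (colon A {x}) r"
proof (rule adic_length_step_le[OF assms ideal_colon_elem_ideal[OF assms]])
  show "colon A {x} <+> mpow r \<subseteq> colon (A <+> mpow r) {x}"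
  proof (intro add_ideals_least ideal_colon_elem_ideal add_mpow_ideal assms)
    show "colon A {x} \<subseteq> colon (A <+> mpow r) {x}"
      using add_ideals_upper1[OF assms(1) mpow_ideal] by (auto simp: ideal_colon_def)
    have "mpow r \<subseteq> colon (mpow r) {x}" by (rule subset_ideal_colon[OF mpow_ideal]) (use assms in auto)
    then show "mpow r \<subseteq> colon (A <+> mpow r) {x}"
      using add_ideals_upper2[OF assms(1) mpow_ideal, of r] by (auto simp: ideal_colon_def)
  qed
qed

text \<open>Since x lies in m, multiplication by x carries m^r into m^(r+1). The smaller argument on
  the right turns the estimate into a recursion in r.\<close>

lemma adic_length_step_m:
  assumes "ideal A R" "x \<in> \<mm>"
  shows "adic_length A (Suc r) \<le> adic_length (A <+> PIdl x) (Suc r) + adic_length A r"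
proof -
  have x: "x \<in> carrier R" using assms ideal.Icarr[OF m_ideal] by auto
  show ?thesis
  proof (rule adic_length_step_le[OF assms(1) x assms(1)])
    show "A <+> mpow r \<subseteq> colon (A <+> mpow (Suc r)) {x}"
    proof (intro add_ideals_least ideal_colon_elem_ideal add_mpow_ideal assms x)
      have "A \<subseteq> colon A {x}" by (rule subset_ideal_colon[OF assms(1)]) (use x in auto)
      then show "A \<subseteq> colon (A <+> mpow (Suc r)) {x}"
        using add_ideals_upper1[OF assms(1) mpow_ideal, of "Suc r"] by (auto simp: ideal_colon_def simp del: nat_pow_Suc)
      have "y \<otimes> x \<in> mpow (Suc r)" if "y \<in> mpow r" for y
        unfolding ideal_pow_Suc using that assms(2) by (rule ideal_prod.prod)
      then show "mpow r \<subseteq> colon (A <+> mpow (Suc r)) {x}"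
        using add_ideals_upper2[OF assms(1) mpow_ideal, of "Suc r"] ideal.Icarr[OF mpow_ideal, of _ r]
        by (auto simp: ideal_colon_def simp del: nat_pow_Suc)
    qed
  qed
qed

text \<open>By Artin-Rees for B = A + (x), the intersection of m^(r+c) with B lies in m^r B, hence
  in A + m^r x. So y x in A + m^(r+c) forces y into (A : x) + m^r, at the price of the shift
  c.\<close>

lemma adic_length_step_lower:
  assumes A: "ideal A R" and x: "x \<in> carrier R"
  shows "\<exists>c. \<forall>r. adic_length (A <+> PIdl x) (r + c) + adic_length (colon A {x}) r \<le> adic_length A (r + c)"
proof -
  note Px = ideal_PIdl[OF x]
  let ?B = "A <+> PIdl x" and ?Q = "colon A {x}"
  have B: "ideal ?B R" by (intro add_ideals A Px)
  have Q: "ideal ?Q R" by (rule ideal_colon_elem_ideal[OF A x])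
  obtain c where c: "\<And>r. mpow (r + c) \<inter> ?B \<subseteq> mpow r \<cdot> ?B" using artin_rees[OF m_ideal B] by blast
  have "colon (A <+> mpow (r + c)) {x} \<subseteq> ?Q <+> mpow r" for r
  proof
    fix y assume "y \<in> colon (A <+> mpow (r + c)) {x}"
    then have y: "y \<in> carrier R" "y \<otimes> x \<in> A <+> mpow (r + c)" by (auto simp: ideal_colon_def)
    let ?T = "A <+> (\<lambda>k. k \<otimes> x) ` mpow r"
    have T: "ideal ?T R" "A \<subseteq> ?T" "(\<lambda>k. k \<otimes> x) ` mpow r \<subseteq> ?T"
      using add_ideals[OF A ideal_image_mult[OF mpow_ideal x]] add_ideals_upper1[OF A ideal_image_mult[OF mpow_ideal x]]
        add_ideals_upper2[OF A ideal_image_mult[OF mpow_ideal x]] by auto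
    have "mpow r \<cdot> ?B \<subseteq> ?T"
    proof (rule ideal_prod_least[OF T(1)])
      fix p q assume p: "p \<in> mpow r" and "q \<in> ?B"
      then obtain a k where ak: "a \<in> A" "k \<in> carrier R" "q = a \<oplus> k \<otimes> x" by (auto elim!: set_add_elemE in_PIdlE)
      have pc: "p \<in> carrier R" "a \<in> carrier R" using p ak(1) ideal.Icarr[OF mpow_ideal] ideal.Icarr[OF A] by auto
      have "p \<otimes> q = p \<otimes> a \<oplus> (k \<otimes> p) \<otimes> x" using ak pc x by (simp add: r_distr m_ac)
      moreover have "p \<otimes> a \<in> A" "k \<otimes> p \<in> mpow r" using ideal_multD[OF A ak(1) pc(1)] ideal_multD[OF mpow_ideal p ak(2)] by auto
      ultimately show "p \<otimes> q \<in> ?T" by (auto intro: set_add_elemI)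
    qed
    then have sub: "mpow (r + c) \<inter> ?B \<subseteq> ?T" using c by blast
    have "y \<otimes> x \<in> ?B" using y(1) add_ideals_upper2[OF A Px] by (auto simp: cgenideal_def)
    then have "y \<otimes> x \<in> A <+> (mpow (r + c) \<inter> ?B)"
      using y(2) add_ideals_modular[OF A mpow_ideal B add_ideals_upper1[OF A Px]] by blast
    also have "\<dots> \<subseteq> ?T" by (rule add_ideals_least[OF T(1,2) sub])
    finally obtain a k where ak: "a \<in> A" "k \<in> mpow r" "y \<otimes> x = a \<oplus> k \<otimes> x" by (auto elim!: set_add_elemE)
    have kc: "k \<in> carrier R" "a \<in> carrier R" using ideal.Icarr[OF mpow_ideal ak(2)] ideal.Icarr[OF A ak(1)] by auto
    have "(y \<ominus> k) \<otimes> x = (a \<oplus> k \<otimes> x) \<oplus> \<ominus> (k \<otimes> x)" using ak(3)[symmetric] kc x y(1) by (simp add: a_minus_def l_distr l_minus)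
    also have "\<dots> = a" using kc x by (simp add: a_assoc r_neg)
    finally have "y \<ominus> k \<in> ?Q" using ak(1) y(1) kc by (simp add: ideal_colon_def)
    then have "(y \<ominus> k) \<oplus> k \<in> ?Q <+> mpow r" using ak(2) by (rule set_add_elemI)
    moreover have "(y \<ominus> k) \<oplus> k = y" using y(1) kc by (simp add: a_minus_def a_assoc l_neg)
    ultimately show "y \<in> ?Q <+> mpow r" by simp
  qed
  then have "adic_length ?B (r + c) + adic_length ?Q r \<le> adic_length A (r + c)" for r
    by (intro adic_length_step_ge A x Q)
  then show ?thesis by blast
qed

section \<open>Prime filtrations\<close>

text \<open>This is an associated prime of C/A, found as a maximal annihilator: (A : bx) contains (A
  : x), so the two coincide if bx is not in A.\<close>

lemma exists_prime_colon:
  assumes "ideal A R" "ideal C R" "A \<subset> C"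
  shows "\<exists>x\<in>C. x \<notin> A \<and> primeideal (colon A {x}) R"
proof -
  define Q where "Q B \<longleftrightarrow> (\<exists>x\<in>C. x \<notin> A \<and> B = colon A {x})" for B
  have Cc: "x \<in> carrier R" if "x \<in> C" for x using that ideal.Icarr[OF assms(2)] by auto
  obtain x0 where "x0 \<in> C" "x0 \<notin> A" using assms by auto
  then have "ideal (colon A {x0}) R" "Q (colon A {x0})"
    using ideal_colon_elem_ideal[OF assms(1) Cc] by (auto simp: Q_def)
  then obtain B where B: "ideal B R" "Q B" "\<And>D. ideal D R \<Longrightarrow> Q D \<Longrightarrow> B \<subseteq> D \<Longrightarrow> D = B"
    using exists_maximal_ideal_in[of "colon A {x0}" Q] by blast
  then obtain x where x: "x \<in> C" "x \<notin> A" "B = colon A {x}" by (auto simp: Q_def)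
  note xc = Cc[OF x(1)]
  have "primeideal B R"
  proof (rule primeidealI[OF B(1) is_cring])
    have "\<one> \<notin> B" using x xc by (simp add: ideal_colon_def)
    then show "carrier R \<noteq> B" by auto
    fix a b assume ab: "a \<in> carrier R" "b \<in> carrier R" "a \<otimes> b \<in> B"
    show "a \<in> B \<or> b \<in> B"
    proof (rule disjCI)
      assume "b \<notin> B"
      then have bx: "b \<otimes> x \<notin> A" using ab x by (simp add: ideal_colon_def)
      let ?D = "colon A {b \<otimes> x}"
      have D: "ideal ?D R" using ab xc by (intro ideal_colon_elem_ideal assms) auto
      have "Q ?D" unfolding Q_def using bx ideal_multD[OF assms(2) x(1) ab(2)] by blast
      moreover have "B \<subseteq> ?D"
      proof
        fix y assume "y \<in> B"
        then have y: "y \<in> carrier R" "y \<otimes> x \<in> A" using x by (auto simp: ideal_colon_def)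
        then have "b \<otimes> (y \<otimes> x) \<in> A" by (intro ideal_multD[OF assms(1) _ ab(2)])
        then show "y \<in> ?D" using y(1) ab xc by (simp add: ideal_colon_def m_lcomm)
      qed
      ultimately have "?D = B" using B(3) D by blast
      moreover have "a \<in> ?D" using ab x xc by (simp add: ideal_colon_def m_assoc)
      ultimately show "a \<in> B" by simp
    qed
  qed
  then show ?thesis using x by blast
qed

text \<open>Packages a prime filtration of C/A as an induction rule that descends from C to A, each
  step having factor R/(A : x) with (A : x) prime.\<close>

lemma prime_filtration_induct [consumes 3, case_names refl step]:
  assumes "ideal A R" "ideal C R" "A \<subseteq> C"
    and "P C"
    and "\<And>A x. ideal A R \<Longrightarrow> A \<subseteq> C \<Longrightarrow> x \<in> C \<Longrightarrow> x \<notin> A \<Longrightarrow> primeideal (colon A {x}) R \<Longrightarrow>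
      ideal (A <+> PIdl x) R \<Longrightarrow> A <+> PIdl x \<subseteq> C \<Longrightarrow> P (A <+> PIdl x) \<Longrightarrow> P A"
  shows "P A"
  using assms(1,3)
proof (induction rule: noetherian_induct)
  case (step A)
  show ?case
  proof (cases "A = C")
    case False
    then obtain x where x: "x \<in> C" "x \<notin> A" "primeideal (colon A {x}) R"
      using exists_prime_colon[OF step(1) assms(2)] step.prems by blast
    have xc: "x \<in> carrier R" using ideal.Icarr[OF assms(2) x(1)] .
    note Px = ideal_PIdl[OF xc]
    have B: "ideal (A <+> PIdl x) R" by (intro add_ideals step Px)
    have "x \<in> A <+> PIdl x" using add_ideals_upper2[OF step(1) Px] cgenideal_self[OF xc] by blast
    then have "A \<subset> A <+> PIdl x" using x add_ideals_upper1[OF step(1) Px] by blast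
    moreover have "A <+> PIdl x \<subseteq> C"
      using step.prems x xc by (intro add_ideals_least assms) (auto simp: PIdl_subset_iff assms)
    ultimately show ?thesis using assms(5)[OF step(1) step.prems x B] step.IH[OF B] by blast
  qed (use assms(4) in simp)
qed

lemma colon_subset_colon_elem: "x \<in> C \<Longrightarrow> colon A C \<subseteq> colon A {x}"
  by (auto simp: ideal_colon_def)

lemma colon_mono_left: "A \<subseteq> A' \<Longrightarrow> colon A C \<subseteq> colon A' C"
  by (auto simp: ideal_colon_def)

text \<open>Every prime met in the filtration contains the annihilator of C/A, so growth bounds for
  such primes suffice; the constants of the factors add up.\<close>

lemma adic_length_upper_bound:
  assumes "ideal A R" "ideal C R" "A \<subseteq> C"
    and "\<And>q. primeideal q R \<Longrightarrow> colon A C \<subseteq> q \<Longrightarrow> \<exists>K. \<forall>r. adic_length q r \<le> K * (r + 1) ^ k"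
  shows "\<exists>K. \<forall>r. adic_length A r \<le> adic_length C r + K * (r + 1) ^ k"
  using assms
proof (induction rule: prime_filtration_induct)
  case refl
  then show ?case by (intro exI[of _ 0]) simp
next
  case (step A x)
  have xc: "x \<in> carrier R" using ideal.Icarr[OF assms(2)] step by blast
  have "colon A C \<subseteq> colon (A <+> PIdl x) C"
    by (intro colon_mono_left add_ideals_upper1 step ideal_PIdl xc)
  then obtain K where K: "\<And>r. adic_length (A <+> PIdl x) r \<le> adic_length C r + K * (r + 1) ^ k"
    using step.IH step.prems by (meson subset_trans)
  obtain L where L: "\<And>r. adic_length (colon A {x}) r \<le> L * (r + 1) ^ k"
    using step.prems[OF step(5) colon_subset_colon_elem[OF step(3)]] by blast
  have "adic_length A r \<le> adic_length C r + (K + L) * (r + 1) ^ k" for r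
    using K[of r] L[of r] adic_length_step_upper[OF step(1) xc, of r] by (simp add: add_mult_distrib)
  then show ?case by blast
qed

definition minimal_prime :: "'a set \<Rightarrow> bool" where
  "minimal_prime p \<longleftrightarrow> primeideal p R \<and> (\<forall>q. primeideal q R \<longrightarrow> q \<subseteq> p \<longrightarrow> q = p)"

lemma prime_ideal: "primeideal p R \<Longrightarrow> ideal p R"
  by (rule primeideal.axioms(1))

lemma primeD: "primeideal p R \<Longrightarrow> a \<in> carrier R \<Longrightarrow> b \<in> carrier R \<Longrightarrow> a \<otimes> b \<in> p \<Longrightarrow> a \<in> p \<or> b \<in> p"
  by (rule primeideal.I_prime)

lemma prime_one: "primeideal p R \<Longrightarrow> \<one> \<notin> p"
  using ideal_proper_iff[OF prime_ideal] primeideal.I_notcarr by metis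

text \<open>The prime p must occur as a factor of the filtration: otherwise elements outside p
  killing the factors would multiply to an annihilator of C/A outside p. One occurrence is retained,
  so a single Artin-Rees shift c appears.\<close>

lemma adic_length_lower_bound:
  assumes "ideal A R" "ideal C R" "A \<subseteq> C" "minimal_prime p" "colon A C \<subseteq> p"
  shows "\<exists>c. \<forall>r. adic_length C (r + c) + adic_length p r \<le> adic_length A (r + c)"
  using assms(1,2,3,5)
proof (induction rule: prime_filtration_induct)
  case refl
  have "\<one> \<in> colon C C" using ideal.Icarr[OF assms(2)] by (auto simp: ideal_colon_def)
  then show ?case using refl prime_one assms(4) by (auto simp: minimal_prime_def)
next
  case (step A x)
  have p: "primeideal p R" using assms(4) by (simp add: minimal_prime_def)
  have xc: "x \<in> carrier R" using ideal.Icarr[OF assms(2)] step by blast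
  let ?B = "A <+> PIdl x" and ?q = "colon A {x}"
  have AB: "A \<subseteq> ?B" by (intro add_ideals_upper1 step ideal_PIdl xc)
  show ?case
  proof (cases "?q \<subseteq> p")
    case True
    then have q: "?q = p" using assms(4) step(5) by (auto simp: minimal_prime_def)
    obtain c where c: "\<And>r. adic_length ?B (r + c) + adic_length ?q r \<le> adic_length A (r + c)"
      using adic_length_step_lower[OF step(1) xc] by blast
    have "adic_length C (r + c) \<le> adic_length ?B (r + c)" for r
      by (intro adic_length_antimono step assms)
    then show ?thesis using c unfolding q by (meson add_right_mono order_trans)
  next
    case False
    then obtain s where s: "s \<in> ?q" "s \<notin> p" by blast
    then have sc: "s \<in> carrier R" "s \<otimes> x \<in> A" by (auto simp: ideal_colon_def)
    have "colon ?B C \<subseteq> p"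
    proof
      fix t assume t: "t \<in> colon ?B C"
      then have tc: "t \<in> carrier R" by (simp add: ideal_colon_def)
      have "s \<otimes> t \<in> colon A C"
        unfolding ideal_colon_def
      proof (intro CollectI conjI ballI)
        fix y assume y: "y \<in> C"
        then have yc: "y \<in> carrier R" using ideal.Icarr[OF assms(2)] by blast
        have "t \<otimes> y \<in> ?B" using t y by (simp add: ideal_colon_def)
        then have "s \<otimes> (t \<otimes> y) \<in> A" by (rule ideal_colon_mult_add_PIdl[OF step(1) xc s(1)])
        then show "(s \<otimes> t) \<otimes> y \<in> A" using sc tc yc by (simp add: m_assoc)
      qed (use sc tc in simp)
      then have "s \<otimes> t \<in> p" using step.prems by blast
      then show "t \<in> p" using primeD[OF p sc(1) tc] s by blast
    qed
    then obtain c where c: "\<And>r. adic_length C (r + c) + adic_length p r \<le> adic_length ?B (r + c)"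
      using step.IH by blast
    have "adic_length ?B (r + c) \<le> adic_length A (r + c)" for r
      by (intro adic_length_antimono step AB)
    then show ?thesis using c by (meson order_trans)
  qed
qed

text \<open>Expresses that R/A localized at p has finite length: n counts the factors R/p in a prime
  filtration of R/A, and t is a product of elements outside p that kill the other factors.\<close>

lemma minimal_prime_pow_annihilated:
  assumes "minimal_prime p" "ideal A R"
  shows "\<exists>n. \<exists>t\<in>carrier R. t \<notin> p \<and> (\<forall>y\<in>ideal_pow p n. t \<otimes> y \<in> A)"
proof -
  have p: "primeideal p R" using assms(1) by (simp add: minimal_prime_def)
  note pc = ideal.Icarr[OF ideal_pow_ideal[OF prime_ideal[OF p]]]
  from assms(2) oneideal ideal_subset[OF assms(2)] show ?thesis
  proof (induction rule: prime_filtration_induct)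
    case refl
    then show ?case using pc prime_one[OF p] by (intro exI[of _ 0] bexI[of _ \<one>]) auto
  next
    case (step A x)
    let ?q = "colon A {x}"
    from step.IH obtain n t where t: "t \<in> carrier R" "t \<notin> p" "\<And>y. y \<in> ideal_pow p n \<Longrightarrow> t \<otimes> y \<in> A <+> PIdl x"
      by blast
    show ?case
    proof (cases "?q \<subseteq> p")
      case True
      then have q: "?q = p" using assms(1) step(5) by (auto simp: minimal_prime_def)
      have "ideal_pow p (Suc n) \<subseteq> colon A {t}"
        unfolding ideal_pow_Suc
      proof (rule ideal_prod_least)
        show "ideal (colon A {t}) R" by (intro ideal_colon_elem_ideal step t)
        fix y b assume y: "y \<in> ideal_pow p n" and b: "b \<in> p"
        then have c: "y \<in> carrier R" "b \<in> carrier R" using pc ideal.Icarr[OF prime_ideal[OF p]] by auto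
        have "(y \<otimes> b) \<otimes> t = b \<otimes> (t \<otimes> y)" using c t by (simp add: m_ac)
        also have "\<dots> \<in> A" using b q by (intro ideal_colon_mult_add_PIdl[OF step(1,3) _ t(3)[OF y]]) simp
        finally show "y \<otimes> b \<in> colon A {t}" using c by (simp add: ideal_colon_def)
      qed
      then have "t \<otimes> y \<in> A" if "y \<in> ideal_pow p (Suc n)" for y
        using that m_comm[OF t(1) pc[OF that]] by (auto simp: ideal_colon_def)
      then show ?thesis using t by blast
    next
      case False
      then obtain s where s: "s \<in> ?q" "s \<notin> p" by blast
      then have sc: "s \<in> carrier R" "s \<otimes> x \<in> A" by (auto simp: ideal_colon_def)
      have "(s \<otimes> t) \<otimes> y \<in> A" if y: "y \<in> ideal_pow p n" for y
        using ideal_colon_mult_add_PIdl[OF step(1,3) s(1) t(3)[OF y]] sc t pc[OF y] by (simp add: m_assoc)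
      moreover have "s \<otimes> t \<notin> p" using primeD[OF p sc(1) t(1)] s t by blast
      ultimately show ?thesis using sc t by blast
    qed
  qed
qed

text \<open>A prime containing A but not x contains (A : x), so a minimal one equals it. Thus the
  primes of a filtration of R include all minimal primes.\<close>

lemma finite_minimal_primes: "finite {p. minimal_prime p}"
proof -
  have "\<exists>S. finite S \<and> (\<forall>p. minimal_prime p \<longrightarrow> A \<subseteq> p \<longrightarrow> p \<in> S)" if "ideal A R" for A
    using that oneideal ideal_subset[OF that]
  proof (induction rule: prime_filtration_induct)
    case refl
    have "\<not> carrier R \<subseteq> p" if "minimal_prime p" for p
      using that prime_one by (auto simp: minimal_prime_def)
    then show ?case by (intro exI[of _ "{}"]) auto
  next
    case (step A x)
    then obtain S where S: "finite S" "\<And>p. minimal_prime p \<Longrightarrow> A <+> PIdl x \<subseteq> p \<Longrightarrow> p \<in> S" by blast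
    have "p \<in> insert (colon A {x}) S" if p: "minimal_prime p" "A \<subseteq> p" for p
    proof (cases "x \<in> p")
      case True
      have "ideal p R" using p prime_ideal by (simp add: minimal_prime_def)
      then have "A <+> PIdl x \<subseteq> p" using True p step(3) by (intro add_ideals_least) (auto simp: PIdl_subset_iff)
      then show ?thesis using S p by blast
    next
      case False
      have "colon A {x} \<subseteq> p"
      proof
        fix y assume "y \<in> colon A {x}"
        then have "y \<in> carrier R" "y \<otimes> x \<in> p" using p by (auto simp: ideal_colon_def)
        then show "y \<in> p" using False primeD[of p y x] step(3) p by (auto simp: minimal_prime_def)
      qed
      then show ?thesis using p step(5) by (auto simp: minimal_prime_def)
    qed
    then show ?case using S by (intro exI[of _ "insert (colon A {x}) S"]) auto
  qed
  from this[OF zeroideal] obtain S where S: "finite S" "\<And>p. minimal_prime p \<Longrightarrow> {\<zero>} \<subseteq> p \<Longrightarrow> p \<in> S" by blast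
  have "{p. minimal_prime p} \<subseteq> S"
    using S(2) ideal_zeroD prime_ideal by (auto simp: minimal_prime_def)
  then show ?thesis using S(1) by (rule finite_subset)
qed

end

section \<open>Growth of lengths and dimension\<close>

text \<open>For an ideal q this is dim R/q, read off inside Spec R.\<close>

definition coheight :: "('a, 'b) ring_scheme \<Rightarrow> 'a set \<Rightarrow> enat" where
  "coheight R q = chain_length {p. primeideal p R \<and> q \<subseteq> p}"

lemma (in cring) krull_dim_quotient:
  assumes I: "ideal I R"
  shows "krull_dim (R Quot I) = coheight R I"
proof -
  have bij: "\<Union> ((+>) I ` J) = J" "ideal ((+>) I ` J) (R Quot I)" if "ideal J R" "I \<subseteq> J" for J
    using that I ideal_incl_iff ring_ideal_imp_quot_ideal by blast+
  have bij': "ideal (\<Union>J) R" "I \<subseteq> \<Union>J" "(+>) I ` (\<Union>J) = J" if J: "ideal J (R Quot I)" for J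
  proof -
    obtain K where K: "ideal K R" "I \<subseteq> K" "J = (+>) I ` K"
      using quot_ideal_correspondence[OF I] J unfolding bij_betw_def by blast
    then have "\<Union>J = K" using bij by simp
    then show "ideal (\<Union>J) R" "I \<subseteq> \<Union>J" "(+>) I ` (\<Union>J) = J" using K by simp_all
  qed
  have carr: "carrier (R Quot I) = (+>) I ` carrier R"
    by (auto simp: FactRing_def A_RCOSETS_def RCOSETS_def a_r_coset_def)
  have mem: "I +> a \<in> (+>) I ` J \<longleftrightarrow> a \<in> J" if "ideal J R" "I \<subseteq> J" "a \<in> carrier R" for J a
  proof -
    have "(+>) I ` J \<subseteq> carrier (R Quot I)" unfolding carr using ideal_subset[OF that(1)] by blast
    from canonical_proj_vimage_mem_iff[OF I this that(3)] show ?thesis using bij(1)[OF that(1,2)] by simp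
  qed
  have mult: "(I +> a) \<otimes>\<^bsub>R Quot I\<^esub> (I +> b) = I +> (a \<otimes> b)" if "a \<in> carrier R" "b \<in> carrier R" for a b
    using ideal.rcoset_mult_add[OF I that] by (simp add: FactRing_def)
  have Qcring: "cring (R Quot I)" by (rule ideal.quotient_is_cring[OF I is_cring])
  have prime_iff: "primeideal ((+>) I ` J) (R Quot I) \<longleftrightarrow> primeideal J R" if J: "ideal J R" "I \<subseteq> J" for J
  proof
    assume p: "primeideal ((+>) I ` J) (R Quot I)"
    show "primeideal J R"
    proof (rule primeidealI[OF J(1) is_cring])
      show "carrier R \<noteq> J" using primeideal.I_notcarr[OF p] carr by auto
      fix a b assume ab: "a \<in> carrier R" "b \<in> carrier R" "a \<otimes> b \<in> J"
      then have "(I +> a) \<otimes>\<^bsub>R Quot I\<^esub> (I +> b) \<in> (+>) I ` J" by (simp add: mult)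
      then have "I +> a \<in> (+>) I ` J \<or> I +> b \<in> (+>) I ` J"
        using ab carr by (intro primeideal.I_prime[OF p]) auto
      then show "a \<in> J \<or> b \<in> J" using mem[OF J] ab by simp
    qed
  next
    assume p: "primeideal J R"
    show "primeideal ((+>) I ` J) (R Quot I)"
    proof (rule primeidealI[OF bij(2)[OF J] Qcring])
      show "carrier (R Quot I) \<noteq> (+>) I ` J"
      proof
        assume "carrier (R Quot I) = (+>) I ` J"
        then have "I +> \<one> \<in> (+>) I ` J" unfolding carr by blast
        then have "carrier R = J" using mem[OF J] ideal_proper_iff[OF J(1)] by simp
        then show False using primeideal.I_notcarr[OF p] by simp
      qed
      fix a b assume "a \<in> carrier (R Quot I)" "b \<in> carrier (R Quot I)" "a \<otimes>\<^bsub>R Quot I\<^esub> b \<in> (+>) I ` J"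
      then obtain x y where xy: "x \<in> carrier R" "y \<in> carrier R" "a = I +> x" "b = I +> y" "I +> (x \<otimes> y) \<in> (+>) I ` J"
        unfolding carr by (auto simp: mult)
      then have "x \<in> J \<or> y \<in> J" using mem[OF J] primeideal.I_prime[OF p] by simp
      then show "a \<in> (+>) I ` J \<or> b \<in> (+>) I ` J" using xy by auto
    qed
  qed
  show ?thesis unfolding krull_dim_def coheight_def
  proof (rule chain_length_eq_inverse[where f="\<lambda>J. \<Union>J" and g="\<lambda>J. (+>) I ` J"])
    fix X assume "X \<in> {p. primeideal p (R Quot I)}"
    then have X: "primeideal X (R Quot I)" "ideal X (R Quot I)" by (auto intro: primeideal.axioms(1))
    show "(+>) I ` (\<Union>X) = X" using bij'(3)[OF X(2)] .
    show "\<Union>X \<in> {p. primeideal p R \<and> I \<subseteq> p}"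
      using prime_iff[OF bij'(1,2)[OF X(2)]] bij'[OF X(2)] X(1) by simp
  next
    fix Y assume "Y \<in> {p. primeideal p R \<and> I \<subseteq> p}"
    then have Y: "primeideal Y R" "ideal Y R" "I \<subseteq> Y" by (auto intro: primeideal.axioms(1))
    show "(+>) I ` Y \<in> {p. primeideal p (R Quot I)}" using prime_iff[OF Y(2,3)] Y(1) by simp
    show "\<Union> ((+>) I ` Y) = Y" using bij(1)[OF Y(2,3)] .
  qed auto
qed

context noetherian_local_ring
begin

lemma proper_ideal_subset_m:
  assumes "ideal J R" "J \<noteq> carrier R"
  shows "J \<subseteq> \<mm>"
proof -
  obtain B where B: "ideal B R" "B \<noteq> carrier R" "J \<subseteq> B" "\<And>C. ideal C R \<Longrightarrow> C \<noteq> carrier R \<Longrightarrow> B \<subseteq> C \<Longrightarrow> C = B"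
    using exists_maximal_ideal_in[OF assms(1), of "\<lambda>B. B \<noteq> carrier R"] assms(2) by blast
  have "maximalideal B R"
    by (rule maximalidealI) (use B(1,2) B(4) in blast)+
  then show ?thesis using maximal_unique B(3) by blast
qed

lemma m_prime: "primeideal \<mm> R"
  by (rule maximalideal_prime[OF maximal])

lemma prime_subset_m: "primeideal p R \<Longrightarrow> p \<subseteq> \<mm>"
  using proper_ideal_subset_m[OF prime_ideal] primeideal.I_notcarr by metis

lemma coheight_less:
  assumes "primeideal q R" "primeideal p R" "q \<subset> p" "coheight R q \<le> enat (Suc k)"
  shows "coheight R p \<le> enat k"
  unfolding coheight_def
proof (rule chain_length_leI)
  fix n assume n: "has_chain {p'. primeideal p' R \<and> p \<subseteq> p'} n"
  let ?F = "{p'. primeideal p' R \<and> q \<subseteq> p'}"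
  have "has_chain {K \<in> ?F. K \<subseteq> p} 1"
    unfolding has_chain_def
    by (rule exI[of _ "\<lambda>i. if i = 0 then q else p"]) (use assms in auto)
  moreover have "has_chain {K \<in> ?F. p \<subseteq> K} n" by (rule has_chain_subset[OF n]) (use assms in auto)
  ultimately have "has_chain ?F (1 + n)" by (rule has_chain_append)
  then have "enat (1 + n) \<le> coheight R q" unfolding coheight_def by (rule has_chain_imp_le)
  then have "enat (1 + n) \<le> enat (Suc k)" using assms(4) by (rule order_trans)
  then show "enat n \<le> enat k" by simp
qed

lemma prime_colon_elem:
  assumes "primeideal q R" "x \<in> carrier R" "x \<notin> q"
  shows "colon q {x} = q"
proof
  show "colon q {x} \<subseteq> q" using primeD[OF assms(1)] assms by (auto simp: ideal_colon_def)
  show "q \<subseteq> colon q {x}" by (rule subset_ideal_colon[OF prime_ideal[OF assms(1)]]) (use assms in auto)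
qed

lemma adic_length_le_of_primes_above:
  assumes "ideal A R" "\<And>q. primeideal q R \<Longrightarrow> A \<subseteq> q \<Longrightarrow> \<exists>K. \<forall>r. adic_length q r \<le> K * (r + 1) ^ k"
  shows "\<exists>K. \<forall>r. adic_length A r \<le> K * (r + 1) ^ k"
proof -
  have "A \<subseteq> colon A (carrier R)" by (rule subset_ideal_colon[OF assms(1) subset_refl])
  then show ?thesis
    using adic_length_upper_bound[OF assms(1) oneideal ideal_subset[OF assms(1)], of k] assms(2)
    by (simp add: adic_length_carrier)
qed

text \<open>Cut R/q by some x in m outside q: primes over q + (x) have smaller coheight, so the
  increment of the length from r to r + 1 is O(r^(k-1)), and summation gives O(r^k).\<close>

lemma adic_length_le_coheight:
  assumes "primeideal q R" "coheight R q \<le> enat k"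
  shows "\<exists>K. \<forall>r. adic_length q r \<le> K * (r + 1) ^ k"
  using prime_ideal[OF assms(1)] assms
proof (induction q arbitrary: k rule: noetherian_induct)
  case (step q)
  note qi = step.hyps and q = step.prems(1)
  show ?case
  proof (cases "q = \<mm>")
    case True
    have "enat (adic_length \<mm> r) \<le> enat 1" for r
      using interval_length_mono[OF add_ideals_upper1[OF m_ideal mpow_ideal, of r] subset_refl, of "carrier R"]
      by (simp add: adic_length_eq[OF m_ideal] interval_length_m one_enat_def)
    then have "adic_length q r \<le> 1 * (r + 1) ^ k" for r unfolding True
      by (metis enat_ord_simps(1) le_add2 mult_1 one_le_power order_trans)
    then show ?thesis by blast
  next
    case False
    then obtain x where x: "x \<in> \<mm>" "x \<notin> q" using prime_subset_m[OF q] by blast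
    have xc: "x \<in> carrier R" using ideal.Icarr[OF m_ideal x(1)] .
    note Px = ideal_PIdl[OF xc]
    have qm: "q \<subset> \<mm>" using False prime_subset_m[OF q] by blast
    \<comment> \<open>As q is properly contained in m, its coheight is positive, so k has a
      predecessor.\<close>
    obtain k' where k: "k = Suc k'"
    proof (cases k)
      case 0
      have "has_chain {p. primeideal p R \<and> q \<subseteq> p} 1"
        unfolding has_chain_def
        by (rule exI[of _ "\<lambda>i. if i = 0 then q else \<mm>"]) (use q m_prime qm in auto)
      then have "enat 1 \<le> coheight R q" unfolding coheight_def by (rule has_chain_imp_le)
      then have "enat 1 \<le> enat 0" using step.prems(2) unfolding 0 by (rule order_trans)
      then show ?thesis by simp
    qed (use that in blast)
    let ?B = "q <+> PIdl x"
    have B: "ideal ?B R" by (intro add_ideals qi Px)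
    have "\<exists>K. \<forall>r. adic_length p r \<le> K * (r + 1) ^ k'" if p: "primeideal p R" "?B \<subseteq> p" for p
    proof -
      have "q \<subset> p" using p(2) x(2) add_ideals_upper1[OF qi Px] add_ideals_upper2[OF qi Px] cgenideal_self[OF xc] by blast
      then show ?thesis
        using step.IH[OF prime_ideal[OF p(1)]] p(1) coheight_less[OF q p(1)] step.prems(2) k by blast
    qed
    then obtain K where K: "\<And>r. adic_length ?B r \<le> K * (r + 1) ^ k'"
      using adic_length_le_of_primes_above[OF B] by blast
    \<comment> \<open>L covers both the constant K of the increments and the value at r = 0.\<close>
    define L where "L = K + adic_length q 0"
    have "adic_length q r \<le> L * (r + 1) ^ Suc k'" for r
    proof (induction r)
      case 0
      then show ?case by (simp add: L_def)
    next
      case (Suc r)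
      have "adic_length q (Suc r) \<le> adic_length ?B (Suc r) + adic_length q r"
        by (rule adic_length_step_m[OF qi x(1)])
      also have "\<dots> \<le> K * (Suc r + 1) ^ k' + L * (r + 1) ^ Suc k'"
        using K[of "Suc r"] Suc.IH by (intro add_mono) auto
      also have "\<dots> \<le> L * (Suc r + 1) ^ k' + L * ((r + 1) * (Suc r + 1) ^ k')"
      proof (intro add_mono)
        show "K * (Suc r + 1) ^ k' \<le> L * (Suc r + 1) ^ k'" by (simp add: L_def)
        have "(r + 1) ^ k' \<le> (Suc r + 1) ^ k'" by (rule power_mono) auto
        then show "L * (r + 1) ^ Suc k' \<le> L * ((r + 1) * (Suc r + 1) ^ k')"
          unfolding power_Suc by (intro mult_le_mono le_refl)
      qed
      also have "\<dots> = L * (Suc r + 1) ^ Suc k'" by (simp add: algebra_simps)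
      finally show ?case .
    qed
    then show ?thesis unfolding k by blast
  qed
qed

text \<open>Let q1 be the next prime of the chain and x in q1 outside q. As (q : x) = q, every
  advance of the argument by c adds at least the length for q1 at the starting point. Starting at K
  r and advancing r times gives r times r^e; the new factor K + c absorbs the shifts.\<close>

lemma adic_length_ge_chain:
  assumes "primeideal q R" "has_chain {p. primeideal p R \<and> q \<subseteq> p} e"
  shows "\<exists>K>0. \<forall>r\<ge>1. r ^ e \<le> adic_length q (K * r)"
  using assms
proof (induction e arbitrary: q)
  case 0
  have "1 \<le> adic_length q r" if "r \<ge> 1" for r
  proof -
    have "mpow r \<subseteq> \<mm>" using ideal_pow_antimono[OF m_ideal that] ideal_pow_1[OF m_ideal] by simp
    then have "q <+> mpow r \<subseteq> \<mm>" by (rule add_ideals_least[OF m_ideal prime_subset_m[OF 0(1)]])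
    then have "ilen \<mm> (carrier R) \<le> ilen (q <+> mpow r) (carrier R)"
      by (rule interval_length_mono) simp
    then show ?thesis
      by (simp add: interval_length_m adic_length_eq[OF prime_ideal[OF 0(1)]] one_enat_def)
  qed
  then show ?case by (intro exI[of _ 1]) simp
next
  case (Suc e)
  from Suc.prems(2) obtain C where C: "\<And>i. i \<le> Suc e \<Longrightarrow> primeideal (C i) R \<and> q \<subseteq> C i" "\<And>i. i < Suc e \<Longrightarrow> C i \<subset> C (Suc i)"
    unfolding has_chain_def by blast
  define q1 where "q1 = C 1"
  have q1: "primeideal q1 R" "q \<subset> q1" using C(1)[of 1] C(1)[of 0] C(2)[of 0] by (auto simp: q1_def)
  have sub: "q1 \<subseteq> C (Suc i)" if "i \<le> e" for i
    using that
  proof (induction i)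
    case (Suc i)
    then have "q1 \<subseteq> C (Suc i)" "C (Suc i) \<subset> C (Suc (Suc i))" using C(2)[of "Suc i"] by auto
    then show ?case by blast
  qed (simp add: q1_def)
  have "has_chain {p. primeideal p R \<and> q1 \<subseteq> p} e"
    unfolding has_chain_def by (rule exI[of _ "\<lambda>i. C (Suc i)"]) (use C sub in auto)
  then obtain K where K: "K > 0" "\<And>r. r \<ge> 1 \<Longrightarrow> r ^ e \<le> adic_length q1 (K * r)"
    using Suc.IH[OF q1(1)] by blast
  obtain x where x: "x \<in> q1" "x \<notin> q" using q1(2) by blast
  note qi = prime_ideal[OF Suc.prems(1)] and q1i = prime_ideal[OF q1(1)]
  have xc: "x \<in> carrier R" using ideal.Icarr[OF q1i x(1)] .
  note Px = ideal_PIdl[OF xc]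
  have B: "ideal (q <+> PIdl x) R" "q <+> PIdl x \<subseteq> q1"
    using add_ideals[OF qi Px] add_ideals_least[OF q1i, of q "PIdl x"] q1(2) PIdl_subset_iff[OF xc q1i] x(1) by auto
  obtain c where c: "\<And>r. adic_length (q <+> PIdl x) (r + c) + adic_length q r \<le> adic_length q (r + c)"
    using adic_length_step_lower[OF qi xc] prime_colon_elem[OF Suc.prems(1) xc x(2)] by auto
  have step: "adic_length q1 r + adic_length q r \<le> adic_length q (r + c)" for r
  proof -
    have "adic_length q1 r \<le> adic_length q1 (r + c)" by (rule adic_length_mono[OF q1i]) simp
    also have "\<dots> \<le> adic_length (q <+> PIdl x) (r + c)" by (rule adic_length_antimono[OF B(1) q1i B(2)])
    finally show ?thesis using c[of r] by linarith
  qed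
  have iter: "j * adic_length q1 n \<le> adic_length q (n + j * c)" for j n
  proof (induction j)
    case (Suc j)
    have "adic_length q1 n \<le> adic_length q1 (n + j * c)" by (rule adic_length_mono[OF q1i]) simp
    then show ?case using Suc.IH step[of "n + j * c"] by (simp add: add.commute add.left_commute)
  qed simp
  have "r ^ Suc e \<le> adic_length q ((K + c) * r)" if "r \<ge> 1" for r
  proof -
    have "r ^ Suc e \<le> r * adic_length q1 (K * r)" using K(2)[OF that] by simp
    also have "\<dots> \<le> adic_length q (K * r + r * c)" by (rule iter)
    finally show ?thesis by (simp add: algebra_simps)
  qed
  then show ?case using K(1) by (intro exI[of _ "K + c"]) simp
qed

end

locale noetherian_local_ring_dim = noetherian_local_ring R \<mm> for R (structure) and \<mm> +
  fixes d :: nat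
  assumes dim: "krull_dim R = enat d" and dim_pos: "d \<ge> 1"
begin

lemma coheight_le_dim: "coheight R q \<le> enat d"
  unfolding dim[symmetric] krull_dim_def coheight_def by (rule chain_length_subset) auto

lemma Assh_iff: "p \<in> Assh R \<longleftrightarrow> primeideal p R \<and> coheight R p = enat d"
  unfolding Assh_def using krull_dim_quotient[OF prime_ideal] dim by auto

lemma Assh_prime: "p \<in> Assh R \<Longrightarrow> primeideal p R"
  by (simp add: Assh_iff)

lemma Assh_minimal: "p \<in> Assh R \<Longrightarrow> minimal_prime p"
  unfolding minimal_prime_def
proof (intro conjI allI impI)
  assume p: "p \<in> Assh R"
  then show "primeideal p R" by (rule Assh_prime)
  fix q assume q: "primeideal q R" "q \<subseteq> p"
  show "q = p"
  proof (rule ccontr)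
    assume "q \<noteq> p"
    then have "q \<subset> p" using q(2) by blast
    moreover have "coheight R q \<le> enat (Suc (d - 1))" using coheight_le_dim[of q] dim_pos by simp
    ultimately have "coheight R p \<le> enat (d - 1)" by (rule coheight_less[OF q(1) Assh_prime[OF p]])
    then show False using p dim_pos by (simp add: Assh_iff)
  qed
qed

lemma finite_Assh: "finite (Assh R)"
  by (rule finite_subset[OF _ finite_minimal_primes]) (use Assh_minimal in auto)

lemma adic_length_le_dim:
  assumes "ideal A R" shows "\<exists>K. \<forall>r. adic_length A r \<le> K * (r + 1) ^ d"
  by (rule adic_length_le_of_primes_above[OF assms]) (rule adic_length_le_coheight[OF _ coheight_le_dim])

lemma adic_length_diff_le:
  assumes "ideal A R" "ideal C R" "A \<subseteq> C" "\<And>p. p \<in> Assh R \<Longrightarrow> \<not> colon A C \<subseteq> p"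
  shows "\<exists>K. \<forall>r. adic_length A r \<le> adic_length C r + K * (r + 1) ^ (d - 1)"
proof (rule adic_length_upper_bound[OF assms(1-3)])
  fix q assume q: "primeideal q R" "colon A C \<subseteq> q"
  then have "q \<notin> Assh R" using assms(4) by blast
  then have "coheight R q \<noteq> enat d" using q by (simp add: Assh_iff)
  then have "coheight R q < enat d" using coheight_le_dim by (simp add: less_le)
  then have "coheight R q \<le> enat (d - 1)" using dim_pos by (cases "coheight R q") auto
  then show "\<exists>K. \<forall>r. adic_length q r \<le> K * (r + 1) ^ (d - 1)" by (rule adic_length_le_coheight[OF q(1)])
qed

lemma adic_length_diff_ge:
  assumes "ideal A R" "ideal C R" "A \<subseteq> C" "p \<in> Assh R" "colon A C \<subseteq> p"
  shows "\<exists>c. \<exists>K>0. \<forall>r\<ge>1. adic_length C (K * r + c) + r ^ d \<le> adic_length A (K * r + c)"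
proof -
  obtain c where c: "\<And>r. adic_length C (r + c) + adic_length p r \<le> adic_length A (r + c)"
    using adic_length_lower_bound[OF assms(1-3) Assh_minimal[OF assms(4)] assms(5)] by blast
  have "has_chain {q. primeideal q R \<and> p \<subseteq> q} d"
    using assms(4) by (intro le_chain_length_imp) (auto simp: Assh_iff coheight_def[symmetric])
  then obtain K where K: "K > 0" "\<And>r. r \<ge> 1 \<Longrightarrow> r ^ d \<le> adic_length p (K * r)"
    using adic_length_ge_chain[OF Assh_prime[OF assms(4)]] by blast
  have "adic_length C (K * r + c) + r ^ d \<le> adic_length A (K * r + c)" if "r \<ge> 1" for r
    using c[of "K * r"] K(2)[OF that] by linarith
  then show ?thesis using K(1) by blast
qed

end

section \<open>The first multiplicity\<close>

lemma tendsto_over_power_shift: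
  fixes f :: "nat \<Rightarrow> real"
  assumes "(\<lambda>r. f r / real r ^ d) \<longlonglongrightarrow> L"
  shows "(\<lambda>r. f (r - a) / real r ^ d) \<longlonglongrightarrow> L"
proof (rule LIMSEQ_offset[where k=a])
  have "(\<lambda>r. real r / (real r + real a)) \<longlonglongrightarrow> 1" by real_asymp
  then have "(\<lambda>r. (real r / (real r + real a)) ^ d) \<longlonglongrightarrow> 1 ^ d" by (rule tendsto_power)
  then have "(\<lambda>r. f r / real r ^ d * (real r / (real r + real a)) ^ d) \<longlonglongrightarrow> L * 1 ^ d"
    using assms by (intro tendsto_mult)
  moreover have "\<forall>\<^sub>F r in sequentially. f r / real r ^ d * (real r / (real r + real a)) ^ d
      = f (r + a - a) / real (r + a) ^ d"
    by (rule eventually_sequentiallyI[of 1]) (simp add: power_divide)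
  ultimately show "(\<lambda>r. f (r + a - a) / real (r + a) ^ d) \<longlonglongrightarrow> L"
    using Lim_transform_eventually by fastforce
qed

context noetherian_local_ring
begin

text \<open>The modular law and the second isomorphism theorem turn a factor of the I-adic
  filtration modulo m^n into a summand of the Hilbert function, with the intersection of m^n and I^v
  in place of their product.\<close>

lemma interval_length_induced:
  assumes "ideal I R"
  shows "ilen (ideal_pow I (Suc v) <+> mpow n) (ideal_pow I v <+> mpow n) =
    ilen ((mpow n \<inter> ideal_pow I v) <+> ideal_pow I (Suc v)) (ideal_pow I v)"
proof -
  note ids = ideal_pow_ideal[OF assms] mpow_ideal
  have sub: "ideal_pow I (Suc v) \<subseteq> ideal_pow I v" by (rule ideal_pow_antimono[OF assms]) simp
  have "(ideal_pow I (Suc v) <+> mpow n) <+> ideal_pow I v = ideal_pow I v <+> (ideal_pow I (Suc v) <+> mpow n)"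
    by (intro set_add_comm ideal_subset add_ideals ids)
  also have "\<dots> = (ideal_pow I v <+> ideal_pow I (Suc v)) <+> mpow n"
    by (intro add_ideals_assoc[symmetric] ids)
  also have "ideal_pow I v <+> ideal_pow I (Suc v) = ideal_pow I v"
    by (intro add_ideals_absorb1 ids sub)
  finally show ?thesis
    using interval_length_diamond[OF add_ideals[OF ids(1)[of "Suc v"] ids(2)[of n]] ids(1)[of v]]
      add_ideals_modular[OF ids(1)[of "Suc v"] ids(2)[of n] ids(1)[of v] sub]
      set_add_comm[OF ideal_subset[OF ids(1)] ideal_subset[OF i_intersect[OF ids(2,1)]], of "Suc v" n v]
    by simp
qed

lemma sum_interval_length_induced:
  assumes "ideal I R"
  shows "(\<Sum>v=0..s. ilen (ideal_pow I (Suc v) <+> mpow n) (ideal_pow I v <+> mpow n)) =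
    enat (adic_length (ideal_pow I (Suc s)) n)"
proof -
  note ids = ideal_pow_ideal[OF assms]
  have step: "enat (adic_length (ideal_pow I (Suc v)) n) =
      ilen (ideal_pow I (Suc v) <+> mpow n) (ideal_pow I v <+> mpow n) + enat (adic_length (ideal_pow I v) n)" for v
    by (intro adic_length_split ids ideal_pow_antimono assms) simp
  have "adic_length (ideal_pow I 0) n = 0" unfolding ideal_pow_0 by (rule adic_length_carrier)
  then show ?thesis
  proof (induction s)
    case 0
    then show ?case using step[of 0] by (simp add: zero_enat_def[symmetric] del: nat_pow_Suc)
  next
    case (Suc s)
    then show ?case using step[of "Suc s"] by (simp add: add.commute del: nat_pow_Suc)
  qed
qed

text \<open>Term by term, the product m^(r+1) I^v lies in the intersection; the reverse comparison
  is the one that uses Artin-Rees.\<close>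

lemma bigraded_hilbert_fun_ge:
  assumes "ideal I R"
  shows "enat (adic_length (ideal_pow I (Suc s)) (Suc r)) \<le> bigraded_hilbert_fun R \<mm> I r s"
  unfolding sum_interval_length_induced[OF assms, symmetric] bigraded_hilbert_fun_eq[OF assms]
    interval_length_induced[OF assms]
  by (intro sum_mono interval_length_mono set_add_mono subset_refl ideal_prod_inter mpow_ideal
      ideal_pow_ideal[OF assms])

lemma bigraded_hilbert_fun_le:
  assumes "ideal I R"
  shows "\<exists>c. \<forall>r. bigraded_hilbert_fun R \<mm> I r s \<le> enat (adic_length (ideal_pow I (Suc s)) (Suc r + c))"
proof -
  obtain c where c: "\<And>v r. mpow (r + c v) \<inter> ideal_pow I v \<subseteq> mpow r \<cdot> ideal_pow I v"
    using artin_rees[OF m_ideal ideal_pow_ideal[OF assms]] by metis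
  \<comment> \<open>One shift must serve all of I^0, ..., I^s. It depends on s, which is harmless
    while s stays fixed.\<close>
  define C where "C = (\<Sum>v=0..s. c v)"
  have "bigraded_hilbert_fun R \<mm> I r s \<le> enat (adic_length (ideal_pow I (Suc s)) (Suc r + C))" for r
    unfolding sum_interval_length_induced[OF assms, symmetric] bigraded_hilbert_fun_eq[OF assms]
      interval_length_induced[OF assms]
  proof (intro sum_mono interval_length_mono set_add_mono subset_refl)
    fix v assume v: "v \<in> {0..s}"
    have "c v \<le> C" unfolding C_def by (rule member_le_sum) (use v in auto)
    then have "mpow (Suc r + C) \<subseteq> mpow (Suc r + c v)" by (intro ideal_pow_antimono m_ideal) simp
    then show "mpow (Suc r + C) \<inter> ideal_pow I v \<subseteq> mpow (Suc r) \<cdot> ideal_pow I v" using c[of "Suc r" v] by blast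
  qed
  then show ?thesis by blast
qed

end

section \<open>From the limit in r to the top coefficient\<close>

context noetherian_local_ring_dim
begin

lemma real_adic_length_le_dim:
  assumes "ideal A R"
  shows "\<exists>K. \<forall>r. real (adic_length A (r + a)) \<le> K * (real r + 1) ^ d"
proof -
  obtain K where K: "\<And>r. adic_length A r \<le> K * (r + 1) ^ d" using adic_length_le_dim[OF assms] by blast
  have "real (adic_length A (r + a)) \<le> (real K * (real a + 1) ^ d) * (real r + 1) ^ d" for r
  proof -
    have "real (adic_length A (r + a)) \<le> real (K * (r + a + 1) ^ d)" using K[of "r + a"] by linarith
    also have "\<dots> = real K * (real r + real a + 1) ^ d" by (simp add: add.commute add.left_commute)
    also have "\<dots> \<le> real K * ((real a + 1) * (real r + 1)) ^ d"
      by (intro mult_left_mono power_mono) (auto simp: algebra_simps)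
    finally show ?thesis by (simp add: power_mult_distrib mult.assoc)
  qed
  then show ?thesis by blast
qed

abbreviation scaled_length :: "'a set \<Rightarrow> nat \<Rightarrow> real" where
  "scaled_length A r \<equiv> real (adic_length A r) / real r ^ d"

definition top_coeff :: "'a set \<Rightarrow> real" where
  "top_coeff I = Polynomial.coeff (Polynomial.coeff (bigraded_hilbert_poly R \<mm> I) 0) d"

lemma multiplicity_seq_0: "multiplicity_seq R \<mm> 0 I = fact d * top_coeff I"
  by (simp add: multiplicity_seq_def dim top_coeff_def)

text \<open>For fixed s the Hilbert polynomial is squeezed between two shifts of one length
  function. The O(r^d) bound limits its degree in r, and shifts do not affect the limit, whose value
  may still depend on s at this point.\<close>

lemma adic_length_pow_tendsto:
  assumes "ideal I R"
  shows "\<exists>N. \<forall>s\<ge>N. scaled_length (ideal_pow I (Suc s))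
    \<longlonglongrightarrow> Polynomial.coeff (poly (bigraded_hilbert_poly R \<mm> I) [:real s:]) d"
proof -
  obtain N where N: "\<And>r s. r \<ge> N \<Longrightarrow> s \<ge> N \<Longrightarrow> ereal_of_enat (bigraded_hilbert_fun R \<mm> I r s)
      = ereal (poly (poly (bigraded_hilbert_poly R \<mm> I) [:real s:]) (real r))"
    using bigraded_hilbert_fun_poly[OF assms] by blast
  have "scaled_length (ideal_pow I (Suc s))
    \<longlonglongrightarrow> Polynomial.coeff (poly (bigraded_hilbert_poly R \<mm> I) [:real s:]) d" if s: "s \<ge> N" for s
  proof -
    define Q where "Q = poly (bigraded_hilbert_poly R \<mm> I) [:real s:]"
    let ?A = "ideal_pow I (Suc s)"
    note A = ideal_pow_ideal[OF assms, of "Suc s"]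
    obtain c where c: "\<And>r. bigraded_hilbert_fun R \<mm> I r s \<le> enat (adic_length ?A (Suc r + c))"
      using bigraded_hilbert_fun_le[OF assms] by blast
    have Q: "real (adic_length ?A (Suc r)) \<le> poly Q (real r)" "poly Q (real r) \<le> real (adic_length ?A (Suc r + c))"
      if r: "r \<ge> N" for r
    proof -
      obtain h where h: "bigraded_hilbert_fun R \<mm> I r s = enat h" using bigraded_hilbert_fun_finite[OF assms] by blast
      then have "poly Q (real r) = real h" using N[OF r s] by (simp add: Q_def)
      then show "real (adic_length ?A (Suc r)) \<le> poly Q (real r)" "poly Q (real r) \<le> real (adic_length ?A (Suc r + c))"
        using bigraded_hilbert_fun_ge[OF assms, of s r] c[of r] h by auto
    qed
    obtain K where K: "\<And>r. real (adic_length ?A (r + (1 + c))) \<le> K * (real r + 1) ^ d"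
      using real_adic_length_le_dim[OF A] by blast
    have "\<bar>poly Q (real r)\<bar> \<le> K * (real r + 1) ^ d" if "r \<ge> N" for r
    proof -
      have "0 \<le> poly Q (real r)" using Q(1)[OF that] of_nat_0_le_iff order_trans by blast
      then show ?thesis using Q(2)[OF that] K[of r] by simp
    qed
    then have "Polynomial.degree Q \<le> d" by (rule poly_degree_le_of_bound)
    then have lim: "(\<lambda>r. poly Q (real r) / real r ^ d) \<longlonglongrightarrow> Polynomial.coeff Q d"
      by (rule poly_over_power_tendsto)
    have "scaled_length ?A \<longlonglongrightarrow> Polynomial.coeff Q d"
    proof (rule tendsto_sandwich[rotated 2])
      show "(\<lambda>r. poly Q (real (r - Suc c)) / real r ^ d) \<longlonglongrightarrow> Polynomial.coeff Q d"
        using tendsto_over_power_shift[OF lim, of "Suc c"] .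
      show "(\<lambda>r. poly Q (real (r - 1)) / real r ^ d) \<longlonglongrightarrow> Polynomial.coeff Q d"
        using tendsto_over_power_shift[OF lim, of 1] .
      show "\<forall>\<^sub>F r in sequentially. poly Q (real (r - Suc c)) / real r ^ d \<le> real (adic_length ?A r) / real r ^ d"
      proof (rule eventually_sequentiallyI[of "N + Suc c"])
        fix r assume "r \<ge> N + Suc c"
        then show "poly Q (real (r - Suc c)) / real r ^ d \<le> real (adic_length ?A r) / real r ^ d"
          using Q(2)[of "r - Suc c"] by (intro divide_right_mono) auto
      qed
      show "\<forall>\<^sub>F r in sequentially. real (adic_length ?A r) / real r ^ d \<le> poly Q (real (r - 1)) / real r ^ d"
      proof (rule eventually_sequentiallyI[of "N + 1"])
        fix r assume "r \<ge> N + 1"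
        then show "real (adic_length ?A r) / real r ^ d \<le> poly Q (real (r - 1)) / real r ^ d"
          using Q(1)[of "r - 1"] by (intro divide_right_mono) auto
      qed
    qed
    then show ?thesis by (simp add: Q_def)
  qed
  then show ?thesis by blast
qed

lemma Assh_annihilates_pow:
  assumes "ideal I R" "p \<in> Assh R" "I \<subseteq> p"
  shows "\<exists>n. \<exists>t\<in>carrier R. t \<notin> p \<and> (\<forall>y\<in>ideal_pow I n. t \<otimes> y = \<zero>)"
proof -
  obtain n t where t: "t \<in> carrier R" "t \<notin> p" "\<And>y. y \<in> ideal_pow p n \<Longrightarrow> t \<otimes> y \<in> {\<zero>}"
    using minimal_prime_pow_annihilated[OF Assh_minimal[OF assms(2)] zeroideal] by blast
  have "ideal_pow I n \<subseteq> ideal_pow p n" by (rule ideal_pow_mono[OF assms(3)])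
  then show ?thesis using t by blast
qed

lemma prime_pow_not_subset:
  assumes "ideal I R" "primeideal p R" "\<not> I \<subseteq> p"
  shows "\<not> ideal_pow I n \<subseteq> p"
proof
  assume sub: "ideal_pow I n \<subseteq> p"
  obtain x where x: "x \<in> I" "x \<notin> p" using assms by blast
  have xc: "x \<in> carrier R" using ideal.Icarr[OF assms(1) x(1)] .
  have "x [^] k \<notin> p" for k :: nat
    by (induction k) (use prime_one[OF assms(2)] primeD[OF assms(2) _ xc] x xc in auto)
  then show False using elem_pow_in_ideal_pow[OF assms(1) x(1), of n] sub by blast
qed

text \<open>Locally at a prime \<open>p\<close> of \<open>Assh R\<close>, which is minimal, a power of \<open>I\<close> vanishes if \<open>I \<subseteq> p\<close>, and
  \<open>J\<^sup>t\<close> is the unit ideal if \<open>p\<close> does not contain \<open>J\<close>.\<close>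

lemma colon_pow_not_subset:
  assumes "ideal I R" "ideal J R" "\<And>p. p \<in> Assh R \<Longrightarrow> J \<subseteq> p \<Longrightarrow> I \<subseteq> p"
  shows "\<exists>N. \<forall>s\<ge>N. \<forall>t. \<forall>p\<in>Assh R. \<not> colon (ideal_pow J t) (ideal_pow I s) \<subseteq> p"
proof -
  have "\<exists>n. I \<subseteq> p \<longrightarrow> (\<exists>t\<in>carrier R. t \<notin> p \<and> (\<forall>y\<in>ideal_pow I n. t \<otimes> y = \<zero>))" if "p \<in> Assh R" for p
    using Assh_annihilates_pow[OF assms(1) that] by blast
  then obtain n where n: "\<And>p. p \<in> Assh R \<Longrightarrow> I \<subseteq> p \<Longrightarrow> \<exists>t\<in>carrier R. t \<notin> p \<and> (\<forall>y\<in>ideal_pow I (n p). t \<otimes> y = \<zero>)"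
    by metis
  \<comment> \<open>A sum over the finite set Assh(R) serves as a common bound for the
    exponents.\<close>
  define N where "N = (\<Sum>p\<in>Assh R. n p)"
  have "\<not> colon (ideal_pow J t) (ideal_pow I s) \<subseteq> p" if s: "s \<ge> N" and p: "p \<in> Assh R" for s t p
  proof (cases "I \<subseteq> p")
    case True
    have "n p \<le> N" unfolding N_def by (rule member_le_sum) (use finite_Assh p in auto)
    then have sub: "ideal_pow I s \<subseteq> ideal_pow I (n p)" using s by (intro ideal_pow_antimono assms) simp
    obtain z where z: "z \<in> carrier R" "z \<notin> p" "\<forall>y\<in>ideal_pow I (n p). z \<otimes> y = \<zero>" using n[OF p True] by blast
    have "z \<otimes> y \<in> ideal_pow J t" if "y \<in> ideal_pow I s" for y
    proof -
      have "z \<otimes> y = \<zero>" using z(3) sub that by blast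
      then show ?thesis using ideal_zeroD[OF ideal_pow_ideal[OF assms(2)]] by simp
    qed
    then have "z \<in> colon (ideal_pow J t) (ideal_pow I s)" using z(1) by (simp add: ideal_colon_def)
    then show ?thesis using z(2) by blast
  next
    case False
    then have "\<not> J \<subseteq> p" using assms(3) p by blast
    then have "\<not> ideal_pow J t \<subseteq> p" by (rule prime_pow_not_subset[OF assms(2) Assh_prime[OF p]])
    moreover have "ideal_pow J t \<subseteq> colon (ideal_pow J t) (ideal_pow I s)"
      by (intro subset_ideal_colon ideal_pow_ideal assms ideal_subset)
    ultimately show ?thesis by blast
  qed
  then show ?thesis by blast
qed

text \<open>For t >= s the module I^s/J^t vanishes locally at every p in Assh(R), so the lengths
  differ by O(r^(d-1)). The case J = I shows independence of s; the case t = s compares two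
  ideals.\<close>

lemma adic_length_pow_limits_eq:
  assumes "ideal I R" "ideal J R" "J \<subseteq> I" "\<And>p. p \<in> Assh R \<Longrightarrow> J \<subseteq> p \<Longrightarrow> I \<subseteq> p"
  shows "\<exists>N. \<forall>s\<ge>N. \<forall>t\<ge>s. \<forall>L L'. scaled_length (ideal_pow I s) \<longlonglongrightarrow> L \<longrightarrow>
    scaled_length (ideal_pow J t) \<longlonglongrightarrow> L' \<longrightarrow> L = L'"
proof -
  obtain N where N: "\<And>s t p. s \<ge> N \<Longrightarrow> p \<in> Assh R \<Longrightarrow> \<not> colon (ideal_pow J t) (ideal_pow I s) \<subseteq> p"
    using colon_pow_not_subset[OF assms(1,2,4)] by blast
  have "L = L'" if st: "s \<ge> N" "t \<ge> s"
    and L: "scaled_length (ideal_pow I s) \<longlonglongrightarrow> L"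
    and L': "scaled_length (ideal_pow J t) \<longlonglongrightarrow> L'" for s t L L'
  proof -
    let ?A = "ideal_pow J t" and ?C = "ideal_pow I s"
    have ids: "ideal ?A R" "ideal ?C R" using ideal_pow_ideal assms by auto
    have sub: "?A \<subseteq> ?C"
      using ideal_pow_mono[OF assms(3), of t] ideal_pow_antimono[OF assms(1) st(2)] by blast
    obtain K where K: "\<And>r. adic_length ?A r \<le> adic_length ?C r + K * (r + 1) ^ (d - 1)"
      using adic_length_diff_le[OF ids sub] N[OF st(1)] by blast
    have "L \<le> L'"
    proof (rule LIMSEQ_le[OF L L'], intro exI allI impI)
      show "real (adic_length ?C r) / real r ^ d \<le> real (adic_length ?A r) / real r ^ d" if "0 \<le> r" for r
        using adic_length_antimono[OF ids sub, of r] by (intro divide_right_mono) auto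
    qed
    moreover have "L' \<le> L"
    proof -
      have "(\<lambda>r. (real r + 1) / real r) \<longlonglongrightarrow> 1" by real_asymp
      then have "(\<lambda>r. ((real r + 1) / real r) ^ (d - 1)) \<longlonglongrightarrow> 1 ^ (d - 1)" by (rule tendsto_power)
      moreover have "(\<lambda>r. real K * inverse (real r)) \<longlonglongrightarrow> 0" by (rule tendsto_mult_right_zero[OF lim_inverse_n])
      ultimately have "(\<lambda>r. real K * inverse (real r) * ((real r + 1) / real r) ^ (d - 1)) \<longlonglongrightarrow> 0 * 1 ^ (d - 1)"
        by (intro tendsto_mult)
      then have lim: "(\<lambda>r. real (adic_length ?C r) / real r ^ d + real K * inverse (real r) * ((real r + 1) / real r) ^ (d - 1)) \<longlonglongrightarrow> L + 0 * 1 ^ (d - 1)"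
        by (rule tendsto_add[OF L])
      have "L' \<le> L + 0 * 1 ^ (d - 1)"
      proof (rule LIMSEQ_le[OF L' lim], intro exI[of _ 1] allI impI)
        fix r :: nat assume r: "1 \<le> r"
        have "real (adic_length ?A r) \<le> real (adic_length ?C r + K * (r + 1) ^ (d - 1))"
          using K[of r] by (simp only: of_nat_le_iff)
        then have "real (adic_length ?A r) / real r ^ d \<le> (real (adic_length ?C r) + real K * (real r + 1) ^ (d - 1)) / real r ^ d"
          by (intro divide_right_mono) (simp_all add: add.commute)
        also have "\<dots> = real (adic_length ?C r) / real r ^ d
            + real K * inverse (real r) * ((real r + 1) / real r) ^ (d - 1)"
        proof -
          have "real r ^ d = real r * real r ^ (d - 1)" using dim_pos by (simp add: power_eq_if)
          moreover have "(a + k * y) / (z * x) = a / (z * x) + k * inverse z * (y / x)" for a k x y z :: real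
            unfolding add_divide_distrib by (simp add: divide_inverse mult_ac)
          ultimately show ?thesis by (simp only: power_divide)
        qed
        finally show "real (adic_length ?A r) / real r ^ d \<le> real (adic_length ?C r) / real r ^ d
            + real K * inverse (real r) * ((real r + 1) / real r) ^ (d - 1)" .
      qed
      then show ?thesis by simp
    qed
    ultimately show ?thesis by simp
  qed
  then show ?thesis by blast
qed

lemma coeff_poly_const:
  "Polynomial.coeff (poly P [:x:]) d = poly (map_poly (\<lambda>p. Polynomial.coeff p d) P) (x::real)"
  by (induction P) (auto simp: map_poly_pCons)

text \<open>The coefficient of r^d in the Hilbert polynomial is a polynomial in s with the same
  value at all large integers. It is therefore constant, equal to its constant term, the coefficient
  of r^d s^0.\<close>

theorem adic_length_pow_tendsto_top_coeff:
  assumes "ideal I R"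
  shows "\<exists>N. \<forall>s\<ge>N. scaled_length (ideal_pow I s) \<longlonglongrightarrow> top_coeff I"
proof -
  define P where "P = map_poly (\<lambda>p. Polynomial.coeff p d) (bigraded_hilbert_poly R \<mm> I)"
  obtain N where N: "\<And>s. s \<ge> N \<Longrightarrow> scaled_length (ideal_pow I (Suc s)) \<longlonglongrightarrow> poly P (real s)"
    using adic_length_pow_tendsto[OF assms] unfolding coeff_poly_const P_def by blast
  obtain M where M: "\<And>s t L L'. s \<ge> M \<Longrightarrow> t \<ge> s \<Longrightarrow>
      scaled_length (ideal_pow I s) \<longlonglongrightarrow> L \<Longrightarrow>
      scaled_length (ideal_pow I t) \<longlonglongrightarrow> L' \<Longrightarrow> L = L'"
    using adic_length_pow_limits_eq[OF assms assms subset_refl] by blast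
  let ?m = "max M N"
  define b where "b = poly P (real ?m)"
  have "poly P (real s) = b" if "s \<ge> ?m" for s
    unfolding b_def
    by (rule M[of "Suc ?m" "Suc s", OF _ _ N N, symmetric]) (use that in auto)
  then have "P = [:b:]" by (intro poly_eqI_nat[of ?m]) simp
  then have "poly P (real s) = Polynomial.coeff P 0" for s by simp
  moreover have "Polynomial.coeff P 0 = top_coeff I" by (simp add: P_def top_coeff_def coeff_map_poly)
  ultimately have "scaled_length (ideal_pow I (Suc s)) \<longlonglongrightarrow> top_coeff I" if "s \<ge> N" for s
    using N[OF that] by (simp del: nat_pow_Suc)
  then have "scaled_length (ideal_pow I s) \<longlonglongrightarrow> top_coeff I" if "s \<ge> Suc N" for s
    using that by (metis Suc_le_D Suc_le_mono)
  then show ?thesis by blast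
qed

section \<open>Dependence of the top coefficient on the primes containing the ideal\<close>

lemma top_coeff_eq_subset:
  assumes "ideal I R" "ideal J R" "J \<subseteq> I" "\<And>p. p \<in> Assh R \<Longrightarrow> J \<subseteq> p \<Longrightarrow> I \<subseteq> p"
  shows "top_coeff I = top_coeff J"
proof -
  obtain N1 where N1: "\<And>s. s \<ge> N1 \<Longrightarrow> scaled_length (ideal_pow I s) \<longlonglongrightarrow> top_coeff I"
    using adic_length_pow_tendsto_top_coeff[OF assms(1)] by blast
  obtain N2 where N2: "\<And>s. s \<ge> N2 \<Longrightarrow> scaled_length (ideal_pow J s) \<longlonglongrightarrow> top_coeff J"
    using adic_length_pow_tendsto_top_coeff[OF assms(2)] by blast
  obtain N3 where N3: "\<And>s t L L'. s \<ge> N3 \<Longrightarrow> t \<ge> s \<Longrightarrow>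
      scaled_length (ideal_pow I s) \<longlonglongrightarrow> L \<Longrightarrow>
      scaled_length (ideal_pow J t) \<longlonglongrightarrow> L' \<Longrightarrow> L = L'"
    using adic_length_pow_limits_eq[OF assms] by blast
  let ?s = "max N1 (max N2 N3)"
  show ?thesis by (rule N3[of ?s ?s]) (auto intro: N1 N2)
qed

text \<open>The module I^s/J^s is supported at p, which adds r^d to the length at argument K r + c.
  Both limits persist along this subsequence, so the gap is at least K^(-d).\<close>

lemma top_coeff_less_subset:
  assumes "ideal I R" "ideal J R" "J \<subseteq> I" "p \<in> Assh R" "J \<subseteq> p" "\<not> I \<subseteq> p"
  shows "top_coeff I < top_coeff J"
proof -
  obtain N1 where N1: "\<And>s. s \<ge> N1 \<Longrightarrow> scaled_length (ideal_pow I s) \<longlonglongrightarrow> top_coeff I"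
    using adic_length_pow_tendsto_top_coeff[OF assms(1)] by blast
  obtain N2 where N2: "\<And>s. s \<ge> N2 \<Longrightarrow> scaled_length (ideal_pow J s) \<longlonglongrightarrow> top_coeff J"
    using adic_length_pow_tendsto_top_coeff[OF assms(2)] by blast
  \<comment> \<open>The successor makes s positive, so that J^s lies in J and hence in p.\<close>
  define s where "s = Suc (max N1 N2)"
  let ?A = "ideal_pow J s" and ?C = "ideal_pow I s"
  note p = Assh_prime[OF assms(4)]
  have ids: "ideal ?A R" "ideal ?C R" using ideal_pow_ideal assms by auto
  have sub: "?A \<subseteq> ?C" by (rule ideal_pow_mono[OF assms(3)])
  have "ideal_pow J s \<subseteq> ideal_pow J (Suc 0)" by (intro ideal_pow_antimono assms) (simp add: s_def)
  then have Jp: "ideal_pow J s \<subseteq> p" using assms(5) unfolding ideal_pow_1[OF assms(2)] by blast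
  have "colon ?A ?C \<subseteq> p"
  proof
    fix y assume y: "y \<in> colon ?A ?C"
    obtain z where z: "z \<in> ?C" "z \<notin> p" using prime_pow_not_subset[OF assms(1) p assms(6), of s] by blast
    have "y \<in> carrier R" "y \<otimes> z \<in> p" using y z(1) Jp by (auto simp: ideal_colon_def)
    then show "y \<in> p" using primeD[OF p _ ideal.Icarr[OF ids(2) z(1)]] z(2) by blast
  qed
  then obtain c K where K: "K > 0" "\<And>r. r \<ge> 1 \<Longrightarrow> adic_length ?C (K * r + c) + r ^ d \<le> adic_length ?A (K * r + c)"
    using adic_length_diff_ge[OF ids sub assms(4)] by blast
  have sm: "strict_mono (\<lambda>r. K * r + c)" using K(1) by (simp add: strict_mono_def)
  have limC: "(\<lambda>r. real (adic_length ?C (K * r + c)) / real (K * r + c) ^ d) \<longlonglongrightarrow> top_coeff I"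
    using LIMSEQ_subseq_LIMSEQ[OF N1[of s] sm] by (simp add: s_def o_def del: nat_pow_Suc)
  have limA: "(\<lambda>r. real (adic_length ?A (K * r + c)) / real (K * r + c) ^ d) \<longlonglongrightarrow> top_coeff J"
    using LIMSEQ_subseq_LIMSEQ[OF N2[of s] sm] by (simp add: s_def o_def del: nat_pow_Suc)
  have "(\<lambda>r. real r / (real K * real r + real c)) \<longlonglongrightarrow> inverse (real K)" using K(1) by real_asymp
  then have "(\<lambda>r. (real r / (real K * real r + real c)) ^ d) \<longlonglongrightarrow> inverse (real K) ^ d" by (rule tendsto_power)
  then have lim: "(\<lambda>r. real (adic_length ?C (K * r + c)) / real (K * r + c) ^ d + (real r / (real K * real r + real c)) ^ d)
      \<longlonglongrightarrow> top_coeff I + inverse (real K) ^ d"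
    by (rule tendsto_add[OF limC])
  have "top_coeff I + inverse (real K) ^ d \<le> top_coeff J"
  proof (rule LIMSEQ_le[OF lim limA], intro exI[of _ 1] allI impI)
    fix r :: nat assume r: "1 \<le> r"
    have "real (adic_length ?C (K * r + c) + r ^ d) \<le> real (adic_length ?A (K * r + c))"
      using K(2)[OF r] by (simp only: of_nat_le_iff)
    then have "(real (adic_length ?C (K * r + c)) + real r ^ d) / real (K * r + c) ^ d \<le> real (adic_length ?A (K * r + c)) / real (K * r + c) ^ d"
      by (intro divide_right_mono) simp_all
    then show "real (adic_length ?C (K * r + c)) / real (K * r + c) ^ d + (real r / (real K * real r + real c)) ^ d
        \<le> real (adic_length ?A (K * r + c)) / real (K * r + c) ^ d"
      by (simp add: add_divide_distrib power_divide)
  qed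
  moreover have "inverse (real K) ^ d > 0" using K(1) by simp
  ultimately show ?thesis by linarith
qed

lemma prime_prod_subset_iff:
  assumes "primeideal p R" "ideal I R" "ideal J R"
  shows "I \<cdot> J \<subseteq> p \<longleftrightarrow> I \<subseteq> p \<or> J \<subseteq> p"
proof
  assume sub: "I \<cdot> J \<subseteq> p"
  show "I \<subseteq> p \<or> J \<subseteq> p"
  proof (rule ccontr)
    assume "\<not> (I \<subseteq> p \<or> J \<subseteq> p)"
    then obtain a b where ab: "a \<in> I" "a \<notin> p" "b \<in> J" "b \<notin> p" by blast
    have "a \<otimes> b \<in> p" using sub ideal_prod.prod[OF ab(1,3)] by (rule subsetD)
    then show False using primeD[OF assms(1) ideal.Icarr[OF assms(2) ab(1)] ideal.Icarr[OF assms(3) ab(3)]] ab by blast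
  qed
qed (use ideal_prod_inter assms in blast)

text \<open>The product I J lies in both ideals, and a prime contains it exactly when it contains
  one of them. Each of I and J can thus be compared with I J by inclusion.\<close>

theorem top_coeff_eq:
  assumes "ideal I R" "ideal J R" "\<And>p. p \<in> Assh R \<Longrightarrow> I \<subseteq> p \<longleftrightarrow> J \<subseteq> p"
  shows "top_coeff I = top_coeff J"
proof -
  have IJ: "ideal (I \<cdot> J) R" "I \<cdot> J \<subseteq> I" "I \<cdot> J \<subseteq> J"
    using ideal_prod_is_ideal ideal_prod_inter assms by auto
  have "top_coeff I = top_coeff (I \<cdot> J)"
    using assms(3) prime_prod_subset_iff[OF Assh_prime assms(1,2)]
    by (intro top_coeff_eq_subset assms IJ) blast
  also have "\<dots> = top_coeff J"
    using assms(3) prime_prod_subset_iff[OF Assh_prime assms(1,2)]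
    by (intro top_coeff_eq_subset[OF assms(2) IJ(1,3), symmetric]) blast
  finally show ?thesis .
qed

text \<open>Under the hypothesis on primes, I J and J lie in the same members of Assh(R), so the
  strict comparison of I with its subideal I J carries over to J.\<close>

theorem top_coeff_less:
  assumes "ideal I R" "ideal J R" "\<And>p. p \<in> Assh R \<Longrightarrow> I \<subseteq> p \<Longrightarrow> J \<subseteq> p"
    and "p \<in> Assh R" "J \<subseteq> p" "\<not> I \<subseteq> p"
  shows "top_coeff I < top_coeff J"
proof -
  have IJ: "ideal (I \<cdot> J) R" "I \<cdot> J \<subseteq> I" "I \<cdot> J \<subseteq> J"
    using ideal_prod_is_ideal ideal_prod_inter assms by auto
  have "top_coeff I < top_coeff (I \<cdot> J)"
    using IJ assms(5) by (intro top_coeff_less_subset[OF assms(1) IJ(1,2) assms(4) _ assms(6)]) blast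
  also have "\<dots> = top_coeff J"
    using assms(3) prime_prod_subset_iff[OF Assh_prime assms(1,2)]
    by (intro top_coeff_eq_subset[OF assms(2) IJ(1,3), symmetric]) blast
  finally show ?thesis .
qed

lemma top_coeff_le:
  assumes "ideal I R" "ideal J R" "\<And>p. p \<in> Assh R \<Longrightarrow> I \<subseteq> p \<Longrightarrow> J \<subseteq> p"
  shows "top_coeff I \<le> top_coeff J"
proof (cases "\<exists>p\<in>Assh R. J \<subseteq> p \<and> \<not> I \<subseteq> p")
  case True
  then show ?thesis using top_coeff_less[OF assms] by (auto intro: less_imp_le)
next
  case False
  then show ?thesis using assms(3) by (intro eq_refl top_coeff_eq assms(1,2)) blast
qed

end

section \<open>Convergence of the first multiplicities\<close>

text \<open>The least positive difference e of two members divides every member, so e = 1. Two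
  consecutive members then generate all large numbers.\<close>

lemma additive_nat_set_gcd_1:
  fixes S :: "nat set"
  assumes add: "\<And>a b. a \<in> S \<Longrightarrow> b \<in> S \<Longrightarrow> a + b \<in> S"
    and ne: "S \<noteq> {}" and pos: "0 \<notin> S" and gcd: "Gcd S = 1"
  shows "\<exists>N. \<forall>n\<ge>N. n \<in> S"
proof -
  have mult: "k * a \<in> S" if "a \<in> S" "k \<ge> 1" for k a
    using that(2) by (induction k rule: dec_induct) (use that(1) add in auto)
  define Q where "Q e \<longleftrightarrow> e > 0 \<and> (\<exists>a\<in>S. a + e \<in> S)" for e
  define e where "e = (LEAST e. Q e)"
  obtain a0 where a0: "a0 \<in> S" using ne by blast
  have "a0 > 0" using a0 pos by (cases a0) auto
  then have "Q a0" using add[OF a0 a0] a0 unfolding Q_def by blast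
  then have "Q e" unfolding e_def by (rule LeastI)
  then have e: "e > 0" "\<exists>a\<in>S. a + e \<in> S" by (simp_all add: Q_def)
  have least: "e \<le> k" if "k > 0" "\<exists>a\<in>S. a + k \<in> S" for k
  proof -
    have "Q k" using that by (simp add: Q_def)
    then show ?thesis unfolding e_def by (rule Least_le)
  qed
  obtain a where a: "a \<in> S" "a + e \<in> S" using e(2) by blast
  have "e dvd b" if b: "b \<in> S" for b
  proof (rule ccontr)
    assume "\<not> e dvd b"
    then have r: "b mod e > 0" by (simp add: mod_greater_zero_iff_not_dvd)
    have "\<exists>x\<in>S. x + b mod e \<in> S"
    proof (cases "b div e = 0")
      case True
      then have "b mod e = b" using e(1) by (simp add: div_eq_0_iff)
      then show ?thesis using add[OF a(1) b] a(1) by auto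
    next
      case False
      define q where "q = b div e"
      \<comment> \<open>This exhibits the remainder \<open>b mod e\<close> as a difference of two
        members, against the minimality of e.\<close>
      have "q * (a + e) + b mod e = q * a + b" unfolding q_def
        by (metis add.assoc add_mult_distrib2 div_mult_mod_eq)
      moreover have "q * a + b \<in> S" "q * (a + e) \<in> S" using False mult a b add by (auto simp: q_def)
      ultimately show ?thesis by metis
    qed
    then have "e \<le> b mod e" using least r by blast
    then show False using mod_less_divisor[OF e(1), of b] by linarith
  qed
  then have "e dvd Gcd S" by (rule Gcd_greatest)
  then have "e = 1" using gcd by simp
  then have a1: "Suc a \<in> S" using a by simp
  \<comment> \<open>For n >= a^2 the quotient by a is at least a, hence above the remainder r, so r
    copies of a can be replaced by a + 1.\<close>
  have "n \<in> S" if n: "n \<ge> a * a" for n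
  proof -
    have "a > 0" using a(1) pos by (metis neq0_conv)
    define q r where "q = n div a" and "r = n mod a"
    have ra: "r < a" unfolding r_def using \<open>a > 0\<close> by simp
    have qa: "q \<ge> a" unfolding q_def using n \<open>a > 0\<close> by (metis div_le_mono nonzero_mult_div_cancel_right neq0_conv)
    have "n = q * a + r" by (simp add: q_def r_def)
    also have "\<dots> = (q - r) * a + r * Suc a" using ra qa by (simp add: diff_mult_distrib)
    finally have nq: "n = (q - r) * a + r * Suc a" .
    have 1: "(q - r) * a \<in> S" using mult[OF a(1)] ra qa by simp
    show ?thesis
    proof (cases "r = 0")
      case False
      then have "r * Suc a \<in> S" using mult[OF a1] by simp
      then show ?thesis using add[OF 1] nq by simp
    qed (use 1 nq in simp)
  qed
  then show ?thesis by blast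
qed

context noetherian_local_ring_dim
begin

lemma Gamma_set_add:
  assumes "graded_family_of_proper_ideals R \<I>" "primeideal p R" "m \<in> Gamma_set p \<I>" "n \<in> Gamma_set p \<I>"
  shows "m + n \<in> Gamma_set p \<I>"
proof -
  have ids: "ideal (\<I> m) R" "ideal (\<I> n) R" and sub: "\<I> m \<cdot> \<I> n \<subseteq> \<I> (m + n)"
    using assms(1) by (auto simp: graded_family_of_proper_ideals_def)
  have "\<not> \<I> m \<cdot> \<I> n \<subseteq> p" using prime_prod_subset_iff[OF assms(2) ids] assms(3,4) by (simp add: Gamma_set_def)
  then show ?thesis using sub assms(3) by (auto simp: Gamma_set_def)
qed

lemma Gamma_set_mult:
  assumes "graded_family_of_proper_ideals R \<I>" "primeideal p R" "m \<in> Gamma_set p \<I>" "k \<ge> 1"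
  shows "k * m \<in> Gamma_set p \<I>"
  using assms(4)
  by (induction k rule: dec_induct) (use assms(3) Gamma_set_add[OF assms(1,2)] in \<open>auto simp: add.commute\<close>)

theorem convergent_top_coeff_iff:
  assumes fam: "graded_family_of_proper_ideals R \<I>"
  shows "convergent (\<lambda>n. top_coeff (\<I> n)) \<longleftrightarrow>
    (\<forall>p \<in> Assh R. Gamma_set p \<I> \<noteq> {} \<longrightarrow> Gcd (Gamma_set p \<I>) = 1)"
proof
  have ids: "ideal (\<I> n) R" for n using fam by (simp add: graded_family_of_proper_ideals_def)
  have mem: "n \<in> Gamma_set p \<I> \<longleftrightarrow> \<not> \<I> n \<subseteq> p" if "n \<ge> 1" for n p using that by (simp add: Gamma_set_def)
  have eqI: "top_coeff (\<I> m) = top_coeff (\<I> n)"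
    if "m \<ge> 1" "n \<ge> 1" "\<And>p. p \<in> Assh R \<Longrightarrow> m \<in> Gamma_set p \<I> \<longleftrightarrow> n \<in> Gamma_set p \<I>" for m n
    using that by (intro top_coeff_eq ids) (simp add: mem)
  {
    assume gcd: "\<forall>p \<in> Assh R. Gamma_set p \<I> \<noteq> {} \<longrightarrow> Gcd (Gamma_set p \<I>) = 1"
    have "\<exists>N. \<forall>n\<ge>N. n \<in> Gamma_set p \<I> \<longleftrightarrow> Gamma_set p \<I> \<noteq> {}" if p: "p \<in> Assh R" for p
    proof (cases "Gamma_set p \<I> = {}")
      case False
      have "\<exists>N. \<forall>n\<ge>N. n \<in> Gamma_set p \<I>"
        by (rule additive_nat_set_gcd_1) (use False gcd p Gamma_set_add[OF fam Assh_prime[OF p]] in \<open>auto simp: Gamma_set_def\<close>)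
      then show ?thesis using False by blast
    qed auto
    then obtain N where N: "\<And>p n. p \<in> Assh R \<Longrightarrow> n \<ge> N p \<Longrightarrow> n \<in> Gamma_set p \<I> \<longleftrightarrow> Gamma_set p \<I> \<noteq> {}"
      by metis
    \<comment> \<open>The successor keeps M positive, since \<open>Gamma_set\<close> does not record
      index 0.\<close>
    define M where "M = Suc (\<Sum>p\<in>Assh R. N p)"
    have M: "N p \<le> M" if "p \<in> Assh R" for p
      unfolding M_def using member_le_sum[of p "Assh R" N] that finite_Assh by auto
    have "top_coeff (\<I> n) = top_coeff (\<I> M)" if n: "n \<ge> M" for n
    proof (rule eqI)
      fix p assume p: "p \<in> Assh R"
      show "n \<in> Gamma_set p \<I> \<longleftrightarrow> M \<in> Gamma_set p \<I>"
        using N[OF p, of n] N[OF p, of M] M[OF p] n by simp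
    qed (use n in \<open>auto simp: M_def\<close>)
    then have "(\<lambda>n. top_coeff (\<I> n)) \<longlonglongrightarrow> top_coeff (\<I> M)"
      by (intro tendsto_eventually eventually_sequentiallyI)
    then show "convergent (\<lambda>n. top_coeff (\<I> n))" by (rule convergentI)
  }
  assume "convergent (\<lambda>n. top_coeff (\<I> n))"
  then obtain L where L: "(\<lambda>n. top_coeff (\<I> n)) \<longlonglongrightarrow> L" unfolding convergent_def by blast
  show "\<forall>p \<in> Assh R. Gamma_set p \<I> \<noteq> {} \<longrightarrow> Gcd (Gamma_set p \<I>) = 1"
  proof (intro ballI impI)
    fix p0 assume p0: "p0 \<in> Assh R" "Gamma_set p0 \<I> \<noteq> {}"
    define B where "B = {p \<in> Assh R. Gamma_set p \<I> \<noteq> {}}"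
    have finB: "finite B" unfolding B_def using finite_Assh by simp
    have "\<forall>p\<in>B. \<exists>n. n \<in> Gamma_set p \<I>" by (auto simp: B_def)
    from bchoice[OF this] obtain \<gamma> where \<gamma>: "\<And>p. p \<in> B \<Longrightarrow> \<gamma> p \<in> Gamma_set p \<I>" by blast
    \<comment> \<open>A product of one member of each nonempty Gamma set; all its positive multiples
      lie in every one of them.\<close>
    define M where "M = (\<Prod>p\<in>B. \<gamma> p)"
    have Mpos: "M \<ge> 1" unfolding M_def using \<gamma> by (intro prod_ge_1) (auto simp: Gamma_set_def)
    have kM: "k * M \<in> Gamma_set p \<I>" if p: "p \<in> B" and k: "k \<ge> 1" for p k
    proof -
      have "\<gamma> p dvd k * M" unfolding M_def using finB p by (intro dvd_mult dvd_prodI) auto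
      then obtain j where j: "k * M = j * \<gamma> p" by (metis dvd_def mult.commute)
      then have "j \<ge> 1" using k Mpos by (cases j) auto
      then show ?thesis unfolding j using p \<gamma> by (intro Gamma_set_mult fam Assh_prime) (auto simp: B_def)
    qed
    have in_B: "p \<in> B" if "p \<in> Assh R" "n \<in> Gamma_set p \<I>" for p n using that by (auto simp: B_def)
    have const: "top_coeff (\<I> (k * M)) = top_coeff (\<I> M)" if k: "k \<ge> 1" for k
    proof (rule eqI)
      show "k * M \<ge> 1" using k Mpos by simp
      fix p assume "p \<in> Assh R"
      then show "k * M \<in> Gamma_set p \<I> \<longleftrightarrow> M \<in> Gamma_set p \<I>"
        using kM[of p k] kM[of p 1] k in_B by auto
    qed (rule Mpos)
    show "Gcd (Gamma_set p0 \<I>) = 1"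
    proof (rule ccontr)
      assume g: "Gcd (Gamma_set p0 \<I>) \<noteq> 1"
      \<comment> \<open>The gcd divides k M, since k M lies in the Gamma set of p0; it could divide
        k M + 1 only if it were 1.\<close>
      have notin: "k * M + 1 \<notin> Gamma_set p0 \<I>" if "k \<ge> 1" for k
      proof
        assume "k * M + 1 \<in> Gamma_set p0 \<I>"
        then have "Gcd (Gamma_set p0 \<I>) dvd k * M + 1" by (rule Gcd_dvd)
        moreover have "Gcd (Gamma_set p0 \<I>) dvd k * M" using kM[of p0 k] p0 that by (intro Gcd_dvd) (simp add: B_def)
        ultimately have "Gcd (Gamma_set p0 \<I>) dvd 1" using dvd_add_right_iff by blast
        then show False using g by simp
      qed
      have M: "\<not> \<I> M \<subseteq> p0" using kM[of p0 1] p0 mem[of M p0] Mpos by (simp add: B_def)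
      note p0i = prime_ideal[OF Assh_prime[OF p0(1)]]
      \<comment> \<open>As members of Assh(R) are minimal primes, those containing X are p0 and the
        ones containing I_M. This makes X a reference ideal, independent of k, lying strictly above
        I_M in top coefficient.\<close>
      let ?X = "\<I> M \<cdot> p0"
      have X: "ideal ?X R" "?X \<subseteq> p0" "?X \<subseteq> \<I> M"
        using ideal_prod_is_ideal[OF ids p0i] ideal_prod_inter[OF ids p0i] by auto
      have less: "top_coeff (\<I> M) < top_coeff ?X"
        by (rule top_coeff_less[OF ids X(1) _ p0(1) X(2) M]) (use X(3) in blast)
      have ge: "top_coeff ?X \<le> top_coeff (\<I> (k * M + 1))" if k: "k \<ge> 1" for k
      proof (rule top_coeff_le[OF X(1) ids])
        fix p assume p: "p \<in> Assh R" "?X \<subseteq> p"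
        then consider "\<I> M \<subseteq> p" | "p0 = p"
          using prime_prod_subset_iff[OF Assh_prime ids p0i] Assh_minimal[OF p(1)] Assh_prime[OF p0(1)]
          by (auto simp: minimal_prime_def)
        then show "\<I> (k * M + 1) \<subseteq> p"
        proof cases
          case 1
          \<comment> \<open>A prime of Assh(R) containing I_M has empty Gamma set, because M belongs
            to every nonempty one.\<close>
          then show ?thesis
            using in_B[OF p(1), of "k * M + 1"] kM[of p 1] mem[of M p] mem[of "k * M + 1" p] Mpos by auto
        next
          case 2
          then show ?thesis using notin[OF k] mem[of "k * M + 1" p0] by simp
        qed
      qed
      have "strict_mono (\<lambda>k. Suc k * M)" "strict_mono (\<lambda>k. Suc k * M + 1)"
        using Mpos by (auto simp: strict_mono_Suc_iff)
      then have lims: "(\<lambda>k. top_coeff (\<I> (Suc k * M))) \<longlonglongrightarrow> L" "(\<lambda>k. top_coeff (\<I> (Suc k * M + 1))) \<longlonglongrightarrow> L"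
        using LIMSEQ_subseq_LIMSEQ[OF L] by (auto simp: o_def)
      have "top_coeff (\<I> (Suc k * M)) = top_coeff (\<I> M)" for k by (rule const) simp
      then have "(\<lambda>k. top_coeff (\<I> M)) \<longlonglongrightarrow> L" using lims(1) by (simp only:)
      then have "L = top_coeff (\<I> M)" using LIMSEQ_unique tendsto_const by blast
      moreover have "top_coeff ?X \<le> L"
      proof (rule LIMSEQ_le_const[OF lims(2)], intro exI allI impI)
        show "top_coeff ?X \<le> top_coeff (\<I> (Suc k * M + 1))" if "0 \<le> k" for k by (rule ge) simp
      qed
      moreover note less
      ultimately show False by linarith
    qed
  qed
qed

end

theorem proposition3p7:
  fixes R :: "('a, 'b) ring_scheme" and \<mm> :: "'a set" and d :: nat and \<I> :: "nat \<Rightarrow> 'a set"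
  assumes "noetherian_local_ring R \<mm>"
    and "krull_dim R = enat d"
    and "d \<ge> 1"
    and "graded_family_of_proper_ideals R \<I>"
  shows "convergent (\<lambda>n. multiplicity_seq R \<mm> 0 (\<I> n)) \<longleftrightarrow>
    (\<forall>p \<in> Assh R. Gamma_set p \<I> \<noteq> {} \<longrightarrow> Gcd (Gamma_set p \<I>) = 1)"
proof -
  interpret noetherian_local_ring R \<mm> by fact
  interpret noetherian_local_ring_dim R \<mm> d by unfold_locales fact+
  have "convergent (\<lambda>n. multiplicity_seq R \<mm> 0 (\<I> n)) \<longleftrightarrow> convergent (\<lambda>n. top_coeff (\<I> n))"
    unfolding multiplicity_seq_0 by (rule convergent_mult_const_iff) simp
  then show ?thesis using convergent_top_coeff_iff[OF assms(4)] by simp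
qed



end
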